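(* Let $k\ge4$ and consider $\mathrm{Ext}_{A_1}^{s,t}(\Sigma^{-2^k}M_k,\mathbb Z_2)$, arranged by stem $n=t-s$ and filtration $s$. For every $i\ge0$ it is, in the indicated stems: (1) $0$ in stems $8i+6$ and $8i+8$; (2) $\mathbb Z_2$ in stem $8i+1$, of filtration $4i$, and $\mathbb Z_2$ in stem $8i+2$, of filtration $4i+1$; (3) in stem $8i+4$: $\mathbb Z_2$ of filtration $4i-k+6$ if $4i-k+6\ge0$, else $0$; in stem $8i+5$: $\mathbb Z_2$ of filtration $4i-k+7$ if $4i-k+7\ge0$, else $0$; (4) in stem $8i+7$: $\mathbb Z/2^{k-4}$ with generator of filtration $4i-k+8$ if $4i-k+8\ge0$, else $\mathbb Z/2^{4i+4}$ with generator of filtration $0$; (5) in stem $8i+3$: $\mathbb Z/2^{k-2}$ with generator of filtration $4i-k+5$ if $4i-k+5\ge0$, else $\mathbb Z/2^{4i+3}$ with generator of filtration $0$.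
   Context: $\mathbb Z_2=\mathbb Z/2$. $A_1$ is the subalgebra of the mod-2 Steenrod algebra generated by $\mathrm{Sq}^1,\mathrm{Sq}^2$. $\Sigma^n$ raises degrees by $n$. Saying that stem $n$ is "$\mathbb Z/2^d$ with generator of filtration $f$" means that $\mathrm{Ext}^{s,s+n}$ is $\mathbb Z_2$ for $f\le s\le f+d-1$ and $0$ for all other $s$, with multiplication by $h_0\in\mathrm{Ext}^{1,1}_{A_1}(\mathbb Z_2,\mathbb Z_2)$ nonzero between consecutive classes ($d$ dots connected by vertical segments); for $d=0$ the group is $0$. The $A_1$-modules $M_k$, $k\ge4$: $\Sigma^{-2^k}M_k$ has the following form (subscripts are degrees; all operations $\mathrm{Sq}^1,\mathrm{Sq}^2$ on basis elements not listed are zero; $\ell\ge0$). (i) $k=4\ell+4$: basis $g_1,\dots,g_{8\ell+2}$; $\mathrm{Sq}^1g_i=g_{i+1}$ for $i$ odd; $\mathrm{Sq}^2g_i=g_{i+2}$ for $i\equiv2,3$ mod $4$ with $i+2\le 8\ell+2$. (ii) $k=4\ell+5$: basis $g_1,\dots,g_{8\ell+4}$; $\mathrm{Sq}^1g_i=g_{i+1}$ for $i$ odd; $\mathrm{Sq}^2g_i=g_{i+2}$ for $i\equiv2,3$ mod $4$ with $i+2\le8\ell+4$. (iii) $k=4\ell+6$: basis $g_1,\dots,g_{8\ell+6},h_{8\ell+4},h_{8\ell+5},h_{8\ell+7},h_{8\ell+8}$; $\mathrm{Sq}^1g_i=g_{i+1}$ for $i$ odd; $\mathrm{Sq}^2g_i=g_{i+2}$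 for $i\equiv2,3$ mod $4$, $i\le8\ell+3$; $\mathrm{Sq}^1h_{8\ell+4}=h_{8\ell+5}$, $\mathrm{Sq}^1h_{8\ell+7}=h_{8\ell+8}$, $\mathrm{Sq}^2h_{8\ell+4}=g_{8\ell+6}$, $\mathrm{Sq}^2h_{8\ell+5}=h_{8\ell+7}$, $\mathrm{Sq}^2g_{8\ell+6}=h_{8\ell+8}$. (iv) $k=4\ell+7$: basis $g_1,\dots,g_{8\ell+6},g_{8\ell+8},h_{8\ell+5},h_{8\ell+6},h_{8\ell+7},h_{8\ell+8},h_{8\ell+9}$; $\mathrm{Sq}^1g_i=g_{i+1}$ for $i$ odd; $\mathrm{Sq}^2g_i=g_{i+2}$ for $i\equiv2,3$ mod $4$, $i\le8\ell+3$, and $\mathrm{Sq}^2g_{8\ell+6}=g_{8\ell+8}$; $\mathrm{Sq}^1h_{8\ell+5}=h_{8\ell+6}$, $\mathrm{Sq}^1h_{8\ell+7}=g_{8\ell+8}$, $\mathrm{Sq}^1h_{8\ell+8}=h_{8\ell+9}$, $\mathrm{Sq}^2h_{8\ell+5}=h_{8\ell+7}$, $\mathrm{Sq}^2h_{8\ell+6}=h_{8\ell+8}$, $\mathrm{Sq}^2h_{8\ell+7}=h_{8\ell+9}$. *)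

theory Defs
  imports
    "HOL-Library.Poly_Mapping"
    "HOL-Library.Z2"
    "HOL-Algebra.Coset"
    "HOL-Algebra.Elementary_Groups"
begin

section \<open>The mod-2 Steenrod algebra and the subalgebra \<open>A\<^sub>1\<close>\<close>

text \<open>
  The Steenrod algebra is the free associative \<open>\<int>/2\<close>-algebra on \<open>Sq\<^sup>1, Sq\<^sup>2, \<dots>\<close> modulo the
  two-sided ideal generated by the Adem relations. The letter \<open>i\<close> of a word stands for
  \<open>Sq\<close> of degree \<open>i + 1\<close>, so that every letter has positive degree and the empty word is
  \<open>Sq\<^sup>0 = 1\<close>.
\<close>

datatype word = Word (letters: "nat list")

instantiation word :: monoid_add
begin
definition "0 = Word []"
definition "v + w = Word (letters v @ letters w)"
instance by standard (auto simp: zero_word_def plus_word_def)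
end

definition word_deg :: "word \<Rightarrow> nat"
  where "word_deg w = sum_list (map Suc (letters w))"

type_synonym free_alg = "word \<Rightarrow>\<^sub>0 bit"

definition free_Sq :: "nat \<Rightarrow> free_alg"
  where "free_Sq i = (case i of 0 \<Rightarrow> 1 | Suc j \<Rightarrow> Poly_Mapping.single (Word [j]) 1)"

definition adem_relator :: "nat \<Rightarrow> nat \<Rightarrow> free_alg"
  where "adem_relator a b = free_Sq a * free_Sq b -
    (\<Sum>c = 0..a div 2. of_nat ((b - c - 1) choose (a - 2 * c)) * (free_Sq (a + b - c) * free_Sq c))"

inductive_set adem_ideal :: "free_alg set" where
  relator: "0 < a \<Longrightarrow> a < 2 * b \<Longrightarrow> adem_relator a b \<in> adem_ideal"
| zero: "0 \<in> adem_ideal"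
| add: "x \<in> adem_ideal \<Longrightarrow> y \<in> adem_ideal \<Longrightarrow> x + y \<in> adem_ideal"
| uminus: "x \<in> adem_ideal \<Longrightarrow> - x \<in> adem_ideal"
| mult_left: "x \<in> adem_ideal \<Longrightarrow> r * x \<in> adem_ideal"
| mult_right: "x \<in> adem_ideal \<Longrightarrow> x * r \<in> adem_ideal"

lemma word_sum_eq_zero_iff: "v + w = (0::word) \<longleftrightarrow> v = 0 \<and> w = 0"
  by (cases v; cases w) (auto simp: zero_word_def plus_word_def)

lemma lookup_zero_times:
  fixes p q :: free_alg
  shows "Poly_Mapping.lookup (p * q) 0 = Poly_Mapping.lookup p 0 * Poly_Mapping.lookup q 0"
proof -
  have inner: "(\<Sum>v. Poly_Mapping.lookup q v when 0 = u + v) = (Poly_Mapping.lookup q 0 when u = 0)" for u :: word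
  proof -
    have "(\<lambda>v. Poly_Mapping.lookup q v when 0 = u + v) = (\<lambda>v. (Poly_Mapping.lookup q 0 when u = 0) when v = 0)"
      using word_sum_eq_zero_iff[of u] by (auto simp: fun_eq_iff when_def eq_commute[of 0])
    then show ?thesis by (simp only: Sum_any_when_equal)
  qed
  have "Poly_Mapping.lookup (p * q) 0 = (\<Sum>u. Poly_Mapping.lookup p u * (\<Sum>v. Poly_Mapping.lookup q v when 0 = u + v))"
    by (simp add: lookup_mult prod_fun_def)
  also have "\<dots> = (\<Sum>u::word. (Poly_Mapping.lookup p 0 * Poly_Mapping.lookup q 0) when u = 0)"
    unfolding inner by (rule arg_cong[where f = Sum_any]) (auto simp: fun_eq_iff when_def)
  finally show ?thesis by (simp only: Sum_any_when_equal)
qed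

lemma lookup_zero_free_Sq: "Poly_Mapping.lookup (free_Sq i) 0 = (if i = 0 then 1 else 0)"
proof (cases i)
  case 0
  then show ?thesis by (simp add: free_Sq_def lookup_one)
next
  case (Suc j)
  then show ?thesis by (simp add: free_Sq_def lookup_single zero_word_def)
qed

lemma lookup_zero_adem_relator:
  assumes "0 < a" "a < 2 * b"
  shows "Poly_Mapping.lookup (adem_relator a b) 0 = 0"
proof -
  have "Poly_Mapping.lookup (of_nat n * (free_Sq (a + b - c) * free_Sq c)) 0 = 0" if "c \<le> a div 2" for n c
    using that assms by (simp add: lookup_zero_times lookup_zero_free_Sq)
  then have "Poly_Mapping.lookup (\<Sum>c = 0..a div 2.
      of_nat ((b - c - 1) choose (a - 2 * c)) * (free_Sq (a + b - c) * free_Sq c)) 0 = 0"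
    unfolding lookup_sum by (intro sum.neutral) auto
  then show ?thesis
    using assms by (simp add: adem_relator_def lookup_minus lookup_zero_times lookup_zero_free_Sq)
qed

lemma lookup_zero_adem_ideal: "x \<in> adem_ideal \<Longrightarrow> Poly_Mapping.lookup x 0 = 0"
  by (induction rule: adem_ideal.induct)
     (auto simp: lookup_zero_adem_relator lookup_zero_times lookup_add)

definition adem_rel :: "free_alg \<Rightarrow> free_alg \<Rightarrow> bool"
  where "adem_rel x y \<longleftrightarrow> x - y \<in> adem_ideal"

lemma equivp_adem_rel: "equivp adem_rel"
proof (rule equivpI)
  show "reflp adem_rel" by (auto simp: reflp_def adem_rel_def intro: adem_ideal.zero)
  show "symp adem_rel"
    unfolding symp_def adem_rel_def using adem_ideal.uminus by (metis minus_diff_eq)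
  show "transp adem_rel"
    unfolding transp_def adem_rel_def using adem_ideal.add
    by (metis diff_add_cancel add_diff_eq)
qed

quotient_type steenrod = free_alg / adem_rel
  by (rule equivp_adem_rel)

instantiation steenrod :: ring_1
begin

lift_definition zero_steenrod :: steenrod is 0 .
lift_definition one_steenrod :: steenrod is 1 .

lift_definition plus_steenrod :: "steenrod \<Rightarrow> steenrod \<Rightarrow> steenrod" is "(+)"
proof -
  fix x x' y y' :: free_alg
  assume "adem_rel x x'" "adem_rel y y'"
  then have "(x - x') + (y - y') \<in> adem_ideal"
    unfolding adem_rel_def by (intro adem_ideal.add)
  then show "adem_rel (x + y) (x' + y')" by (simp add: adem_rel_def algebra_simps)
qed

lift_definition uminus_steenrod :: "steenrod \<Rightarrow> steenrod" is uminus
proof -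
  fix x x' :: free_alg
  assume "adem_rel x x'"
  then have "- (x - x') \<in> adem_ideal"
    unfolding adem_rel_def by (intro adem_ideal.uminus)
  then show "adem_rel (- x) (- x')" by (simp add: adem_rel_def)
qed

lift_definition minus_steenrod :: "steenrod \<Rightarrow> steenrod \<Rightarrow> steenrod" is "(-)"
proof -
  fix x x' y y' :: free_alg
  assume "adem_rel x x'" "adem_rel y y'"
  then have "(x - x') + - (y - y') \<in> adem_ideal"
    unfolding adem_rel_def by (intro adem_ideal.add adem_ideal.uminus)
  then show "adem_rel (x - y) (x' - y')" by (simp add: adem_rel_def algebra_simps)
qed

lift_definition times_steenrod :: "steenrod \<Rightarrow> steenrod \<Rightarrow> steenrod" is "(*)"
proof -
  fix x x' y y' :: free_alg
  assume "adem_rel x x'" "adem_rel y y'"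
  then have "(x - x') * y + x' * (y - y') \<in> adem_ideal"
    unfolding adem_rel_def
    by (intro adem_ideal.add adem_ideal.mult_left adem_ideal.mult_right)
  then show "adem_rel (x * y) (x' * y')" by (simp add: adem_rel_def algebra_simps)
qed

instance
proof
  fix a b c :: steenrod
  show "a * b * c = a * (b * c)"
    by transfer (simp add: equivp_reflp[OF equivp_adem_rel] mult.assoc)
  show "(a + b) * c = a * c + b * c"
    by transfer (simp add: equivp_reflp[OF equivp_adem_rel] algebra_simps)
  show "a * (b + c) = a * b + a * c"
    by transfer (simp add: equivp_reflp[OF equivp_adem_rel] algebra_simps)
  show "a + b + c = a + (b + c)"
    by transfer (simp add: equivp_reflp[OF equivp_adem_rel] add.assoc)
  show "a + b = b + a"
    by transfer (simp add: equivp_reflp[OF equivp_adem_rel] add.commute)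
  show "0 + a = a" "1 * a = a" "a * 1 = a" "- a + a = 0" "a - b = a + - b"
    by (transfer, simp add: equivp_reflp[OF equivp_adem_rel])+
  show "(0::steenrod) \<noteq> 1"
  proof (transfer, unfold adem_rel_def, rule notI)
    assume "(0::free_alg) - 1 \<in> adem_ideal"
    from lookup_zero_adem_ideal[OF this] show False by (simp add: lookup_minus lookup_one)
  qed
qed

end

lift_definition Sq :: "nat \<Rightarrow> steenrod" is free_Sq .

text \<open>The homogeneous part of degree \<open>n\<close>; an element of the quotient is homogeneous if it has a
  homogeneous representative.\<close>

definition steenrod_deg :: "nat \<Rightarrow> steenrod set"
  where "steenrod_deg n = abs_steenrod ` {p. \<forall>w \<in> Poly_Mapping.keys p. word_deg w = n}"

text \<open>The augmentation, i.e. the projection onto degree \<open>0\<close>.\<close>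

lift_definition augmentation :: "steenrod \<Rightarrow> bit" is "\<lambda>p. Poly_Mapping.lookup p 0"
  unfolding adem_rel_def using lookup_zero_adem_ideal by (fastforce simp: lookup_minus)

inductive_set A1 :: "steenrod set" where
  zero: "0 \<in> A1"
| one: "1 \<in> A1"
| Sq1: "Sq 1 \<in> A1"
| Sq2: "Sq 2 \<in> A1"
| add: "a \<in> A1 \<Longrightarrow> b \<in> A1 \<Longrightarrow> a + b \<in> A1"
| mult: "a \<in> A1 \<Longrightarrow> b \<in> A1 \<Longrightarrow> a * b \<in> A1"


section \<open>Graded \<open>A\<^sub>1\<close>-modules\<close>

text \<open>The action is only meaningful for elements of \<open>A1\<close>.\<close>

record 'm gmod =
  piece :: "int \<Rightarrow> 'm set"
  act :: "steenrod \<Rightarrow> 'm \<Rightarrow> 'm"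

definition total :: "'m::ab_group_add gmod \<Rightarrow> 'm set"
  where "total M = {(\<Sum>n\<in>I. x n) | I x. finite I \<and> (\<forall>n\<in>I. x n \<in> piece M n)}"

text \<open>\<open>total M\<close> is the internal direct sum of the pieces. That it has exponent 2
  follows from \<open>1 + 1 = 0\<close> in \<open>A1\<close>.\<close>

definition graded_A1_module :: "'m::ab_group_add gmod \<Rightarrow> bool"
  where "graded_A1_module M \<longleftrightarrow>
    (\<forall>n. 0 \<in> piece M n) \<and>
    (\<forall>n. \<forall>x\<in>piece M n. \<forall>y\<in>piece M n. x - y \<in> piece M n) \<and>
    (\<forall>I x. finite I \<and> (\<forall>n\<in>I. x n \<in> piece M n) \<and> (\<Sum>n\<in>I. x n) = 0 \<longrightarrow> (\<forall>n\<in>I. x n = 0)) \<and>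
    (\<forall>p n. \<forall>a \<in> A1 \<inter> steenrod_deg p. \<forall>x\<in>piece M n. act M a x \<in> piece M (n + int p)) \<and>
    (\<forall>x\<in>total M. act M 1 x = x) \<and>
    (\<forall>a\<in>A1. \<forall>b\<in>A1. \<forall>x\<in>total M. act M (a * b) x = act M a (act M b x)) \<and>
    (\<forall>a\<in>A1. \<forall>b\<in>A1. \<forall>x\<in>total M. act M (a + b) x = act M a x + act M b x) \<and>
    (\<forall>a\<in>A1. \<forall>x\<in>total M. \<forall>y\<in>total M. act M a (x + y) = act M a x + act M a y)"

definition suspension :: "int \<Rightarrow> 'm gmod \<Rightarrow> 'm gmod"
  where "suspension n M = M\<lparr>piece := \<lambda>d. piece M (d - n)\<rparr>"

definition Z2_mod :: "bit gmod"
  where "Z2_mod = \<lparr>piece = (\<lambda>n. if n = 0 then UNIV else {0}), act = (\<lambda>a c. augmentation a * c)\<rparr>"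


section \<open>Ext over \<open>A\<^sub>1\<close>\<close>

text \<open>
  \<open>Ext\<^sup>s\<^sup>,\<^sup>t(M, N)\<close> is the \<open>s\<close>-th cohomology of the degree-preserving part of
  \<open>Hom(B\<^sub>\<bullet>(M), \<Sigma>\<^sup>t N)\<close>, Hom being taken over \<open>A\<^sub>1\<close> and \<open>B\<^sub>\<bullet>(M)\<close> being the bar resolution
  \<open>B\<^sub>s(M) = A\<^sub>1 \<otimes> A\<^sub>1\<^sup>\<otimes>\<^sup>s \<otimes> M\<close> (a free resolution of \<open>M\<close>) with
  \<open>d(a\<^sub>0[a\<^sub>1|\<dots>|a\<^sub>s]m) = \<Sum>\<^sub>i a\<^sub>0[\<dots>|a\<^sub>i a\<^sub>i\<^sub>+\<^sub>1|\<dots>]m + a\<^sub>0[a\<^sub>1|\<dots>|a\<^sub>s\<^sub>-\<^sub>1] a\<^sub>s m\<close>.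
  An \<open>A\<^sub>1\<close>-linear map out of the tensor product \<open>B\<^sub>s(M)\<close> is written as a function of the list
  \<open>[a\<^sub>0, \<dots>, a\<^sub>s]\<close> and of \<open>m\<close> that is additive in each slot and \<open>A\<^sub>1\<close>-linear in \<open>a\<^sub>0\<close>; it is
  extended by \<open>0\<close> outside its domain. All signs are omitted, as \<open>-1 = 1\<close> in \<open>\<int>/2\<close>.
\<close>

definition bar_dom :: "nat \<Rightarrow> 'm::ab_group_add gmod \<Rightarrow> (steenrod list \<times> 'm) set"
  where "bar_dom s M = {(as, m). length as = Suc s \<and> set as \<subseteq> A1 \<and> m \<in> total M}"

definition cochains ::
    "nat \<Rightarrow> int \<Rightarrow> 'm::ab_group_add gmod \<Rightarrow> 'n::ab_group_add gmod \<Rightarrow> (steenrod list \<Rightarrow> 'm \<Rightarrow> 'n) set"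
  where "cochains s t M N = {f.
    (\<forall>as m. (as, m) \<notin> bar_dom s M \<longrightarrow> f as m = 0) \<and>
    (\<forall>(as, m) \<in> bar_dom s M. f as m \<in> total N) \<and>
    (\<forall>(as, m) \<in> bar_dom s M. \<forall>i\<le>s. \<forall>a\<in>A1. \<forall>b\<in>A1.
        f (as[i := a + b]) m = f (as[i := a]) m + f (as[i := b]) m) \<and>
    (\<forall>(as, m) \<in> bar_dom s M. \<forall>m'\<in>total M. f as (m + m') = f as m + f as m') \<and>
    (\<forall>(as, m) \<in> bar_dom s M. \<forall>a\<in>A1. f (as[0 := a * as ! 0]) m = act N a (f as m)) \<and>
    (\<forall>(as, m) \<in> bar_dom s M. \<forall>ds n.
        list_all2 (\<lambda>d a. a \<in> steenrod_deg d) ds as \<and> m \<in> piece M n \<longrightarrow>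
        f as m \<in> piece N (n + int (sum_list ds) - t))}"

definition coboundary ::
    "nat \<Rightarrow> 'm::ab_group_add gmod \<Rightarrow> (steenrod list \<Rightarrow> 'm \<Rightarrow> 'n::ab_group_add) \<Rightarrow>
     (steenrod list \<Rightarrow> 'm \<Rightarrow> 'n)"
  where "coboundary s M f = (\<lambda>as m.
    if (as, m) \<in> bar_dom (Suc s) M
    then (\<Sum>i\<le>s. f (take i as @ [as ! i * as ! Suc i] @ drop (i + 2) as) m)
         + f (butlast as) (act M (last as) m)
    else 0)"

definition cocycles ::
    "nat \<Rightarrow> int \<Rightarrow> 'm::ab_group_add gmod \<Rightarrow> 'n::ab_group_add gmod \<Rightarrow> (steenrod list \<Rightarrow> 'm \<Rightarrow> 'n) set"
  where "cocycles s t M N = {f \<in> cochains s t M N. coboundary s M f = (\<lambda>_ _. 0)}"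

definition coboundaries ::
    "nat \<Rightarrow> int \<Rightarrow> 'm::ab_group_add gmod \<Rightarrow> 'n::ab_group_add gmod \<Rightarrow> (steenrod list \<Rightarrow> 'm \<Rightarrow> 'n) set"
  where "coboundaries s t M N =
    (case s of 0 \<Rightarrow> {\<lambda>_ _. 0} | Suc r \<Rightarrow> coboundary r M ` cochains r t M N)"

definition cocycle_group ::
    "nat \<Rightarrow> int \<Rightarrow> 'm::ab_group_add gmod \<Rightarrow> 'n::ab_group_add gmod \<Rightarrow>
     (steenrod list \<Rightarrow> 'm \<Rightarrow> 'n) monoid"
  where "cocycle_group s t M N =
    \<lparr>carrier = cocycles s t M N, mult = (\<lambda>f g as m. f as m + g as m), one = (\<lambda>_ _. 0)\<rparr>"

definition Ext ::
    "nat \<Rightarrow> int \<Rightarrow> 'm::ab_group_add gmod \<Rightarrow> 'n::ab_group_add gmod \<Rightarrow>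
     (steenrod list \<Rightarrow> 'm \<Rightarrow> 'n) set monoid"
  where "Ext s t M N = cocycle_group s t M N Mod coboundaries s t M N"

text \<open>
  Yoneda composition. A cocycle \<open>f : B\<^sub>s(M) \<rightarrow> \<Sigma>\<^sup>t N\<close> lifts to the chain map
  \<open>B\<^sub>p\<^sub>+\<^sub>s(M) \<rightarrow> \<Sigma>\<^sup>t B\<^sub>p(N)\<close> sending \<open>a\<^sub>0[a\<^sub>1|\<dots>|a\<^sub>p\<^sub>+\<^sub>s]m\<close> to
  \<open>a\<^sub>0[a\<^sub>1|\<dots>|a\<^sub>p] f(1[a\<^sub>p\<^sub>+\<^sub>1|\<dots>|a\<^sub>p\<^sub>+\<^sub>s]m)\<close>, and the product with \<open>h : B\<^sub>p(N) \<rightarrow> \<Sigma>\<^sup>u L\<close> is the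
  composite of \<open>h\<close> with this chain map.
\<close>

definition yoneda_cochain ::
    "nat \<Rightarrow> nat \<Rightarrow> 'm::ab_group_add gmod \<Rightarrow> (steenrod list \<Rightarrow> 'n \<Rightarrow> 'l::ab_group_add) \<Rightarrow>
     (steenrod list \<Rightarrow> 'm \<Rightarrow> 'n) \<Rightarrow> (steenrod list \<Rightarrow> 'm \<Rightarrow> 'l)"
  where "yoneda_cochain p s M h f = (\<lambda>as m.
    if (as, m) \<in> bar_dom (p + s) M
    then h (take (Suc p) as) (f (1 # drop (Suc p) as) m)
    else 0)"

text \<open>The product of \<open>X \<in> Ext\<^sup>p\<^sup>,\<^sup>u(N, L)\<close> and \<open>Y \<in> Ext\<^sup>s\<^sup>,\<^sup>t(M, N)\<close>; the cosets in the union
  coincide.\<close>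

definition yoneda ::
    "nat \<Rightarrow> int \<Rightarrow> nat \<Rightarrow> int \<Rightarrow> 'm::ab_group_add gmod \<Rightarrow> 'l::ab_group_add gmod \<Rightarrow>
     (steenrod list \<Rightarrow> 'n::ab_group_add \<Rightarrow> 'l) set \<Rightarrow> (steenrod list \<Rightarrow> 'm \<Rightarrow> 'n) set \<Rightarrow>
     (steenrod list \<Rightarrow> 'm \<Rightarrow> 'l) set"
  where "yoneda p u s t M L X Y =
    (\<Union>h\<in>X. \<Union>f\<in>Y. coboundaries (p + s) (u + t) M L
        #>\<^bsub>cocycle_group (p + s) (u + t) M L\<^esub> yoneda_cochain p s M h f)"

text \<open>\<open>h\<^sub>0 \<in> Ext\<^sup>1\<^sup>,\<^sup>1(\<int>/2, \<int>/2)\<close> is the class of the cocycle \<open>[a] \<mapsto> \<langle>a, (Sq\<^sup>1)\<^sup>*\<rangle>\<close>. In bidegree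
  \<open>(1,1)\<close> the only coboundary is \<open>0\<close>, so this set is a coset (a singleton).\<close>

definition h0_class :: "(steenrod list \<Rightarrow> bit \<Rightarrow> bit) set"
  where "h0_class = {f \<in> cocycles 1 1 Z2_mod Z2_mod. f [1, Sq 1] 1 = 1}"

definition h0_mult ::
    "nat \<Rightarrow> int \<Rightarrow> 'm::ab_group_add gmod \<Rightarrow> (steenrod list \<Rightarrow> 'm \<Rightarrow> bit) set \<Rightarrow>
     (steenrod list \<Rightarrow> 'm \<Rightarrow> bit) set"
  where "h0_mult s t M Y = yoneda 1 1 s t M Z2_mod h0_class Y"

text \<open>\<open>stem_cyclic M n d f\<close>: stem \<open>n\<close> of \<open>Ext(M, \<int>/2)\<close> is \<open>\<int>/2\<^sup>d\<close> with generator of filtration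
  \<open>f\<close>.\<close>

definition stem_cyclic :: "'m::ab_group_add gmod \<Rightarrow> nat \<Rightarrow> nat \<Rightarrow> nat \<Rightarrow> bool"
  where "stem_cyclic M n d f \<longleftrightarrow>
    (\<forall>s. if f \<le> s \<and> s < f + d
         then Ext s (int s + int n) M Z2_mod \<cong> integer_mod_group 2
         else trivial_group (Ext s (int s + int n) M Z2_mod)) \<and>
    (\<forall>s. f \<le> s \<and> Suc s < f + d \<longrightarrow>
      (\<forall>x \<in> carrier (Ext s (int s + int n) M Z2_mod).
         x \<noteq> \<one>\<^bsub>Ext s (int s + int n) M Z2_mod\<^esub> \<longrightarrow>
         h0_mult s (int s + int n) M x
           \<in> carrier (Ext (Suc s) (int (Suc s) + int n) M Z2_mod)
              - {\<one>\<^bsub>Ext (Suc s) (int (Suc s) + int n) M Z2_mod\<^esub>}))"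

definition stem_zero :: "'m::ab_group_add gmod \<Rightarrow> nat \<Rightarrow> bool"
  where "stem_zero M n \<longleftrightarrow> (\<forall>s. trivial_group (Ext s (int s + int n) M Z2_mod))"


section \<open>The modules \<open>M\<^sub>k\<close>\<close>

datatype label = g_lab nat | h_lab nat

fun label_deg :: "label \<Rightarrow> nat" where
  "label_deg (g_lab i) = i"
| "label_deg (h_lab i) = i"

text \<open>\<open>Mk_basis k\<close> is the basis of \<open>\<Sigma>\<^sup>-\<^sup>2\<^sup>^\<^sup>k M\<^sub>k\<close>; a pair \<open>(x, y)\<close> in \<open>Mk_Sq1 k\<close> resp. \<open>Mk_Sq2 k\<close> says
  that \<open>Sq\<^sup>1 x = y\<close> resp. \<open>Sq\<^sup>2 x = y\<close>. In each definition the four cases are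
  \<open>k = 4 * l + 4\<close>, \<open>k = 4 * l + 5\<close>, \<open>k = 4 * l + 6\<close> and \<open>k = 4 * l + 7\<close>.\<close>

definition Mk_basis :: "nat \<Rightarrow> label set"
  where "Mk_basis k = (let l = (k - 4) div 4; r = (k - 4) mod 4 in
    if r = 0 then g_lab ` {1..8*l+2}
    else if r = 1 then g_lab ` {1..8*l+4}
    else if r = 2 then g_lab ` {1..8*l+6} \<union> h_lab ` {8*l+4, 8*l+5, 8*l+7, 8*l+8}
    else g_lab ` ({1..8*l+6} \<union> {8*l+8}) \<union> h_lab ` {8*l+5, 8*l+6, 8*l+7, 8*l+8, 8*l+9})"

definition Mk_Sq1 :: "nat \<Rightarrow> (label \<times> label) set"
  where "Mk_Sq1 k = (let l = (k - 4) div 4; r = (k - 4) mod 4 in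
    {(g_lab i, g_lab (i + 1)) | i. odd i \<and> g_lab i \<in> Mk_basis k} \<union>
    (if r = 2 then {(h_lab (8*l+4), h_lab (8*l+5)), (h_lab (8*l+7), h_lab (8*l+8))}
     else if r = 3 then {(h_lab (8*l+5), h_lab (8*l+6)), (h_lab (8*l+7), g_lab (8*l+8)),
                         (h_lab (8*l+8), h_lab (8*l+9))}
     else {}))"

definition Mk_Sq2 :: "nat \<Rightarrow> (label \<times> label) set"
  where "Mk_Sq2 k = (let l = (k - 4) div 4; r = (k - 4) mod 4 in
    if r = 0 then {(g_lab i, g_lab (i + 2)) | i. i mod 4 \<in> {2, 3} \<and> i + 2 \<le> 8*l+2}
    else if r = 1 then {(g_lab i, g_lab (i + 2)) | i. i mod 4 \<in> {2, 3} \<and> i + 2 \<le> 8*l+4}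
    else {(g_lab i, g_lab (i + 2)) | i. i mod 4 \<in> {2, 3} \<and> i \<le> 8*l+3} \<union>
      (if r = 2 then {(h_lab (8*l+4), g_lab (8*l+6)), (h_lab (8*l+5), h_lab (8*l+7)),
                      (g_lab (8*l+6), h_lab (8*l+8))}
       else {(g_lab (8*l+6), g_lab (8*l+8)), (h_lab (8*l+5), h_lab (8*l+7)),
             (h_lab (8*l+6), h_lab (8*l+8)), (h_lab (8*l+7), h_lab (8*l+9))}))"

text \<open>Over \<open>\<int>/2\<close> a linear combination of basis elements is the sum over a subset. The sums over
  images below have at most one term; they are \<open>0\<close> for operations that are not listed.\<close>

definition has_Mk_form :: "nat \<Rightarrow> 'm::ab_group_add gmod \<Rightarrow> bool"
  where "has_Mk_form k N \<longleftrightarrow> (\<exists>e :: label \<Rightarrow> 'm.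
    (\<forall>n. piece N n = {(\<Sum>x\<in>S. e x) | S. S \<subseteq> {x \<in> Mk_basis k. int (label_deg x) = n}}) \<and>
    (\<forall>S \<subseteq> Mk_basis k. (\<Sum>x\<in>S. e x) = 0 \<longrightarrow> S = {}) \<and>
    (\<forall>x \<in> Mk_basis k. act N (Sq 1) (e x) = (\<Sum>y \<in> Mk_Sq1 k `` {x}. e y)) \<and>
    (\<forall>x \<in> Mk_basis k. act N (Sq 2) (e x) = (\<Sum>y \<in> Mk_Sq2 k `` {x}. e y)))"

definition is_Mk :: "nat \<Rightarrow> 'm::ab_group_add gmod \<Rightarrow> bool"
  where "is_Mk k M \<longleftrightarrow> graded_A1_module M \<and> has_Mk_form k (suspension (- (2 ^ k)) M)"

end

theory Submission imports Defs "HOL-Library.Function_Algebras"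
begin

text \<open>
  \<open>Ext\<close> is read off from an explicit minimal free resolution. For each \<open>k\<close> there is one complex of
  free \<open>A\<^sub>1\<close>-modules, indexed by all integers \<open>s\<close> and invariant under raising \<open>s\<close> by \<open>4\<close> and the stem by
  \<open>8\<close>; it has at most one generator for each pair of \<open>s\<close> and stem, and an explicit additive contracting
  homotopy shows that it is exact. The module presented by its differential from degree \<open>5\<close> to
  degree \<open>4\<close> is the suspension of \<open>M\<^sub>k\<close> by \<open>-2^k\<close> up to the shift of stems by \<open>8\<close>, in all four cases
  of \<open>k\<close> modulo \<open>4\<close>. As no unit occurs in the differential, the generators are dual to a basis of \<open>Ext\<close>,
  and \<open>h\<^sub>0\<close> is detected by the entries \<open>Sq\<^sup>1\<close> of the differential. To compare with the bar complex, a minimal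
  cover \<open>F \<rightarrow> M\<close> with kernel \<open>K\<close> gives \<open>Ext\<^sup>s(K) = Ext\<^sup>s\<^sup>+\<^sup>1(M)\<close>, compatibly with \<open>h\<^sub>0\<close>, and one
  moves down the syzygies to degree \<open>0\<close>.
\<close>

section \<open>The structure of \<open>A\<^sub>1\<close>\<close>

text \<open>The complex is a complete resolution, with the module as its syzygy at the cut between
  degrees 3 and 4. The part below the cut serves exactness at the cut, which says that
  \<open>eps\<close> kills only boundaries: the homotopy writes \<open>x\<close> as a boundary plus
  an element of the image of \<open>hmap\<close> in degree 4, and that image lies in the span of
  chosen normal forms of the basis elements, where \<open>lift\<close> inverts \<open>eps\<close>.
  The generators sit at the dots of the chart to be proved, and the stem difference of two
  generators determines the degree of the entry between them. The obstacle on the other side is the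
  bar complex, whose cochains are functions on lists. They are additive, not linear, in the module
  slot, so they pull back along any additive graded map. An additive section of the cover thus
  splits the sequence of cochain groups in each degree, and the extra degeneracy
  \<open>contr\<close> shows that a free module has no higher Ext. Minimality makes restriction from
  the cover to its kernel zero on Ext in degree 0; otherwise degree 0 of \<open>K\<close> would be
  larger than degree 1 of \<open>M\<close>.\<close>

declare add_bit_eq_xor [simp del] mult_bit_eq_and [simp del]

lemma bit_add_self [simp]: "x + x = (0::bit)" "x + (x + y) = (y::bit)"
proof -
  show *: "x + x = 0" for x :: bit by (cases x) (simp_all add: add_bit_eq_xor)
  show "x + (x + y) = y" by (simp add: add.assoc [symmetric] *)
qed

text \<open>
  Coordinates with respect to the basis \<open>1\<close>, \<open>Sq\<^sup>1\<close>, \<open>Sq\<^sup>2\<close>, \<open>Sq\<^sup>1Sq\<^sup>2\<close>, \<open>Sq\<^sup>2Sq\<^sup>1\<close>,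
  \<open>Sq\<^sup>1Sq\<^sup>2Sq\<^sup>1 = Sq\<^sup>2Sq\<^sup>2\<close>, \<open>Sq\<^sup>2Sq\<^sup>1Sq\<^sup>2\<close>, \<open>Sq\<^sup>1Sq\<^sup>2Sq\<^sup>1Sq\<^sup>2\<close> of \<open>A\<^sub>1\<close>.
\<close>

datatype v8 = V8 (c0: bit) (c1: bit) (c2: bit) (c3: bit) (c4: bit) (c5: bit) (c6: bit) (c7: bit)

instantiation v8 :: ab_group_add
begin
definition "0 = V8 0 0 0 0 0 0 0 0"
definition "u + v = V8 (c0 u + c0 v) (c1 u + c1 v) (c2 u + c2 v) (c3 u + c3 v)
   (c4 u + c4 v) (c5 u + c5 v) (c6 u + c6 v) (c7 u + c7 v)"
definition "- u = (u::v8)"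
definition "u - v = u + (v::v8)"
instance
  by standard (simp_all add: zero_v8_def plus_v8_def uminus_v8_def minus_v8_def add.assoc add.commute)
end

lemma v8_zero_sel [simp]:
  "c0 0 = 0" "c1 0 = 0" "c2 0 = 0" "c3 0 = 0" "c4 0 = 0" "c5 0 = 0" "c6 0 = 0" "c7 0 = 0"
  by (simp_all add: zero_v8_def)

lemma v8_plus_sel [simp]:
  "c0 (u + v) = c0 u + c0 v" "c1 (u + v) = c1 u + c1 v" "c2 (u + v) = c2 u + c2 v"
  "c3 (u + v) = c3 u + c3 v" "c4 (u + v) = c4 u + c4 v" "c5 (u + v) = c5 u + c5 v"
  "c6 (u + v) = c6 u + c6 v" "c7 (u + v) = c7 u + c7 v"
  by (simp_all add: plus_v8_def)

lemma v8_add_self [simp]: "v + v = (0::v8)" "v + (v + w) = (w::v8)"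
proof -
  show *: "v + v = 0" for v :: v8 by (rule v8.expand) simp
  show "v + (v + w) = w" by (simp add: add.assoc [symmetric] *)
qed

lemma v8_minus [simp]: "u - v = u + (v::v8)" "- u = (u::v8)"
  by (simp_all add: minus_v8_def uminus_v8_def)

abbreviation v8_one :: v8 where "v8_one \<equiv> V8 1 0 0 0 0 0 0 0"

text \<open>Left multiplication by Sq1, and below by Sq2, in coordinates. The tables encode Sq1 Sq1
  = 0, Sq2 Sq2 = Sq1 Sq2 Sq1 and Sq2 Sq1 Sq2 Sq1 = Sq1 Sq2 Sq1 Sq2.\<close>

definition lmul1 :: "v8 \<Rightarrow> v8" where
  "lmul1 v = V8 0 (c0 v) 0 (c2 v) 0 (c4 v) 0 (c6 v)"
definition lmul2 :: "v8 \<Rightarrow> v8" where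
  "lmul2 v = V8 0 0 (c0 v) 0 (c1 v) (c2 v) (c3 v) (c5 v)"

text \<open>
  The eight basis elements are linearly independent because \<open>A\<^sub>1\<close> carries a module structure over the whole
  Steenrod algebra that extends left multiplication. The values of \<open>Sq\<^sup>n\<close> for \<open>n \<ge> 4\<close> are one
  choice compatible with the Adem relations.
\<close>

fun letter_act :: "nat \<Rightarrow> v8 \<Rightarrow> v8" where
  "letter_act i v =
    (if i = 0 then lmul1 v
     else if i = 1 then lmul2 v
     else if i = 2 then lmul1 (lmul2 v)
     else if i = 3 then V8 0 0 0 0 0 0 (c1 v) 0
     else if i = 4 then V8 0 0 0 0 0 0 0 (c1 v)
     else if i = 5 then V8 0 0 0 0 0 0 0 (c0 v)
     else 0)"
declare letter_act.simps [simp del]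

section \<open>The action of the Steenrod algebra on the coordinates\<close>

definition word_act :: "word \<Rightarrow> v8 \<Rightarrow> v8" where
  "word_act w v = foldr letter_act (letters w) v"

lemma letter_act_add: "letter_act i (u + v) = letter_act i u + letter_act i v"
  by (rule v8.expand) (simp add: letter_act.simps lmul1_def lmul2_def)

lemma word_act_zero [simp]: "word_act 0 v = v"
  by (simp add: word_act_def zero_word_def)

lemma word_act_plus: "word_act (w + w') v = word_act w (word_act w' v)"
  by (simp add: word_act_def plus_word_def)

lemma word_act_add: "word_act w (u + v) = word_act w u + word_act w v"
proof -
  have "foldr letter_act js (u + v) = foldr letter_act js u + foldr letter_act js v" for js
    by (induction js) (simp_all add: letter_act_add)
  then show ?thesis by (simp add: word_act_def)
qed

definition free_act :: "free_alg \<Rightarrow> v8 \<Rightarrow> v8" where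
  "free_act p v = (\<Sum>w\<in>Poly_Mapping.keys p. word_act w v)"

definition bscale :: "bit \<Rightarrow> 'a::zero \<Rightarrow> 'a" where "bscale b x = (if b = 0 then 0 else x)"

lemma bscale_simps [simp]: "bscale 0 x = 0" "bscale 1 x = x" "bscale b 0 = 0"
  by (simp_all add: bscale_def)

text \<open>Summing over a common finite superset of two supports makes additivity provable even
  where coefficients cancel.\<close>

lemma free_act_eq:
  assumes "finite W" "Poly_Mapping.keys p \<subseteq> W"
  shows "free_act p v = (\<Sum>w\<in>W. bscale (Poly_Mapping.lookup p w) (word_act w v))"
  unfolding free_act_def using assms
  by (intro sum.mono_neutral_cong_left) (auto simp: bscale_def in_keys_iff)

lemma bscale_add_v8: "bscale (a + b) (x::v8) = bscale a x + bscale b x"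
  by (cases a; cases b) simp_all

lemma free_act_plus: "free_act (p + q) v = free_act p v + free_act q v"
proof -
  let ?W = "Poly_Mapping.keys p \<union> Poly_Mapping.keys q"
  have fin: "finite ?W" by simp
  have "Poly_Mapping.keys (p + q) \<subseteq> ?W" by (rule Poly_Mapping.keys_add)
  then show ?thesis
    using fin by (simp add: free_act_eq[where W = ?W] lookup_add bscale_add_v8 sum.distrib)
qed

lemma free_act_zero [simp]: "free_act 0 v = 0"
  by (simp add: free_act_def)

lemma free_act_single: "free_act (Poly_Mapping.single w 1) v = word_act w v"
  by (simp add: free_act_def)

lemma free_act_add: "free_act p (u + v) = free_act p u + free_act p v"
  by (simp add: free_act_def word_act_add sum.distrib)

text \<open>Coefficient 1 suffices in the \<open>single\<close> case, since every nonzero bit is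
  1.\<close>

lemma free_alg_induct [case_names zero single plus]:
  fixes p :: free_alg
  assumes "P 0" "\<And>w. P (Poly_Mapping.single w 1)" "\<And>p q. P p \<Longrightarrow> P q \<Longrightarrow> P (p + q)"
  shows "P p"
proof (induction p rule: update_induct)
  case (update f a b)
  have "Poly_Mapping.update a b f = f + Poly_Mapping.single a 1"
    using update by (intro poly_mapping_eqI) (auto simp: lookup_update lookup_add lookup_single in_keys_iff when_def)
  then show ?case using assms(2,3) update by simp
qed fact

lemma free_act_times: "free_act (p * q) v = free_act p (free_act q v)"
proof (induction p rule: free_alg_induct)
  case (single w)
  show ?case
  proof (induction q rule: free_alg_induct)
    case zero
    then show ?case using free_act_add[of "Poly_Mapping.single w 1" 0 0] by simp
  next
    case (single w')
    then show ?case by (simp add: mult_single free_act_single word_act_plus)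
  next
    case (plus p q)
    then show ?case by (simp add: distrib_left free_act_plus free_act_add)
  qed
qed (simp_all add: free_act_plus distrib_right)

text \<open>The filtration by degree at least \<open>n\<close>. The top class has degree 6, so level
  7 is zero; this disposes of products of large total degree.\<close>

definition v8_low :: "nat \<Rightarrow> v8 \<Rightarrow> bool" where
  "v8_low n v \<longleftrightarrow> (0 < n \<longrightarrow> c0 v = 0) \<and> (1 < n \<longrightarrow> c1 v = 0) \<and> (2 < n \<longrightarrow> c2 v = 0) \<and>
    (3 < n \<longrightarrow> c3 v = 0 \<and> c4 v = 0) \<and> (4 < n \<longrightarrow> c5 v = 0) \<and> (5 < n \<longrightarrow> c6 v = 0) \<and> (6 < n \<longrightarrow> c7 v = 0)"

text \<open>The basis has degrees 0, 1, 2, 3, 3, 4, 5, 6. The index is an integer because shifted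
  degrees \<open>d - dg n\<close> may be negative, where the piece is zero.\<close>

definition v8_piece :: "int \<Rightarrow> v8 set" where
  "v8_piece d = {v. (d \<noteq> 0 \<longrightarrow> c0 v = 0) \<and> (d \<noteq> 1 \<longrightarrow> c1 v = 0) \<and> (d \<noteq> 2 \<longrightarrow> c2 v = 0) \<and>
    (d \<noteq> 3 \<longrightarrow> c3 v = 0 \<and> c4 v = 0) \<and> (d \<noteq> 4 \<longrightarrow> c5 v = 0) \<and> (d \<noteq> 5 \<longrightarrow> c6 v = 0) \<and> (d \<noteq> 6 \<longrightarrow> c7 v = 0)}"

lemma v8_piece_zero [simp]: "0 \<in> v8_piece d"
  by (simp add: v8_piece_def)

lemma v8_piece_add: "u \<in> v8_piece d \<Longrightarrow> v \<in> v8_piece d \<Longrightarrow> u + v \<in> v8_piece d"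
  by (auto simp: v8_piece_def)

lemma v8_piece_sum: "(\<And>i. i \<in> I \<Longrightarrow> f i \<in> v8_piece d) \<Longrightarrow> (\<Sum>i\<in>I. f i) \<in> v8_piece d"
  by (induction I rule: infinite_finite_induct) (auto intro: v8_piece_add)

lemma letter_act_piece: "v \<in> v8_piece d \<Longrightarrow> letter_act i v \<in> v8_piece (d + int (Suc i))"
  by (auto simp: v8_piece_def letter_act.simps lmul1_def lmul2_def)

lemma word_act_piece: "v \<in> v8_piece d \<Longrightarrow> word_act w v \<in> v8_piece (d + int (word_deg w))"
proof (cases w)
  case (Word js)
  have "v \<in> v8_piece d \<Longrightarrow> foldr letter_act js v \<in> v8_piece (d + int (sum_list (map Suc js)))"
  proof (induction js)
    case (Cons i ls)
    have "foldr letter_act (i # ls) v \<in> v8_piece (d + int (sum_list (map Suc ls)) + int (Suc i))"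
      using letter_act_piece[OF Cons.IH[OF Cons.prems], of i] by simp
    then show ?case by (simp add: ac_simps)
  qed simp
  then show "v \<in> v8_piece d \<Longrightarrow> ?thesis" by (simp add: Word word_act_def word_deg_def)
qed

lemma letter_act_low: "v8_low n v \<Longrightarrow> v8_low (n + Suc i) (letter_act i v)"
  by (auto simp: v8_low_def letter_act.simps lmul1_def lmul2_def)

lemma v8_low_zero: "v8_low 7 v \<longleftrightarrow> v = 0"
  by (cases v) (auto simp: v8_low_def zero_v8_def)

lemma v8_low_mono: "v8_low n v \<Longrightarrow> m \<le> n \<Longrightarrow> v8_low m v"
  by (auto simp: v8_low_def)

text \<open>Letters \<open>i\<close> and \<open>j\<close> have degrees \<open>i + 1\<close> and
  \<open>j + 1\<close>, so the bound 5 means total degree at least 7.\<close>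

lemma letter_act_letter_act_high:
  assumes "i + j \<ge> 5" shows "letter_act i (letter_act j v) = 0"
proof -
  have "v8_low 0 v" by (simp add: v8_low_def)
  from letter_act_low[OF letter_act_low[OF this]]
  have "v8_low (Suc j + Suc i) (letter_act i (letter_act j v))" by simp
  from v8_low_mono[OF this, of 7] assms show ?thesis by (simp add: v8_low_zero)
qed

definition sq_act :: "nat \<Rightarrow> v8 \<Rightarrow> v8" where
  "sq_act n v = (case n of 0 \<Rightarrow> v | Suc j \<Rightarrow> letter_act j v)"

lemma free_act_one [simp]: "free_act 1 v = v"
  by (metis free_act_single single_one word_act_zero)

lemma free_act_free_Sq: "free_act (free_Sq n) v = sq_act n v"
  by (cases n) (simp_all add: free_Sq_def sq_act_def free_act_single word_act_def)

lemma sq_act_values: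
  "sq_act 0 v = v" "sq_act 1 v = lmul1 v" "sq_act 2 v = lmul2 v" "sq_act 3 v = lmul1 (lmul2 v)"
  "sq_act 4 v = V8 0 0 0 0 0 0 (c1 v) 0" "sq_act 5 v = V8 0 0 0 0 0 0 0 (c1 v)"
  "sq_act 6 v = V8 0 0 0 0 0 0 0 (c0 v)"
  by (simp_all add: sq_act_def letter_act.simps numeral_eq_Suc)

lemma sq_act_sq_act_high: "a + b > 6 \<Longrightarrow> sq_act a (sq_act b v) = 0"
proof -
  have "letter_act j v = 0" if "j > 5" for j using that by (simp add: letter_act.simps)
  then show "a + b > 6 \<Longrightarrow> ?thesis"
    by (cases a; cases b) (auto simp: sq_act_def letter_act_letter_act_high)
qed

lemma free_act_of_nat: "free_act (of_nat m) v = (if even m then 0 else v)"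
  by (induction m) (auto simp: free_act_plus)

lemma free_act_sum: "free_act (\<Sum>i\<in>I. p i) v = (\<Sum>i\<in>I. free_act (p i) v)"
  by (induction I rule: infinite_finite_induct) (simp_all add: free_act_plus)

lemma free_alg_char2: "p + p = (0::free_alg)" 
  by (rule poly_mapping_eqI) (simp add: lookup_add)

lemma free_alg_minus: "- q = (q::free_alg)" "p - q = p + (q::free_alg)"
proof -
  show *: "- q = q" for q :: free_alg by (rule minus_unique[OF free_alg_char2])
  show "p - q = p + q" by (subst diff_conv_add_uminus) (simp only: *)
qed

text \<open>Above degree 6 a relator acts as zero for degree reasons. Otherwise only ten pairs
  satisfy \<open>a < 2 * b\<close>, each a computation with \<open>sq_act_values\<close>; this is
  where the values chosen for the higher squares are tested.\<close>

lemma free_act_adem_relator: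
  assumes "0 < a" "a < 2 * b"
  shows "free_act (adem_relator a b) v = 0"
proof -
  have eq: "free_act (adem_relator a b) v = sq_act a (sq_act b v) +
     (\<Sum>c = 0..a div 2. if even ((b - c - 1) choose (a - 2 * c)) then 0 else sq_act (a + b - c) (sq_act c v))"
    by (simp add: adem_relator_def free_alg_minus free_act_plus free_act_sum free_act_of_nat
          free_act_times free_act_free_Sq)
  show ?thesis
  proof (cases "a + b > 6")
    case True
    then have "sq_act (a + b - c) (sq_act c v) = 0" if "c \<in> {0..a div 2}" for c
      using that by (intro sq_act_sq_act_high) auto
    then have "(\<Sum>c = 0..a div 2. if even ((b - c - 1) choose (a - 2 * c)) then 0
        else sq_act (a + b - c) (sq_act c v)) = 0"
      by (intro sum.neutral) simp
    then show ?thesis using True unfolding eq by (simp add: sq_act_sq_act_high)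
  next
    case False
    then have "a \<in> {1,2,3,4,5,6}" "b \<in> {1,2,3,4,5,6}" using assms by auto
    with False assms have "(a, b) \<in> {(1,1),(1,2),(1,3),(1,4),(1,5),(2,2),(2,3),(2,4),(3,2),(3,3)}"
      by auto
    \<comment> \<open>In the remaining pairs \<open>a\<close> is at most 3, so the Adem sum has one
      or two terms.\<close>
    moreover from this have "a div 2 = (if a = 1 then 0 else 1)" by auto
    then have sum_eq: "(\<Sum>c = 0..a div 2. f c) = (if a = 1 then f 0 else f 0 + f 1)" for f :: "nat \<Rightarrow> v8"
      by simp
    ultimately show ?thesis unfolding eq sum_eq
      by (elim insertE emptyE Pair_inject; hypsubst)
        (simp_all add: sq_act_values choose_one choose_two binomial_eq_0 lmul1_def lmul2_def zero_v8_def plus_v8_def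
          flip: One_nat_def)
  qed
qed

lemma free_act_adem_ideal: "p \<in> adem_ideal \<Longrightarrow> free_act p v = 0"
proof (induction p arbitrary: v rule: adem_ideal.induct)
  case (mult_left x r)
  then show ?case using free_act_add[of r 0 0] by (simp add: free_act_times)
qed (simp_all add: free_act_adem_relator free_act_plus free_alg_minus free_act_times)

lift_definition st_act :: "steenrod \<Rightarrow> v8 \<Rightarrow> v8" is free_act
proof -
  fix p q assume "adem_rel p q"
  then have "free_act (p - q) v = 0" for v by (simp only: adem_rel_def free_act_adem_ideal)
  then have "free_act p v + free_act q v = 0" for v by (simp add: free_alg_minus free_act_plus)
  then show "free_act p = free_act q" by (metis ext v8_minus(2) minus_unique)
qed

lemma st_act_plus: "st_act (a + b) v = st_act a v + st_act b v"
  by transfer (rule free_act_plus)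

lemma st_act_times: "st_act (a * b) v = st_act a (st_act b v)"
  by transfer (rule free_act_times)

lemma st_act_one [simp]: "st_act 1 v = v"
  by transfer simp

lemma st_act_zero [simp]: "st_act 0 v = 0"
  by transfer simp

lemma st_act_add: "st_act a (u + v) = st_act a u + st_act a v"
  by transfer (rule free_act_add)

lemma st_act_zero_right [simp]: "st_act a 0 = 0"
  using st_act_add[of a 0 0] by simp

lemma st_act_Sq: "st_act (Sq 1) v = lmul1 v" "st_act (Sq 2) v = lmul2 v"
  by (transfer, simp add: free_act_free_Sq sq_act_def letter_act.simps numeral_2_eq_2)+

lemma st_act_piece:
  assumes "a \<in> steenrod_deg p" "v \<in> v8_piece d"
  shows "st_act a v \<in> v8_piece (d + int p)"
proof -
  from assms(1) obtain q where q: "a = abs_steenrod q" "\<forall>w\<in>Poly_Mapping.keys q. word_deg w = p"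
    by (auto simp: steenrod_deg_def)
  have "free_act q v \<in> v8_piece (d + int p)"
    unfolding free_act_def using q(2) word_act_piece[OF assms(2)] by (intro v8_piece_sum) auto
  then show ?thesis by (simp add: q(1) st_act.abs_eq)
qed

lemma steenrod_char2: "x + x = (0::steenrod)"
  by transfer (simp add: free_alg_char2 adem_rel_def adem_ideal.zero)

lemma adem_relation:
  assumes "0 < a" "a < 2 * b"
  shows "Sq a * Sq b =
    (\<Sum>c = 0..a div 2. of_nat ((b - c - 1) choose (a - 2 * c)) * (Sq (a + b - c) * Sq c))"
proof -
  have n: "of_nat n = abs_steenrod (of_nat n)" for n
    by (induction n) (simp_all add: zero_steenrod.abs_eq one_steenrod.abs_eq plus_steenrod.abs_eq)
  have s: "(\<Sum>i\<in>I. abs_steenrod (f i)) = abs_steenrod (\<Sum>i\<in>I. f i)" if "finite I" for I :: "nat set" and f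
    using that by induction (simp_all add: zero_steenrod.abs_eq plus_steenrod.abs_eq)
  have "abs_steenrod (free_Sq a * free_Sq b) = abs_steenrod
     (\<Sum>c = 0..a div 2. of_nat ((b - c - 1) choose (a - 2 * c)) * (free_Sq (a + b - c) * free_Sq c))"
    unfolding steenrod.abs_eq_iff adem_rel_def using adem_ideal.relator[OF assms] by (simp add: adem_relator_def)
  then show ?thesis by (simp add: Sq.abs_eq times_steenrod.abs_eq n s)
qed

lemma Sq_0: "Sq 0 = 1"
  by transfer (simp add: free_Sq_def adem_rel_def adem_ideal.zero)

lemma Sq1_Sq1: "Sq 1 * Sq 1 = 0"
  using adem_relation[of 1 1] by simp

text \<open>The Adem relation for 2, 2 gives Sq3 Sq1, and the one for 1, 2 identifies Sq3 with Sq1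
  Sq2.\<close>

lemma Sq2_Sq2: "Sq 2 * Sq 2 = Sq 1 * Sq 2 * Sq 1"
  using adem_relation[of 1 2] adem_relation[of 2 2] by (simp add: Sq_0 numeral_eq_Suc mult.assoc)

section \<open>Coordinates on A_1 and their degrees\<close>

definition v8_elt :: "v8 \<Rightarrow> steenrod" where
  "v8_elt v = bscale (c0 v) 1 + bscale (c1 v) (Sq 1) + bscale (c2 v) (Sq 2) + bscale (c3 v) (Sq 1 * Sq 2)
    + bscale (c4 v) (Sq 2 * Sq 1) + bscale (c5 v) (Sq 1 * Sq 2 * Sq 1) + bscale (c6 v) (Sq 2 * Sq 1 * Sq 2)
    + bscale (c7 v) (Sq 1 * Sq 2 * Sq 1 * Sq 2)"

lemma bscale_add_steenrod: "bscale (a + b) (x::steenrod) = bscale a x + bscale b x"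
  by (cases a; cases b) (simp_all add: steenrod_char2)

lemma v8_elt_add: "v8_elt (u + v) = v8_elt u + v8_elt v"
  by (simp add: v8_elt_def bscale_add_steenrod ac_simps)

lemma bscale_mult_left: "x * bscale a (y::steenrod) = bscale a (x * y)"
  by (simp add: bscale_def)

lemma v8_elt_zero [simp]: "v8_elt 0 = 0"
  by (simp add: v8_elt_def)

lemma v8_elt_one [simp]: "v8_elt v8_one = 1"
  by (simp add: v8_elt_def)

lemma Sq1_v8_elt: "Sq 1 * v8_elt v = v8_elt (lmul1 v)"
proof -
  have *: "Sq 1 * (Sq 1 * x) = 0" for x using Sq1_Sq1 by (metis mult.assoc mult_zero_left)
  show ?thesis
    by (simp add: v8_elt_def lmul1_def distrib_left bscale_mult_left Sq1_Sq1 mult.assoc * del: One_nat_def)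
qed

lemma Sq2_v8_elt: "Sq 2 * v8_elt v = v8_elt (lmul2 v)"
proof -
  have 1: "Sq 1 * (Sq 1 * x) = 0" for x using Sq1_Sq1 by (metis mult.assoc mult_zero_left)
  have 2: "Sq 2 * (Sq 2 * x) = Sq 1 * (Sq 2 * (Sq 1 * x))" for x using Sq2_Sq2 by (metis mult.assoc)
  have 3: "Sq 2 * Sq 2 = Sq 1 * (Sq 2 * Sq 1)" using Sq2_Sq2 by (simp add: mult.assoc)
  \<comment> \<open>Both sides are Sq2 Sq2 Sq2 x, with the relation applied to the left or to the
    right pair of factors.\<close>
  have 4: "Sq 2 * (Sq 1 * (Sq 2 * (Sq 1 * x))) = Sq 1 * (Sq 2 * (Sq 1 * (Sq 2 * x)))" for x
    by (metis 2)
  have 5: "Sq 2 * (Sq 1 * (Sq 2 * Sq 1)) = Sq 1 * (Sq 2 * (Sq 1 * Sq 2))"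
    using 4[of 1] by (simp del: One_nat_def)
  show ?thesis
    by (simp add: v8_elt_def lmul2_def distrib_left bscale_mult_left Sq1_Sq1 mult.assoc 1 2 3 4 5
        ac_simps(1-4) del: One_nat_def)
qed

text \<open>The span of the eight monomials is stable under Sq1 and Sq2, with the tables
  \<open>lmul1\<close> and \<open>lmul2\<close> as matrices. At \<open>v8_one\<close> this shows
  that the monomials span \<open>A1\<close>; their independence is
  \<open>A1_coords_v8_elt\<close>.\<close>

lemma A1_mult_v8_elt: "a \<in> A1 \<Longrightarrow> a * v8_elt v = v8_elt (st_act a v)"
proof (induction a arbitrary: v rule: A1.induct)
  case Sq1 then show ?case using Sq1_v8_elt st_act_Sq by simp
next
  case Sq2 then show ?case using Sq2_v8_elt st_act_Sq by simp
next
  case (mult a b) then show ?case by (simp add: st_act_times mult.assoc)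
qed (simp_all add: st_act_plus v8_elt_add distrib_right)

definition A1_coords :: "steenrod \<Rightarrow> v8" where "A1_coords a = st_act a v8_one"

lemma v8_elt_A1_coords: "a \<in> A1 \<Longrightarrow> v8_elt (A1_coords a) = a"
  using A1_mult_v8_elt[of a v8_one] by (simp add: A1_coords_def)

lemma A1_coords_v8_elt [simp]: "A1_coords (v8_elt v) = v"
  by (rule v8.expand)
     (simp add: A1_coords_def v8_elt_def st_act_plus st_act_times st_act_Sq lmul1_def lmul2_def
       bscale_def del: One_nat_def)

lemma v8_elt_in_A1: "v8_elt v \<in> A1"
  by (auto simp: v8_elt_def bscale_def simp del: One_nat_def intro!: A1.intros)

lemma A1_coords_plus [simp]: "A1_coords (a + b) = A1_coords a + A1_coords b"
  by (simp add: A1_coords_def st_act_plus)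

lemma A1_coords_simps [simp]: "A1_coords 0 = 0" "A1_coords 1 = v8_one"
   "A1_coords (Sq (Suc 0)) = V8 0 1 0 0 0 0 0 0" "A1_coords (Sq 2) = V8 0 0 1 0 0 0 0 0"
  using st_act_Sq by (simp_all add: A1_coords_def lmul1_def lmul2_def)

lemma A1_coords_times: "A1_coords (a * b) = st_act a (A1_coords b)"
  by (simp add: A1_coords_def st_act_times)

lemma A1_coords_piece: "a \<in> steenrod_deg p \<Longrightarrow> A1_coords a \<in> v8_piece (int p)"
  using st_act_piece[of a p v8_one 0] by (simp add: A1_coords_def v8_piece_def)

lemma zero_in_steenrod_deg: "0 \<in> steenrod_deg p"
  unfolding steenrod_deg_def zero_steenrod.abs_eq by (intro imageI) simp

lemma steenrod_deg_mult:
  assumes "a \<in> steenrod_deg p" "b \<in> steenrod_deg q"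
  shows "a * b \<in> steenrod_deg (p + q)"
proof -
  from assms obtain x y where x: "a = abs_steenrod x" "\<forall>w\<in>Poly_Mapping.keys x. word_deg w = p"
    and y: "b = abs_steenrod y" "\<forall>w\<in>Poly_Mapping.keys y. word_deg w = q"
    by (auto simp: steenrod_deg_def)
  have "word_deg (v + w) = word_deg v + word_deg w" for v w
    by (simp add: word_deg_def plus_word_def)
  then have "\<forall>w\<in>Poly_Mapping.keys (x * y). word_deg w = p + q"
    using keys_mult[of x y] x(2) y(2) by fastforce
  then show ?thesis by (auto simp: x(1) y(1) times_steenrod.abs_eq steenrod_deg_def)
qed

lemma one_in_steenrod_deg: "1 \<in> steenrod_deg 0"
  unfolding steenrod_deg_def one_steenrod.abs_eq by (intro imageI) (simp add: word_deg_def zero_word_def)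

lemma Sq_in_steenrod_deg: "Sq n \<in> steenrod_deg n"
  unfolding steenrod_deg_def Sq.abs_eq
  by (intro imageI) (simp add: free_Sq_def word_deg_def zero_word_def split: nat.split)

lemma bscale_steenrod_deg: "(b = 1 \<Longrightarrow> x \<in> steenrod_deg p) \<Longrightarrow> bscale b x \<in> steenrod_deg p"
  by (cases b) (auto simp: zero_in_steenrod_deg)

lemma add_in_steenrod_deg: "a \<in> steenrod_deg p \<Longrightarrow> b \<in> steenrod_deg p \<Longrightarrow> a + b \<in> steenrod_deg p"
  unfolding steenrod_deg_def using Poly_Mapping.keys_add
  by (fastforce simp: plus_steenrod.abs_eq)

lemma steenrod_deg_Sqs:
  "Sq 1 * Sq 2 \<in> steenrod_deg 3" "Sq 2 * Sq 1 \<in> steenrod_deg 3" "Sq 1 * Sq 2 * Sq 1 \<in> steenrod_deg 4"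
  "Sq 2 * Sq 1 * Sq 2 \<in> steenrod_deg 5" "Sq 1 * Sq 2 * Sq 1 * Sq 2 \<in> steenrod_deg 6"
  using steenrod_deg_mult[of "Sq 1" 1 "Sq 2" 2] steenrod_deg_mult[of "Sq 2" 2 "Sq 1" 1]
    steenrod_deg_mult[of "Sq 1 * Sq 2" 3 "Sq 1" 1] steenrod_deg_mult[of "Sq 2 * Sq 1" 3 "Sq 2" 2]
    steenrod_deg_mult[of "Sq 1 * Sq 2 * Sq 1" 4 "Sq 2" 2]
  by (simp_all add: Sq_in_steenrod_deg del: One_nat_def)

lemma v8_elt_deg: "v \<in> v8_piece (int p) \<Longrightarrow> v8_elt v \<in> steenrod_deg p"
  unfolding v8_elt_def
  by (intro add_in_steenrod_deg bscale_steenrod_deg)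
     (auto simp: v8_piece_def one_in_steenrod_deg steenrod_deg_Sqs Sq_in_steenrod_deg
        simp del: One_nat_def)

lemma augmentation_simps [simp]:
  "augmentation 0 = 0" "augmentation 1 = 1" "augmentation (a + b) = augmentation a + augmentation b"
  "augmentation (a * b) = augmentation a * augmentation b"
  "augmentation (Sq n) = (if n = 0 then 1 else 0)"
  by (transfer; simp add: lookup_one lookup_add lookup_zero_times lookup_zero_free_Sq)+

lemma c0_st_act: "a \<in> A1 \<Longrightarrow> c0 (st_act a v) = augmentation a * c0 v"
  by (induction a arbitrary: v rule: A1.induct)
     (simp_all add: st_act_plus st_act_times distrib_right st_act_Sq lmul1_def lmul2_def mult.assoc del: One_nat_def)

lemma augmentation_A1_coords: "a \<in> A1 \<Longrightarrow> augmentation a = c0 (A1_coords a)"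
  by (simp add: A1_coords_def c0_st_act)

text \<open>The coefficient of Sq1 is a derivation relative to the augmentation. This makes the dual
  of Sq1 a bar cocycle.\<close>

lemma c1_st_act: "a \<in> A1 \<Longrightarrow> c1 (st_act a v) = augmentation a * c1 v + c1 (A1_coords a) * c0 v"
proof (induction a arbitrary: v rule: A1.induct)
  case (mult a b)
  then show ?case by (simp add: A1_coords_times st_act_times distrib_left distrib_right c0_st_act ac_simps augmentation_A1_coords)
next
  case (add a b)
  then show ?case by (simp add: st_act_plus algebra_simps)
qed (simp_all add: st_act_Sq lmul1_def lmul2_def A1_coords_def del: One_nat_def)

section \<open>Graded modules and cochains\<close>

locale gmodule =
  fixes M :: "'m::ab_group_add gmod"
  assumes graded: "graded_A1_module M"
begin

lemmas graded_conjs = graded [unfolded graded_A1_module_def]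

lemma piece_zero [simp]: "0 \<in> piece M n"
  using graded_conjs[THEN conjunct1] by blast

lemma piece_diff: "x \<in> piece M n \<Longrightarrow> y \<in> piece M n \<Longrightarrow> x - y \<in> piece M n"
  using graded_conjs[THEN conjunct2, THEN conjunct1] by blast

lemma piece_indep:
  "finite I \<Longrightarrow> (\<And>n. n \<in> I \<Longrightarrow> f n \<in> piece M n) \<Longrightarrow> (\<Sum>n\<in>I. f n) = 0 \<Longrightarrow> n \<in> I \<Longrightarrow> f n = 0"
  using graded_conjs[THEN conjunct2, THEN conjunct2, THEN conjunct1] by blast

lemma act_piece:
  "a \<in> A1 \<Longrightarrow> a \<in> steenrod_deg p \<Longrightarrow> x \<in> piece M n \<Longrightarrow> act M a x \<in> piece M (n + int p)"
  using graded_conjs[THEN conjunct2, THEN conjunct2, THEN conjunct2, THEN conjunct1] by blast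

lemmas act_conjs = graded_conjs[THEN conjunct2, THEN conjunct2, THEN conjunct2, THEN conjunct2]

lemma act_one: "x \<in> total M \<Longrightarrow> act M 1 x = x"
  using act_conjs[THEN conjunct1] by blast

lemma act_mult: "a \<in> A1 \<Longrightarrow> b \<in> A1 \<Longrightarrow> x \<in> total M \<Longrightarrow> act M (a * b) x = act M a (act M b x)"
  using act_conjs[THEN conjunct2, THEN conjunct1] by blast

lemma act_plus: "a \<in> A1 \<Longrightarrow> b \<in> A1 \<Longrightarrow> x \<in> total M \<Longrightarrow> act M (a + b) x = act M a x + act M b x"
  using act_conjs[THEN conjunct2, THEN conjunct2, THEN conjunct1] by blast

lemma act_add: "a \<in> A1 \<Longrightarrow> x \<in> total M \<Longrightarrow> y \<in> total M \<Longrightarrow> act M a (x + y) = act M a x + act M a y"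
  using act_conjs[THEN conjunct2, THEN conjunct2, THEN conjunct2] by blast

lemma piece_add: "x \<in> piece M n \<Longrightarrow> y \<in> piece M n \<Longrightarrow> x + y \<in> piece M n"
  using piece_diff[of x n "0 - y"] piece_diff[of 0 n y] by simp

lemma piece_subset_total: "x \<in> piece M n \<Longrightarrow> x \<in> total M"
  unfolding total_def by (rule CollectI, rule exI[of _ "{n}"], rule exI[of _ "\<lambda>_. x"]) simp

lemma zero_in_total [simp]: "0 \<in> total M"
  using piece_subset_total[OF piece_zero] .

lemma totalE:
  assumes "x \<in> total M"
  obtains I f where "finite I" "\<And>n. f n \<in> piece M n" "x = (\<Sum>n\<in>I. f n)"
proof -
  from assms obtain I f where f: "finite I" "\<forall>n\<in>I. f n \<in> piece M n" "x = (\<Sum>n\<in>I. f n)"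
    by (auto simp: total_def)
  show thesis
    using f by (intro that[of I "\<lambda>n. if n \<in> I then f n else 0"]) simp_all
qed

lemma total_add:
  assumes "x \<in> total M" "y \<in> total M" shows "x + y \<in> total M"
proof -
  obtain I f where f: "finite I" "\<And>n. f n \<in> piece M n" "x = (\<Sum>n\<in>I. f n)" by (rule totalE[OF assms(1)]) blast
  obtain J g where g: "finite J" "\<And>n. g n \<in> piece M n" "y = (\<Sum>n\<in>J. g n)" by (rule totalE[OF assms(2)]) blast
  have "x = (\<Sum>n\<in>I \<union> J. if n \<in> I then f n else 0)"
    using f(1,3) g(1) by (simp add: sum.If_cases Int_absorb1)
  moreover have "y = (\<Sum>n\<in>I \<union> J. if n \<in> J then g n else 0)"
    using g(1,3) f(1) by (simp add: sum.If_cases Int_absorb1 Un_commute)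
  ultimately have "x + y = (\<Sum>n\<in>I \<union> J. (if n \<in> I then f n else 0) + (if n \<in> J then g n else 0))"
    by (simp add: sum.distrib)
  then show ?thesis unfolding total_def using f g
    by (intro CollectI exI[of _ "I \<union> J"] exI conjI) (auto intro!: piece_add)
qed

lemma total_induct [consumes 1, case_names piece add]:
  assumes "x \<in> total M"
    and "\<And>n x. x \<in> piece M n \<Longrightarrow> P x"
    and "\<And>x y. x \<in> total M \<Longrightarrow> y \<in> total M \<Longrightarrow> P x \<Longrightarrow> P y \<Longrightarrow> P (x + y)"
  shows "P x"
proof -
  obtain I f where f: "finite I" "\<And>n. f n \<in> piece M n" "x = (\<Sum>n\<in>I. f n)" by (rule totalE[OF assms(1)]) blast
  from f(1) have "P (\<Sum>n\<in>I. f n) \<and> (\<Sum>n\<in>I. f n) \<in> total M"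
  proof induction
    case empty
    show ?case using assms(2)[OF piece_zero] by simp
  next
    case (insert i I)
    with assms(3)[of "f i" "sum f I"] show ?case
      using assms(2)[OF f(2)] piece_subset_total[OF f(2)] by (simp add: total_add)
  qed
  then show ?thesis by (simp add: f(3))
qed

lemma act_zero: "x \<in> total M \<Longrightarrow> act M 0 x = 0"
  using act_plus[of 0 0 x] by (simp add: A1.zero)

lemma act_zero_right: "a \<in> A1 \<Longrightarrow> act M a 0 = 0"
  using act_add[of a 0 0] by simp

text \<open>An element of \<open>A1\<close> need not be homogeneous, so the argument runs through
  the generators, which are.\<close>

lemma act_total: "a \<in> A1 \<Longrightarrow> x \<in> total M \<Longrightarrow> act M a x \<in> total M"
proof (induction a arbitrary: x rule: A1.induct)
  case Sq1
  from Sq1.prems show ?case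
    by (induction rule: total_induct)
      (auto intro: act_piece[OF A1.Sq1 Sq_in_steenrod_deg] piece_subset_total total_add simp: act_add A1.Sq1
        simp del: One_nat_def)
next
  case Sq2
  from Sq2.prems show ?case
    by (induction rule: total_induct)
      (auto intro: act_piece[OF A1.Sq2 Sq_in_steenrod_deg] piece_subset_total total_add simp: act_add A1.Sq2)
qed (auto simp: act_zero act_one act_plus act_mult intro: total_add)

lemma add_self: "x \<in> total M \<Longrightarrow> x + x = 0"
  using act_plus[OF A1.one A1.one, of x] by (simp add: act_one act_zero steenrod_char2 del: one_add_one)

lemma minus_eq: "x \<in> total M \<Longrightarrow> - x = x"
  using add_self by (metis minus_unique)

lemma diff_eq: "y \<in> total M \<Longrightarrow> x - y = x + y"
  using minus_eq[of y] by (metis diff_conv_add_uminus)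

end

section \<open>Bar cochains with values in Z/2\<close>

lemma total_Z2 [simp]: "total Z2_mod = UNIV"
proof -
  have "x \<in> total Z2_mod" for x :: bit
    unfolding total_def by (rule CollectI, rule exI[of _ "{0}"], rule exI[of _ "\<lambda>_. x"]) (simp add: Z2_mod_def)
  then show ?thesis by auto
qed

abbreviation coch :: "nat \<Rightarrow> int \<Rightarrow> 'm::ab_group_add gmod \<Rightarrow> (steenrod list \<Rightarrow> 'm \<Rightarrow> bit) set" where
  "coch s t M \<equiv> cochains s t M Z2_mod"
abbreviation cocy :: "nat \<Rightarrow> int \<Rightarrow> 'm::ab_group_add gmod \<Rightarrow> (steenrod list \<Rightarrow> 'm \<Rightarrow> bit) set" where
  "cocy s t M \<equiv> cocycles s t M Z2_mod"
abbreviation cobo :: "nat \<Rightarrow> int \<Rightarrow> 'm::ab_group_add gmod \<Rightarrow> (steenrod list \<Rightarrow> 'm \<Rightarrow> bit) set" where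
  "cobo s t M \<equiv> coboundaries s t M Z2_mod"

lemma act_Z2: "act Z2_mod a b = augmentation a * b"
  by (simp add: Z2_mod_def)

text \<open>As Z/2 is concentrated in degree 0, the degree condition turns into vanishing off
  internal degree \<open>t\<close>.\<close>

lemma cochainI:
  assumes "\<And>as m. (as, m) \<notin> bar_dom s M \<Longrightarrow> f as m = 0"
    and "\<And>as m i a b. (as, m) \<in> bar_dom s M \<Longrightarrow> i \<le> s \<Longrightarrow> a \<in> A1 \<Longrightarrow> b \<in> A1 \<Longrightarrow>
      f (as[i := a + b]) m = f (as[i := a]) m + f (as[i := b]) m"
    and "\<And>as m m'. (as, m) \<in> bar_dom s M \<Longrightarrow> m' \<in> total M \<Longrightarrow> f as (m + m') = f as m + f as m'"
    and "\<And>as m a. (as, m) \<in> bar_dom s M \<Longrightarrow> a \<in> A1 \<Longrightarrow> f (as[0 := a * as ! 0]) m = augmentation a * f as m"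
    and "\<And>as m ds n. (as, m) \<in> bar_dom s M \<Longrightarrow> list_all2 (\<lambda>d a. a \<in> steenrod_deg d) ds as \<Longrightarrow>
      m \<in> piece M n \<Longrightarrow> n + int (sum_list ds) \<noteq> t \<Longrightarrow> f as m = 0"
  shows "f \<in> coch s t M"
  unfolding cochains_def
proof (intro CollectI conjI allI ballI impI; (elim conjE)?; clarify?)
  fix as m ds n
  assume "(as, m) \<in> bar_dom s M" "list_all2 (\<lambda>d a. a \<in> steenrod_deg d) ds as" "m \<in> piece M n"
  then show "f as m \<in> piece Z2_mod (n + int (sum_list ds) - t)"
    using assms(5)[of as m ds n] by (auto simp: Z2_mod_def)
qed (use assms(1-4) in \<open>simp_all add: act_Z2\<close>)

context
  fixes s t and M :: "'m::ab_group_add gmod" and f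
  assumes f: "f \<in> coch s t M"
begin

lemmas cochain_conjs = f [unfolded cochains_def mem_Collect_eq]

lemma cochain_outside: "(as, m) \<notin> bar_dom s M \<Longrightarrow> f as m = 0"
  using cochain_conjs[THEN conjunct1] by simp

lemma cochain_slot: "(as, m) \<in> bar_dom s M \<Longrightarrow> i \<le> s \<Longrightarrow> a \<in> A1 \<Longrightarrow> b \<in> A1 \<Longrightarrow>
      f (as[i := a + b]) m = f (as[i := a]) m + f (as[i := b]) m"
  using bspec[OF cochain_conjs[THEN conjunct2, THEN conjunct2, THEN conjunct1], of "(as, m)"] by simp

lemma cochain_mod: "(as, m) \<in> bar_dom s M \<Longrightarrow> m' \<in> total M \<Longrightarrow> f as (m + m') = f as m + f as m'"
  using bspec[OF cochain_conjs[THEN conjunct2, THEN conjunct2, THEN conjunct2, THEN conjunct1], of "(as, m)"]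
  by simp

lemma cochain_aug: "(as, m) \<in> bar_dom s M \<Longrightarrow> a \<in> A1 \<Longrightarrow> f (as[0 := a * as ! 0]) m = augmentation a * f as m"
  using bspec[OF cochain_conjs[THEN conjunct2, THEN conjunct2, THEN conjunct2, THEN conjunct2, THEN conjunct1],
      of "(as, m)"]
  by (simp add: Z2_mod_def)

lemma cochain_deg:
  assumes "(as, m) \<in> bar_dom s M" "list_all2 (\<lambda>d a. a \<in> steenrod_deg d) ds as"
    "m \<in> piece M n" "n + int (sum_list ds) \<noteq> t"
  shows "f as m = 0"
proof -
  have "f as m \<in> piece Z2_mod (n + int (sum_list ds) - t)"
    using bspec[OF cochain_conjs[THEN conjunct2, THEN conjunct2, THEN conjunct2, THEN conjunct2, THEN conjunct2],
      OF assms(1)] assms(2,3) by blast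
  then show ?thesis using assms(4) by (simp add: Z2_mod_def split: if_splits)
qed

lemma cochain_mod_zero: "f as 0 = 0" if "0 \<in> total M"
proof (cases "(as, 0) \<in> bar_dom s M")
  case True
  from cochain_mod[OF True that] show ?thesis by simp
qed (rule cochain_outside)

end

lemma cochain_add:
  assumes f: "f \<in> coch s t M" and g: "g \<in> coch s t M"
  shows "(\<lambda>as m. f as m + g as m) \<in> coch s t M"
proof (rule cochainI)
  fix as m assume "(as, m) \<notin> bar_dom s M"
  then show "f as m + g as m = 0" by (simp add: cochain_outside[OF f] cochain_outside[OF g])
next
  fix as m ds n
  assume "(as, m) \<in> bar_dom s M" "list_all2 (\<lambda>d a. a \<in> steenrod_deg d) ds as" "m \<in> piece M n"
    "n + int (sum_list ds) \<noteq> t"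
  then show "f as m + g as m = 0"
    using cochain_deg[OF f] cochain_deg[OF g] by (metis add.right_neutral)
qed (simp_all add: cochain_slot[OF f] cochain_slot[OF g]
      cochain_mod[OF f] cochain_mod[OF g] cochain_aug[OF f] cochain_aug[OF g] ac_simps distrib_left)

lemma cochain_zero: "(\<lambda>as m. 0) \<in> coch s t M"
  by (rule cochainI) simp_all

text \<open>The conditional restores the convention that cochains vanish outside their
  domain.\<close>

definition pull :: "nat \<Rightarrow> 'l::ab_group_add gmod \<Rightarrow> ('l \<Rightarrow> 'm) \<Rightarrow> (steenrod list \<Rightarrow> 'm \<Rightarrow> bit) \<Rightarrow> steenrod list \<Rightarrow> 'l \<Rightarrow> bit"
  where "pull s L \<phi> f = (\<lambda>as m. if (as, m) \<in> bar_dom s L then f as (\<phi> m) else 0)"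

definition gmap :: "'l::ab_group_add gmod \<Rightarrow> 'm::ab_group_add gmod \<Rightarrow> ('l \<Rightarrow> 'm) \<Rightarrow> bool" where
  "gmap L M \<phi> \<longleftrightarrow> (\<forall>x\<in>total L. \<forall>y\<in>total L. \<phi> (x + y) = \<phi> x + \<phi> y) \<and> (\<forall>n. \<forall>x\<in>piece L n. \<phi> x \<in> piece M n)"

lemma gmap_total:
  assumes "gmodule L" "gmodule M" "gmap L M \<phi>" "x \<in> total L" shows "\<phi> x \<in> total M"
  using assms(4)
proof (induction rule: gmodule.total_induct[OF assms(1), consumes 1, case_names piece add])
  case (piece n x)
  then have "\<phi> x \<in> piece M n" using assms(3) by (simp add: gmap_def)
  then show ?case by (rule gmodule.piece_subset_total[OF assms(2)])
next
  case (add x y)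
  then show ?case using assms(3) gmodule.total_add[OF assms(2)] by (simp add: gmap_def)
qed

lemma bar_dom_iff: "(as, m) \<in> bar_dom s M \<longleftrightarrow> length as = Suc s \<and> set as \<subseteq> A1 \<and> m \<in> total M"
  by (simp add: bar_dom_def)

lemma set_update_A1: "set as \<subseteq> A1 \<Longrightarrow> a \<in> A1 \<Longrightarrow> set (as[i := a]) \<subseteq> A1"
  by (rule set_update_subsetI)

lemma nth_A1: "set as \<subseteq> A1 \<Longrightarrow> i < length as \<Longrightarrow> as ! i \<in> A1"
  by auto

lemma pull_cochain:
  assumes L: "gmodule L" and M: "gmodule M" and \<phi>: "gmap L M \<phi>" and f: "f \<in> coch s t M"
  shows "pull s L \<phi> f \<in> coch s t L"
proof -
  have dom: "(as, \<phi> m) \<in> bar_dom s M" if "(as, m) \<in> bar_dom s L" for as m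
    using that gmap_total[OF L M \<phi>] by (simp add: bar_dom_iff)
  show ?thesis
  proof (rule cochainI)
    fix as m i a b assume *: "(as, m) \<in> bar_dom s L" "i \<le> s" "a \<in> A1" "b \<in> A1"
    then show "pull s L \<phi> f (as[i := a + b]) m = pull s L \<phi> f (as[i := a]) m + pull s L \<phi> f (as[i := b]) m"
      using cochain_slot[OF f dom[OF *(1)] *(2-4)]
      by (auto simp: pull_def bar_dom_iff set_update_A1 A1.add)
  next
    fix as m m' assume *: "(as, m) \<in> bar_dom s L" "m' \<in> total L"
    then show "pull s L \<phi> f as (m + m') = pull s L \<phi> f as m + pull s L \<phi> f as m'"
      using cochain_mod[OF f dom[OF *(1)], of "\<phi> m'"] gmap_total[OF L M \<phi>] \<phi> gmodule.total_add[OF L]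
      by (auto simp: pull_def bar_dom_iff gmap_def)
  next
    fix as m a assume *: "(as, m) \<in> bar_dom s L" "a \<in> A1"
    then have "as ! 0 \<in> A1" by (intro nth_A1) (auto simp: bar_dom_iff)
    with * show "pull s L \<phi> f (as[0 := a * as ! 0]) m = augmentation a * pull s L \<phi> f as m"
      using cochain_aug[OF f dom[OF *(1)] *(2)]
      by (auto simp: pull_def bar_dom_iff set_update_A1 A1.mult)
  next
    fix as m ds n
    assume "(as, m) \<in> bar_dom s L" "list_all2 (\<lambda>d a. a \<in> steenrod_deg d) ds as" "m \<in> piece L n"
      "n + int (sum_list ds) \<noteq> t"
    then show "pull s L \<phi> f as m = 0"
      using cochain_deg[OF f dom, of as m ds n] \<phi> by (auto simp: pull_def gmap_def)
  qed (simp add: pull_def)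
qed

subsection \<open>The coboundary\<close>

text \<open>The inner faces of the bar construction; the last face instead lets the last entry act
  on the module.\<close>

definition merge :: "nat \<Rightarrow> steenrod list \<Rightarrow> steenrod list" where
  "merge i as = take i as @ [as ! i * as ! Suc i] @ drop (i + 2) as"

lemma merge_Cons [simp]: "merge (Suc i) (a # as) = a # merge i as"
  by (simp add: merge_def)

lemma merge_0 [simp]: "merge 0 (a # b # as) = a * b # as"
  by (simp add: merge_def)

lemma length_merge: "Suc i < length as \<Longrightarrow> length (merge i as) = length as - 1"
  by (simp add: merge_def)

lemma merge_A1:
  assumes "set as \<subseteq> A1" "Suc i < length as" shows "set (merge i as) \<subseteq> A1"
  using assms by (auto simp: merge_def dest: in_set_takeD in_set_dropD intro!: A1.mult)

lemma coboundary_eq: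
  "(as, m) \<in> bar_dom (Suc s) M \<Longrightarrow>
    coboundary s M f as m = (\<Sum>i\<le>s. f (merge i as) m) + f (butlast as) (act M (last as) m)"
  by (simp add: coboundary_def merge_def)

lemma coboundary_outside: "(as, m) \<notin> bar_dom (Suc s) M \<Longrightarrow> coboundary s M f as m = 0"
  by (simp add: coboundary_def)

lemma coboundary_add:
  "coboundary s M (\<lambda>as m. f as m + g as m :: bit) as m = coboundary s M f as m + coboundary s M g as m"
  by (simp add: coboundary_def sum.distrib ac_simps)

lemma coboundary_zero [simp]: "coboundary s M (\<lambda>as m. 0 :: bit) = (\<lambda>as m. 0)"
  by (intro ext) (simp add: coboundary_def)

text \<open>Position \<open>i\<close> enters a product exactly when it is \<open>j\<close> or
  \<open>j + 1\<close>. Additivity of the coboundary in each slot rests on this case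
  distinction.\<close>

lemma merge_update:
  assumes "Suc j < length as" "i < length as"
  shows "merge j (as[i := a]) =
    (if i < j then (merge j as)[i := a]
     else if i = j then (merge j as)[j := a * as ! Suc j]
     else if i = Suc j then (merge j as)[j := as ! j * a]
     else (merge j as)[i - 1 := a])"
  using assms
proof (induction as arbitrary: i j)
  case (Cons x xs)
  show ?case
  proof (cases j)
    case 0
    with Cons.prems obtain y ys where "xs = y # ys" by (cases xs) auto
    with 0 show ?thesis by (auto split: nat.split simp: nth_Cons list_update.simps less_Suc_eq_0_disj)
  next
    case (Suc j')
    then show ?thesis using Cons.prems Cons.IH[of j' "i - 1"]
      by (cases i) (auto simp: nth_Cons split: nat.split)
  qed
qed simp

lemma butlast_update: "i < length as \<Longrightarrow>
   butlast (as[i := a]) = (if Suc i = length as then butlast as else (butlast as)[i := a])"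
  by (induction as arbitrary: i) (auto split: nat.split)

lemma last_update: "i < length as \<Longrightarrow>
   last (as[i := a]) = (if Suc i = length as then a else last as)"
  by (cases as rule: rev_cases) (auto simp: last_list_update)

lemma merge_snoc: "Suc i < length as \<Longrightarrow> merge i (as @ [a]) = merge i as @ [a]"
  by (simp add: merge_def nth_append)

lemma merge_snoc_last: "Suc (Suc i) = length (as @ [b, a]) \<Longrightarrow> merge i (as @ [b, a]) = as @ [b * a]"
  by (simp add: merge_def nth_append)

text \<open>The simplicial identity for inner faces; for \<open>i = j\<close> it is
  associativity.\<close>

lemma merge_merge:
  "i \<le> j \<Longrightarrow> Suc (Suc j) < length as \<Longrightarrow> merge j (merge i as) = merge i (merge (Suc j) as)"
proof (induction as arbitrary: i j)
  case (Cons x as)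
  show ?case
  proof (cases i)
    case (Suc i')
    with Cons.prems Cons.IH[of i' "j - 1"] show ?thesis by (cases j) auto
  next
    case 0
    from Cons.prems obtain y z bs where as: "as = y # z # bs"
      by (cases as; cases "tl as") auto
    show ?thesis
      by (cases j) (auto simp: 0 as merge_def[of "Suc _"] mult.assoc) 
  qed
qed simp

text \<open>By the simplicial identity the terms with \<open>i \<le> j\<close> match those with
  \<open>j < i\<close>, and equal pairs cancel modulo 2.\<close>

lemma sum_merge_merge_zero:
  fixes F :: "steenrod list \<Rightarrow> bit"
  assumes "length as = s + 3"
  shows "(\<Sum>i\<le>Suc s. \<Sum>j\<le>s. F (merge j (merge i as))) = 0"
proof -
  let ?G = "\<lambda>(i, j). F (merge j (merge i as))"
  let ?A = "{(i, j). i \<le> Suc s \<and> j \<le> s \<and> i \<le> j}" and ?B = "{(i, j). i \<le> Suc s \<and> j \<le> s \<and> j < i}"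
  have fin: "finite ?A" "finite ?B"
    by (rule finite_subset[of _ "{..Suc s} \<times> {..s}"]; auto)+
  have swap: "merge (i - Suc 0) (merge j as) = merge j (merge i as)" if "j < i" "i \<le> Suc s" for i j
    using merge_merge[of j "i - 1" as] that assms by simp
  have "(\<Sum>i\<le>Suc s. \<Sum>j\<le>s. F (merge j (merge i as))) = sum ?G ({..Suc s} \<times> {..s})"
    by (simp add: sum.cartesian_product)
  also have "{..Suc s} \<times> {..s} = ?A \<union> ?B" by auto
  also have "sum ?G (?A \<union> ?B) = sum ?G ?A + sum ?G ?B"
    by (rule sum.union_disjoint) (use fin in auto)
  also have "sum ?G ?B = sum ?G ?A"
    by (rule sum.reindex_bij_witness[of _ "\<lambda>(i, j). (Suc j, i)" "\<lambda>(i, j). (j, i - 1)"])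
      (auto simp: swap)
  finally show ?thesis by simp
qed

context gmodule
begin

lemma bar_dom_snoc: "(as @ [a], m) \<in> bar_dom (Suc s) M \<longleftrightarrow> (as, m) \<in> bar_dom s M \<and> a \<in> A1"
  by (auto simp: bar_dom_iff)

lemma bar_dom_merge: "(as, m) \<in> bar_dom (Suc s) M \<Longrightarrow> i \<le> s \<Longrightarrow> (merge i as, m) \<in> bar_dom s M"
  by (simp add: bar_dom_iff length_merge merge_A1)

lemma bar_domE_snoc:
  assumes "(as, m) \<in> bar_dom (Suc s) M"
  obtains bs b where "as = bs @ [b]" "(bs, m) \<in> bar_dom s M" "b \<in> A1"
  using assms by (cases as rule: rev_cases) (auto simp: bar_dom_iff)

lemma bar_dom_act: "(as, m) \<in> bar_dom s M \<Longrightarrow> a \<in> A1 \<Longrightarrow> (as, act M a m) \<in> bar_dom s M"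
  by (simp add: bar_dom_iff act_total)

lemma coboundary_snoc:
  assumes "(as, m) \<in> bar_dom s M" "a \<in> A1"
  shows "coboundary s M f (as @ [a]) m = (\<Sum>i\<le>s. f (merge i (as @ [a])) m) + f as (act M a m)"
  using assms by (simp add: coboundary_eq bar_dom_snoc)

text \<open>Pairs of inner faces cancel among themselves. In the terms with a last face, multiplying
  the last two entries and acting once agrees with acting twice.\<close>

lemma coboundary_coboundary:
  fixes f :: "steenrod list \<Rightarrow> 'm \<Rightarrow> bit"
  shows "coboundary (Suc s) M (coboundary s M f) = (\<lambda>as m. 0)"
proof (intro ext)
  fix as m
  show "coboundary (Suc s) M (coboundary s M f) as m = 0"
  proof (cases "(as, m) \<in> bar_dom (Suc (Suc s)) M")
    case True
    then obtain bs a where as: "as = bs @ [a]" and bs: "(bs, m) \<in> bar_dom (Suc s) M" and a: "a \<in> A1"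
      by (rule bar_domE_snoc)
    from bs obtain cs b where cs: "bs = cs @ [b]" "(cs, m) \<in> bar_dom s M" and b: "b \<in> A1"
      by (rule bar_domE_snoc)
    have len: "length cs = Suc s" and m: "m \<in> total M" using cs by (auto simp: bar_dom_iff)
    have "coboundary s M f (merge i as) m =
        (\<Sum>j\<le>s. f (merge j (merge i as)) m) +
        (if i \<le> s then f (merge i bs) (act M a m) else f cs (act M b (act M a m)))" if "i \<le> Suc s" for i
    proof (cases "i \<le> s")
      case True
      then have "merge i as = merge i bs @ [a]" using len cs as merge_snoc[of i bs a] by simp
      moreover have "(merge i bs, m) \<in> bar_dom s M" using bs True by (rule bar_dom_merge)
      ultimately show ?thesis using True a by (simp add: coboundary_snoc)
    next
      case False
      then have "merge i as = cs @ [b * a]" using that len cs as by (simp add: merge_snoc_last)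
      then show ?thesis using False cs(2) a b m by (simp add: coboundary_snoc A1.mult act_mult)
    qed
    then have "(\<Sum>i\<le>Suc s. coboundary s M f (merge i as) m) =
        (\<Sum>i\<le>Suc s. \<Sum>j\<le>s. f (merge j (merge i as)) m) +
        (\<Sum>i\<le>Suc s. if i \<le> s then f (merge i bs) (act M a m) else f cs (act M b (act M a m)))"
      unfolding sum.distrib [symmetric] by (intro sum.cong refl) simp
    also have "(\<Sum>i\<le>Suc s. \<Sum>j\<le>s. f (merge j (merge i as)) m) = 0"
      by (rule sum_merge_merge_zero) (simp add: as cs(1) len)
    also have "(\<Sum>i\<le>Suc s. if i \<le> s then f (merge i bs) (act M a m) else f cs (act M b (act M a m)))
        = coboundary s M f bs (act M a m)"
      using bar_dom_act[OF cs(2) a] b by (simp add: cs(1) coboundary_snoc)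
    finally show ?thesis using bs a by (simp add: as coboundary_snoc)
  qed (rule coboundary_outside)
qed

lemma coboundary_cochain:
  assumes f: "f \<in> coch s t M"
  shows "coboundary s M f \<in> coch (Suc s) t M"
proof (rule cochainI)
  fix as m i a b
  assume dom: "(as, m) \<in> bar_dom (Suc s) M" and i: "i \<le> Suc s" and ab: "a \<in> A1" "b \<in> A1"
  from dom have len: "length as = Suc (Suc s)" and A: "set as \<subseteq> A1" and m: "m \<in> total M"
    by (auto simp: bar_dom_iff)
  have dom': "(as[i := c], m) \<in> bar_dom (Suc s) M" if "c \<in> A1" for c
    using that len A m by (simp add: bar_dom_iff set_update_A1)
  have "f (merge j (as[i := a + b])) m = f (merge j (as[i := a])) m + f (merge j (as[i := b])) m"
    if j: "j \<le> s" for j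
    using cochain_slot[OF f bar_dom_merge[OF dom j]] ab i j A nth_A1[OF A]
    by (auto simp: merge_update len distrib_left distrib_right A1.mult)
  moreover have "f (butlast (as[i := a + b])) (act M (last (as[i := a + b])) m) =
    f (butlast (as[i := a])) (act M (last (as[i := a])) m) + f (butlast (as[i := b])) (act M (last (as[i := b])) m)"
  proof -
    obtain bs c where as: "as = bs @ [c]" and bs: "(bs, m) \<in> bar_dom s M" and c: "c \<in> A1"
      using dom by (rule bar_domE_snoc)
    have lb: "length bs = Suc s" using bs by (simp add: bar_dom_iff)
    show ?thesis
    proof (cases "i = Suc s")
      \<comment> \<open>In the last slot additivity comes from that of the action and of
        \<open>f\<close> in the module argument.\<close>
      case True
      then show ?thesis
        using cochain_mod[OF f bar_dom_act[OF bs ab(1)] act_total[OF ab(2) m]] ab m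
        by (simp add: as lb butlast_update last_update act_plus)
    next
      case False
      then show ?thesis
        using cochain_slot[OF f bar_dom_act[OF bs c], of i, OF _ ab] i
        by (simp add: as lb butlast_update last_update)
    qed
  qed
  ultimately show "coboundary s M f (as[i := a + b]) m = coboundary s M f (as[i := a]) m + coboundary s M f (as[i := b]) m"
    using ab by (simp add: coboundary_eq[OF dom'] A1.add sum.distrib ac_simps)
next
  fix as m m'
  assume dom: "(as, m) \<in> bar_dom (Suc s) M" and m': "m' \<in> total M"
  then obtain bs c where as: "as = bs @ [c]" and bs: "(bs, m) \<in> bar_dom s M" and c: "c \<in> A1"
    by (blast elim: bar_domE_snoc)
  have "(bs, m + m') \<in> bar_dom s M" "(bs, m') \<in> bar_dom s M" and m: "m \<in> total M"
    using bs m' by (auto simp: bar_dom_iff total_add)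
  then show "coboundary s M f as (m + m') = coboundary s M f as m + coboundary s M f as m'"
    using cochain_mod[OF f bar_dom_act[OF bs c] act_total[OF c m']] c bs m' 
      cochain_mod[OF f bar_dom_merge[OF dom] m']
    by (simp add: as coboundary_snoc act_add sum.distrib ac_simps)
next
  fix as m a
  assume dom: "(as, m) \<in> bar_dom (Suc s) M" and a: "a \<in> A1"
  from dom have len: "length as = Suc (Suc s)" and A: "set as \<subseteq> A1" and m: "m \<in> total M"
    by (auto simp: bar_dom_iff)
  have dom': "(as[0 := a * as ! 0], m) \<in> bar_dom (Suc s) M"
    using a len A m by (simp add: bar_dom_iff set_update_A1 A1.mult nth_A1)
  obtain bs c where as: "as = bs @ [c]" and bs: "(bs, m) \<in> bar_dom s M" and c: "c \<in> A1"
    using dom by (rule bar_domE_snoc)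
  have lb: "length bs = Suc s" using bs by (simp add: bar_dom_iff)
  have *: "merge j (as[0 := a * as ! 0]) = (merge j as)[0 := a * merge j as ! 0]" if "j \<le> s" for j
    using that len by (cases as; cases "tl as"; cases j) (auto simp: mult.assoc)
  have "f (merge j (as[0 := a * as ! 0])) m = augmentation a * f (merge j as) m" if "j \<le> s" for j
    using cochain_aug[OF f bar_dom_merge[OF dom that] a] *[OF that] by simp
  moreover have "f (butlast (as[0 := a * as ! 0])) (act M (last (as[0 := a * as ! 0])) m) =
     augmentation a * f (butlast as) (act M (last as) m)"
    using cochain_aug[OF f bar_dom_act[OF bs c] a] lb
    by (simp add: as butlast_update last_update nth_append)
  ultimately show "coboundary s M f (as[0 := a * as ! 0]) m = augmentation a * coboundary s M f as m"
    by (simp add: coboundary_eq[OF dom'] coboundary_eq[OF dom] sum_distrib_left distrib_left)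
next
  fix as m ds n
  assume dom: "(as, m) \<in> bar_dom (Suc s) M" and ds: "list_all2 (\<lambda>d a. a \<in> steenrod_deg d) ds as"
    and m: "m \<in> piece M n" and ne: "n + int (sum_list ds) \<noteq> t"
  from dom have len: "length as = Suc (Suc s)" and A: "set as \<subseteq> A1" by (auto simp: bar_dom_iff)
  have "f (merge j as) m = 0" if j: "j \<le> s" for j
  proof -
    \<comment> \<open>Merging two entries adds their degrees, so the total degree is
      unchanged.\<close>
    let ?ds = "take j ds @ [ds ! j + ds ! Suc j] @ drop (j + 2) ds"
    have ld: "length ds = Suc (Suc s)" using ds len by (simp add: list_all2_lengthD)
    have "list_all2 (\<lambda>d a. a \<in> steenrod_deg d) ?ds (merge j as)"
      unfolding merge_def using ds j len ld
      by (intro list_all2_appendI list_all2_takeI list_all2_dropI)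
        (auto intro!: steenrod_deg_mult simp: list_all2_conv_all_nth)
    moreover have "sum_list ?ds = sum_list ds"
    proof -
      have "ds = take j ds @ ds ! j # ds ! Suc j # drop (j + 2) ds"
        using j ld by (simp add: Cons_nth_drop_Suc)
      then have "sum_list ds = sum_list (take j ds @ ds ! j # ds ! Suc j # drop (j + 2) ds)" by (rule arg_cong)
      then show ?thesis by simp
    qed
    ultimately show ?thesis using cochain_deg[OF f bar_dom_merge[OF dom j] _ m] ne by metis
  qed
  moreover have "f (butlast as) (act M (last as) m) = 0"
  proof -
    obtain bs c where as: "as = bs @ [c]" and bs: "(bs, m) \<in> bar_dom s M" and c: "c \<in> A1"
      using dom by (rule bar_domE_snoc)
    from ds obtain es d where es: "ds = es @ [d]" "list_all2 (\<lambda>d a. a \<in> steenrod_deg d) es bs" "c \<in> steenrod_deg d"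
      unfolding as by (auto simp: list_all2_append2 list_all2_Cons2)
    show ?thesis
      using cochain_deg[OF f bar_dom_act[OF bs c] es(2) act_piece[OF c es(3) m]] ne by (simp add: as es(1))
  qed
  ultimately show "coboundary s M f as m = 0" by (simp add: coboundary_eq[OF dom])
qed (rule coboundary_outside)

end

section \<open>Multiplication by \<open>h\<^sub>0\<close> on cochains\<close>

text \<open>The Yoneda composite with the cocycle dual to Sq1, which consumes the two leading
  entries; the others are passed to \<open>f\<close> behind a leading 1.\<close>

definition h0m :: "nat \<Rightarrow> 'm::ab_group_add gmod \<Rightarrow> (steenrod list \<Rightarrow> 'm \<Rightarrow> bit) \<Rightarrow> steenrod list \<Rightarrow> 'm \<Rightarrow> bit" where
  "h0m s M f = (\<lambda>as m. if (as, m) \<in> bar_dom (Suc s) M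
     then augmentation (as ! 0) * c1 (A1_coords (as ! 1)) * f (1 # drop 2 as) m else 0)"

lemma h0m_add: "h0m s M (\<lambda>as m. f as m + g as m) = (\<lambda>as m. h0m s M f as m + h0m s M g as m)"
  by (intro ext) (simp add: h0m_def distrib_left)

lemma c0_deg: "a \<in> A1 \<Longrightarrow> a \<in> steenrod_deg d \<Longrightarrow> augmentation a = 1 \<Longrightarrow> d = 0"
  using A1_coords_piece[of a d] by (simp add: augmentation_A1_coords v8_piece_def)

lemma c1_deg: "a \<in> steenrod_deg d \<Longrightarrow> c1 (A1_coords a) = 1 \<Longrightarrow> d = 1"
  using A1_coords_piece[of a d] by (auto simp: v8_piece_def)

lemma c1_times: "a \<in> A1 \<Longrightarrow> b \<in> A1 \<Longrightarrow>
    c1 (A1_coords (a * b)) = augmentation a * c1 (A1_coords b) + c1 (A1_coords a) * augmentation b"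
  by (simp add: A1_coords_times c1_st_act augmentation_A1_coords)

text \<open>Because \<open>A1\<close> acts on Z/2 through the augmentation, a cochain is determined
  by its values at leading entry 1.\<close>

lemma cochain_head:
  assumes f: "f \<in> coch s t M" and "(a # as, m) \<in> bar_dom s M"
  shows "f (a # as) m = augmentation a * f (1 # as) m"
  using cochain_aug[OF f, of "1 # as" m a] assms(2) by (simp add: bar_dom_iff A1.one)

lemma bar_domE_Cons2:
  assumes "(as, m) \<in> bar_dom (Suc s) M"
  obtains a b bs where "as = a # b # bs" "a \<in> A1" "b \<in> A1" "(1 # bs, m) \<in> bar_dom s M"
  using assms by (cases as; cases "tl as") (auto simp: bar_dom_iff A1.one)

context gmodule
begin

lemma h0m_Cons:
  assumes "a \<in> A1" "b \<in> A1" "(1 # bs, m) \<in> bar_dom s M"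
  shows "h0m s M f (a # b # bs) m = augmentation a * c1 (A1_coords b) * f (1 # bs) m"
  using assms by (auto simp: h0m_def bar_dom_iff)

lemma h0m_cochain:
  assumes f: "f \<in> coch s t M"
  shows "h0m s M f \<in> coch (Suc s) (t + 1) M"
proof (rule cochainI)
  fix as m i c d assume dom: "(as, m) \<in> bar_dom (Suc s) M" and i: "i \<le> Suc s" and cd: "c \<in> A1" "d \<in> A1"
  from dom obtain a b bs where as: "as = a # b # bs" and ab: "a \<in> A1" "b \<in> A1" and bs: "(1 # bs, m) \<in> bar_dom s M"
    by (rule bar_domE_Cons2)
  show "h0m s M f (as[i := c + d]) m = h0m s M f (as[i := c]) m + h0m s M f (as[i := d]) m"
  proof (cases "i < 2")
    case True
    then show ?thesis using ab bs cd
      by (auto simp: less_2_cases_iff as h0m_Cons A1.add distrib_left distrib_right)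
  next
    case False
    then obtain j where j: "i = Suc (Suc j)" by (metis add_2_eq_Suc le_add_diff_inverse not_less)
    have "(1 # bs[j := e], m) \<in> bar_dom s M" if "e \<in> A1" for e
      using bs that by (auto simp: bar_dom_iff set_update_A1 intro: set_update_A1[THEN subsetD])
    then show ?thesis using cochain_slot[OF f bs, of "Suc j" c d] i ab cd
      by (simp add: as j h0m_Cons A1.add distrib_left)
  qed
next
  fix as m m' assume dom: "(as, m) \<in> bar_dom (Suc s) M" and m': "m' \<in> total M"
  from dom obtain a b bs where as: "as = a # b # bs" and ab: "a \<in> A1" "b \<in> A1" and bs: "(1 # bs, m) \<in> bar_dom s M"
    by (rule bar_domE_Cons2)
  moreover from this m' have "(1 # bs, m') \<in> bar_dom s M" "(1 # bs, m + m') \<in> bar_dom s M"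
    by (auto simp: bar_dom_iff total_add)
  ultimately show "h0m s M f as (m + m') = h0m s M f as m + h0m s M f as m'"
    using cochain_mod[OF f bs m'] by (simp add: h0m_Cons distrib_left)
next
  fix as m c assume dom: "(as, m) \<in> bar_dom (Suc s) M" and c: "c \<in> A1"
  from dom obtain a b bs where as: "as = a # b # bs" and ab: "a \<in> A1" "b \<in> A1" and bs: "(1 # bs, m) \<in> bar_dom s M"
    by (rule bar_domE_Cons2)
  then show "h0m s M f (as[0 := c * as ! 0]) m = augmentation c * h0m s M f as m"
    using c by (simp add: h0m_Cons A1.mult mult.assoc)
next
  fix as m ds n
  assume dom: "(as, m) \<in> bar_dom (Suc s) M" and ds: "list_all2 (\<lambda>d a. a \<in> steenrod_deg d) ds as"
    and m: "m \<in> piece M n" and ne: "n + int (sum_list ds) \<noteq> t + 1"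
  from dom obtain a b bs where as: "as = a # b # bs" and ab: "a \<in> A1" "b \<in> A1" and bs: "(1 # bs, m) \<in> bar_dom s M"
    by (rule bar_domE_Cons2)
  from ds obtain d e es where ds': "ds = d # e # es" "a \<in> steenrod_deg d" "b \<in> steenrod_deg e"
     "list_all2 (\<lambda>d a. a \<in> steenrod_deg d) es bs"
    by (auto simp: as list_all2_Cons2)
  show "h0m s M f as m = 0"
  proof (rule ccontr)
    assume "h0m s M f as m \<noteq> 0"
    then have "augmentation a * c1 (A1_coords b) * f (1 # bs) m \<noteq> 0" by (simp add: as h0m_Cons ab bs del: bit_not_zero_iff)
    then have "augmentation a \<noteq> 0" "c1 (A1_coords b) \<noteq> 0" and f0: "f (1 # bs) m \<noteq> 0" by (auto simp del: bit_not_zero_iff)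
    \<comment> \<open>A nonzero value forces degrees 0 and 1 on the two leading entries, which
      accounts for the shift from \<open>t\<close> to \<open>t + 1\<close>.\<close>
    then have "d = 0" "e = 1" using ab ds' c0_deg c1_deg by auto
    then have "f (1 # bs) m = 0"
      using cochain_deg[OF f bs, of "0 # es" n] m ne ds' by (auto simp: one_in_steenrod_deg)
    with f0 show False ..
  qed
qed (simp add: h0m_def)

text \<open>By \<open>c1_times\<close> the face multiplying \<open>b\<close> and \<open>c\<close>
  splits into two terms. One cancels the face multiplying \<open>a\<close> and \<open>b\<close>; the
  other is the leading face of the coboundary of \<open>f\<close>.\<close>

lemma coboundary_h0m:
  assumes f: "f \<in> coch s t M"
  shows "coboundary (Suc s) M (h0m s M f) = h0m (Suc s) M (coboundary s M f)"
proof (intro ext)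
  fix as m
  show "coboundary (Suc s) M (h0m s M f) as m = h0m (Suc s) M (coboundary s M f) as m"
  proof (cases "(as, m) \<in> bar_dom (Suc (Suc s)) M")
    case True
    then obtain a b bs where as: "as = a # b # bs" and ab: "a \<in> A1" "b \<in> A1"
      and bs: "(1 # bs, m) \<in> bar_dom (Suc s) M"
      by (rule bar_domE_Cons2)
    then obtain c cs where bs': "bs = c # cs" and c: "c \<in> A1" and cs: "(1 # cs, m) \<in> bar_dom s M"
      by (metis bar_domE_Cons2 list.inject)
    let ?e = "\<lambda>a. augmentation a" and ?h = "\<lambda>a. c1 (A1_coords a)"
    define S where "S = (\<Sum>i<s. f (1 # merge i bs) m)"
    define L where "L = f (butlast (1 # bs)) (act M (last bs) m)"
    have lb: "(butlast (1 # bs), act M (last bs) m) \<in> bar_dom s M"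
      using bs by (simp add: bs') (auto simp: bar_dom_iff act_total dest: in_set_butlastD last_in_set)
    have mb: "(1 # merge i bs, m) \<in> bar_dom s M" if "i < s" for i
      using bar_dom_merge[OF bs, of "Suc i"] that by simp
    have "coboundary (Suc s) M (h0m s M f) as m =
       (\<Sum>i<Suc (Suc s). h0m s M f (merge i as) m) + h0m s M f (butlast as) (act M (last as) m)"
      using True by (simp add: coboundary_eq lessThan_Suc_atMost)
    also have "(\<Sum>i<Suc (Suc s). h0m s M f (merge i as) m) =
       ?e (a * b) * ?h c * f (1 # cs) m + (?e a * ?h (b * c) * f (1 # cs) m + ?e a * ?h b * S)"
      using ab c cs mb
      by (simp add: sum.lessThan_Suc_shift as bs' h0m_Cons A1.mult S_def sum_distrib_left del: augmentation_simps sum.lessThan_Suc)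
    also have "h0m s M f (butlast as) (act M (last as) m) = ?e a * ?h b * L"
      using h0m_Cons[of a b "butlast bs" "act M (last bs) m" s f] lb ab by (simp add: as bs' L_def split: if_splits)
    also have "h0m (Suc s) M (coboundary s M f) as m = ?e a * ?h b * (?e c * f (1 # cs) m + S + L)"
    proof -
      have "coboundary s M f (1 # bs) m = (\<Sum>i<Suc s. f (merge i (1 # bs)) m) + L"
        using bs by (simp add: coboundary_eq lessThan_Suc_atMost L_def bs')
      also have "(\<Sum>i<Suc s. f (merge i (1 # bs)) m) = f (c # cs) m + S"
        by (simp add: sum.lessThan_Suc_shift S_def bs' del: sum.lessThan_Suc)
      also have "f (c # cs) m = ?e c * f (1 # cs) m"
        using cs c by (intro cochain_head[OF f]) (simp add: bar_dom_iff)
      finally show ?thesis using ab bs by (simp add: as h0m_Cons)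
    qed
    ultimately show ?thesis using ab c by (simp add: c1_times algebra_simps)
  qed (simp add: coboundary_outside h0m_def)
qed

end

section \<open>Free modules\<close>

text \<open>Generators will be named by their stems, hence the integer index. The map
  \<open>dg\<close> is separate because the internal degree also depends on the homological
  degree.\<close>

definition free_mod :: "int set \<Rightarrow> (int \<Rightarrow> int) \<Rightarrow> (int \<Rightarrow> v8) gmod" where
  "free_mod G dg = \<lparr>piece = (\<lambda>d. {x. \<forall>n. if n \<in> G then x n \<in> v8_piece (d - dg n) else x n = 0}),
     act = (\<lambda>a x n. st_act a (x n))\<rparr>"

lemma v8_sum_sel:
  "c0 (\<Sum>i\<in>I. g i) = (\<Sum>i\<in>I. c0 (g i))" "c1 (\<Sum>i\<in>I. g i) = (\<Sum>i\<in>I. c1 (g i))"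
  "c2 (\<Sum>i\<in>I. g i) = (\<Sum>i\<in>I. c2 (g i))" "c3 (\<Sum>i\<in>I. g i) = (\<Sum>i\<in>I. c3 (g i))"
  "c4 (\<Sum>i\<in>I. g i) = (\<Sum>i\<in>I. c4 (g i))" "c5 (\<Sum>i\<in>I. g i) = (\<Sum>i\<in>I. c5 (g i))"
  "c6 (\<Sum>i\<in>I. g i) = (\<Sum>i\<in>I. c6 (g i))" "c7 (\<Sum>i\<in>I. g i) = (\<Sum>i\<in>I. c7 (g i))"
  by (induction I rule: infinite_finite_induct; simp)+

lemma bit_sum_single:
  assumes "finite I" "d \<in> I" "\<And>i. i \<in> I \<Longrightarrow> i \<noteq> d \<Longrightarrow> h i = 0" "(\<Sum>i\<in>I. h i) = (0::bit)"
  shows "h d = 0"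
proof -
  have "(\<Sum>i\<in>I. h i) = h d + (\<Sum>i\<in>I - {d}. h i)" using assms(1,2) by (rule sum.remove)
  also have "(\<Sum>i\<in>I - {d}. h i) = 0" using assms(3) by (intro sum.neutral) auto
  finally show ?thesis using assms(4) by simp
qed

text \<open>Each coordinate lives in a single degree, so at most one summand contributes to
  it.\<close>

lemma v8_piece_indep:
  assumes "finite I" "\<And>d. d \<in> I \<Longrightarrow> g d \<in> v8_piece (d - e)" "(\<Sum>d\<in>I. g d) = 0" "d \<in> I"
  shows "g d = 0"
proof -
  have *: "h (g d) = 0" if h: "(\<Sum>i\<in>I. h (g i)) = (0::bit)" "\<And>i. i \<in> I \<Longrightarrow> i - e \<noteq> j \<Longrightarrow> h (g i) = 0" for h j
  proof (cases "d - e = j")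
    case True
    show ?thesis by (rule bit_sum_single[of I d "\<lambda>i. h (g i)"]) (use assms h True in auto)
  qed (use h assms(4) in auto)
  show ?thesis
  proof (rule v8.expand, intro conjI; unfold v8_zero_sel)
    show "c0 (g d) = 0" by (rule *[of _ 0]) (use assms(2,3) in \<open>auto simp flip: v8_sum_sel simp: v8_piece_def\<close>)
    show "c1 (g d) = 0" by (rule *[of _ 1]) (use assms(2,3) in \<open>auto simp flip: v8_sum_sel simp: v8_piece_def\<close>)
    show "c2 (g d) = 0" by (rule *[of _ 2]) (use assms(2,3) in \<open>auto simp flip: v8_sum_sel simp: v8_piece_def\<close>)
    show "c3 (g d) = 0" by (rule *[of _ 3]) (use assms(2,3) in \<open>auto simp flip: v8_sum_sel simp: v8_piece_def\<close>)
    show "c4 (g d) = 0" by (rule *[of _ 3]) (use assms(2,3) in \<open>auto simp flip: v8_sum_sel simp: v8_piece_def\<close>)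
    show "c5 (g d) = 0" by (rule *[of _ 4]) (use assms(2,3) in \<open>auto simp flip: v8_sum_sel simp: v8_piece_def\<close>)
    show "c6 (g d) = 0" by (rule *[of _ 5]) (use assms(2,3) in \<open>auto simp flip: v8_sum_sel simp: v8_piece_def\<close>)
    show "c7 (g d) = 0" by (rule *[of _ 6]) (use assms(2,3) in \<open>auto simp flip: v8_sum_sel simp: v8_piece_def\<close>)
  qed
qed

lemma sum_fun_apply: "(\<Sum>i\<in>I. f i) n = (\<Sum>i\<in>I. f i n :: 'a::comm_monoid_add)"
  by (induction I rule: infinite_finite_induct) simp_all

lemma free_pieceD: "x \<in> piece (free_mod G dg) d \<Longrightarrow> n \<in> G \<Longrightarrow> x n \<in> v8_piece (d - dg n)"
  "x \<in> piece (free_mod G dg) d \<Longrightarrow> n \<notin> G \<Longrightarrow> x n = 0"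
  by (auto simp: free_mod_def split: if_splits)

lemma gmodule_free: "gmodule (free_mod G dg)"
  unfolding gmodule_def graded_A1_module_def
proof (intro conjI allI ballI impI; (elim conjE)?)
  let ?F = "free_mod G dg"
  fix I x n assume I: "finite I" "\<forall>n\<in>I. x n \<in> piece ?F n" "(\<Sum>n\<in>I. x n) = 0" "n \<in> I"
  have "x n m = 0" for m
  proof (cases "m \<in> G")
    case True
    show ?thesis
      by (rule v8_piece_indep[of I "\<lambda>n. x n m" "dg m"])
        (use I True in \<open>auto simp: free_pieceD(1) sum_fun_apply[symmetric]\<close>)
  next
    case False
    then show ?thesis using I free_pieceD(2) by blast
  qed
  then show "x n = 0" by auto
next
  fix n x y assume "x \<in> piece (free_mod G dg) n" "y \<in> piece (free_mod G dg) n"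
  then show "x - y \<in> piece (free_mod G dg) n"
    by (auto simp: free_mod_def v8_piece_add)
next
  fix p n a x assume "a \<in> A1 \<inter> steenrod_deg p" "x \<in> piece (free_mod G dg) n"
  then show "act (free_mod G dg) a x \<in> piece (free_mod G dg) (n + int p)"
    using st_act_piece[of a p "x m" "n - dg m" for m] by (auto simp: free_mod_def algebra_simps)
qed (auto simp: free_mod_def st_act_plus st_act_times st_act_add fun_eq_iff)

definition unit_vec :: "int \<Rightarrow> int \<Rightarrow> v8" where
  "unit_vec n = (\<lambda>m. if m = n then v8_one else 0)"

lemma act_free: "act (free_mod G dg) a x = (\<lambda>n. st_act a (x n))"
  by (simp add: free_mod_def)

lemma st_act_v8_elt [simp]: "st_act (v8_elt v) v8_one = v"
  using A1_coords_v8_elt[of v] by (simp add: A1_coords_def)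

lemma act_unit_vec: "act (free_mod G dg) (v8_elt v) (unit_vec n) = (\<lambda>m. if m = n then v else 0)"
  by (auto simp: act_free unit_vec_def fun_eq_iff)

lemma unit_vec_piece: "n \<in> G \<Longrightarrow> unit_vec n \<in> piece (free_mod G dg) (dg n)"
  by (auto simp: free_mod_def unit_vec_def v8_piece_def)

lemma unit_vec_total: "n \<in> G \<Longrightarrow> unit_vec n \<in> total (free_mod G dg)"
  by (rule gmodule.piece_subset_total[OF gmodule_free unit_vec_piece])

lemma free_expand:
  assumes "finite G" "\<And>n. n \<notin> G \<Longrightarrow> x n = 0"
  shows "x = (\<Sum>n\<in>G. act (free_mod G dg) (v8_elt (x n)) (unit_vec n))"
proof
  fix m
  have "(\<Sum>n\<in>G. act (free_mod G dg) (v8_elt (x n)) (unit_vec n)) m = (\<Sum>n\<in>G. if m = n then x n else 0)"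
    by (simp only: sum_fun_apply act_unit_vec)
  also have "\<dots> = x m" using assms by (simp add: sum.delta)
  finally show "x m = (\<Sum>n\<in>G. act (free_mod G dg) (v8_elt (x n)) (unit_vec n)) m" ..
qed

lemma (in gmodule) total_sum: "(\<And>i. i \<in> I \<Longrightarrow> f i \<in> total M) \<Longrightarrow> (\<Sum>i\<in>I. f i) \<in> total M"
  by (induction I rule: infinite_finite_induct) (auto intro: total_add)

lemma total_free:
  assumes "finite G" shows "total (free_mod G dg) = {x. \<forall>n. n \<notin> G \<longrightarrow> x n = 0}"
proof (intro equalityI subsetI CollectI)
  fix x assume "x \<in> total (free_mod G dg)"
  then show "\<forall>n. n \<notin> G \<longrightarrow> x n = 0"
    by (induction rule: gmodule.total_induct[OF gmodule_free, consumes 1]) (auto dest: free_pieceD(2))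
next
  fix x assume "x \<in> {x. \<forall>n. n \<notin> G \<longrightarrow> x n = (0::v8)}"
  then have "x = (\<Sum>n\<in>G. act (free_mod G dg) (v8_elt (x n)) (unit_vec n))"
    by (intro free_expand assms) auto
  also have "\<dots> \<in> total (free_mod G dg)"
    by (intro gmodule.total_sum[OF gmodule_free] gmodule.act_total[OF gmodule_free] v8_elt_in_A1 unit_vec_total)
  finally show "x \<in> total (free_mod G dg)" .
qed

section \<open>Dimension shifting\<close>

lemma cocyclesD: "f \<in> cocy s t M \<Longrightarrow> f \<in> coch s t M" "f \<in> cocy s t M \<Longrightarrow> coboundary s M f = (\<lambda>_ _. 0)"
  by (simp_all add: cocycles_def)

lemma cocyclesI: "f \<in> coch s t M \<Longrightarrow> coboundary s M f = (\<lambda>_ _. 0) \<Longrightarrow> f \<in> cocy s t M"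
  by (simp add: cocycles_def)

lemma cobo_0: "cobo 0 t M = {\<lambda>_ _. 0}"
  by (simp add: coboundaries_def)

lemma cobo_Suc: "cobo (Suc s) t M = coboundary s M ` coch s t M"
  by (simp add: coboundaries_def)

lemma zero_in_cobo: "(\<lambda>_ _. 0) \<in> cobo s t M"
proof (cases s)
  case (Suc r)
  have "(\<lambda>_ _. 0) = coboundary r M (\<lambda>_ _. 0 :: bit)" by simp
  then show ?thesis unfolding Suc cobo_Suc using cochain_zero by (rule image_eqI)
qed (simp add: cobo_0)

lemma cobo_add: "f \<in> cobo s t M \<Longrightarrow> g \<in> cobo s t M \<Longrightarrow> (\<lambda>as m. f as m + g as m) \<in> cobo s t M"
proof (cases s)
  case (Suc r)
  assume "f \<in> cobo s t M" "g \<in> cobo s t M"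
  then obtain f' g' where *: "f' \<in> coch r t M" "g' \<in> coch r t M" "f = coboundary r M f'" "g = coboundary r M g'"
    by (auto simp: Suc cobo_Suc)
  then have "(\<lambda>as m. f as m + g as m) = coboundary r M (\<lambda>as m. f' as m + g' as m)"
    by (intro ext) (simp add: coboundary_add)
  then show ?thesis using cochain_add[OF *(1,2)] by (auto simp: Suc cobo_Suc)
qed (auto simp: cobo_0)

lemma cocy_add: "f \<in> cocy s t M \<Longrightarrow> g \<in> cocy s t M \<Longrightarrow> (\<lambda>as m. f as m + g as m) \<in> cocy s t M"
  by (intro cocyclesI cochain_add) (simp_all add: cocyclesD coboundary_add fun_eq_iff)

context gmodule
begin

lemma cobo_cocy: "f \<in> cobo s t M \<Longrightarrow> f \<in> cocy s t M"
proof (cases s)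
  case 0
  assume "f \<in> cobo s t M"
  then show ?thesis by (simp add: 0 cobo_0 cocyclesI cochain_zero)
next
  case (Suc r)
  assume "f \<in> cobo s t M"
  then show ?thesis
    by (auto simp: Suc cobo_Suc coboundary_coboundary intro!: cocyclesI coboundary_cochain)
qed

lemma h0m_cocy: "f \<in> cocy s t M \<Longrightarrow> h0m s M f \<in> cocy (Suc s) (t + 1) M"
  using coboundary_h0m[of f s t] by (intro cocyclesI h0m_cochain) (simp_all add: cocyclesD h0m_def fun_eq_iff)

lemma h0m_cobo: "f \<in> cobo s t M \<Longrightarrow> h0m s M f \<in> cobo (Suc s) (t + 1) M"
proof (cases s)
  case 0
  assume "f \<in> cobo s t M"
  then have "h0m s M f = (\<lambda>_ _. 0)" by (auto simp: 0 cobo_0 h0m_def fun_eq_iff)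
  then show ?thesis using zero_in_cobo by metis
next
  case (Suc r)
  assume "f \<in> cobo s t M"
  then show ?thesis using coboundary_h0m h0m_cochain unfolding Suc cobo_Suc by force
qed

end

text \<open>Here \<open>\<phi>\<close> has to be linear, since the last face lets the algebra act on
  the module argument.\<close>

lemma coboundary_pull:
  assumes L: "gmodule L" and M: "gmodule M" and \<phi>: "gmap L M \<phi>"
    and eq: "\<And>a x. a \<in> A1 \<Longrightarrow> x \<in> total L \<Longrightarrow> \<phi> (act L a x) = act M a (\<phi> x)"
  shows "coboundary s L (pull s L \<phi> f) = (pull (Suc s) L \<phi> (coboundary s M f :: _ \<Rightarrow> _ \<Rightarrow> bit))"
proof (intro ext)
  fix as m
  show "coboundary s L (pull s L \<phi> f) as m = pull (Suc s) L \<phi> (coboundary s M f) as m"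
  proof (cases "(as, m) \<in> bar_dom (Suc s) L")
    case True
    then obtain bs b where as: "as = bs @ [b]" and bs: "(bs, m) \<in> bar_dom s L" and b: "b \<in> A1"
      by (rule gmodule.bar_domE_snoc[OF L])
    have m: "m \<in> total L" using bs by (simp add: bar_dom_iff)
    have "(as, \<phi> m) \<in> bar_dom (Suc s) M" using True gmap_total[OF L M \<phi>] by (simp add: bar_dom_iff)
    then show ?thesis
      using True gmodule.bar_dom_merge[OF L True] gmodule.bar_dom_act[OF L bs b]
      by (simp add: pull_def coboundary_eq eq[OF b m] as)
  qed (simp add: coboundary_outside pull_def)
qed

lemma pull_add: "pull s L \<phi> (\<lambda>as m. f as m + g as m) = (\<lambda>as m. pull s L \<phi> f as m + pull s L \<phi> g as m)"
  by (auto simp: pull_def fun_eq_iff)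

lemma pull_zero: "pull s L \<phi> (\<lambda>_ _. 0) = (\<lambda>_ _. 0)"
  by (simp add: pull_def fun_eq_iff)

lemma h0m_pull:
  assumes L: "gmodule L" and M: "gmodule M" and \<phi>: "gmap L M \<phi>"
  shows "h0m s L (pull s L \<phi> f) = pull (Suc s) L \<phi> (h0m s M f)"
proof (intro ext)
  fix as m
  show "h0m s L (pull s L \<phi> f) as m = pull (Suc s) L \<phi> (h0m s M f) as m"
  proof (cases "(as, m) \<in> bar_dom (Suc s) L")
    case True
    then obtain a b bs where as: "as = a # b # bs" "a \<in> A1" "b \<in> A1" "(1 # bs, m) \<in> bar_dom s L"
      by (rule bar_domE_Cons2)
    moreover from this gmap_total[OF L M \<phi>] have "(1 # bs, \<phi> m) \<in> bar_dom s M" by (simp add: bar_dom_iff)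
    ultimately show ?thesis using True by (simp add: gmodule.h0m_Cons[OF L] gmodule.h0m_Cons[OF M] pull_def)
  qed (simp add: pull_def h0m_def)
qed

text \<open>The section \<open>\<sigma>\<close> is additive and graded, but not \<open>A\<^sub>1\<close>-linear.\<close>

locale cover =
  fixes M :: "'m::ab_group_add gmod" and G :: "int set" and dg :: "int \<Rightarrow> int"
    and \<pi> :: "(int \<Rightarrow> v8) \<Rightarrow> 'm" and \<sigma> :: "'m \<Rightarrow> int \<Rightarrow> v8"
  assumes gmod_M: "gmodule M" and fin: "finite G"
    and pi_map: "gmap (free_mod G dg) M \<pi>"
    and pi_act: "\<And>a x. a \<in> A1 \<Longrightarrow> x \<in> total (free_mod G dg) \<Longrightarrow> \<pi> (act (free_mod G dg) a x) = act M a (\<pi> x)"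
    and sigma_map: "gmap M (free_mod G dg) \<sigma>"
    and pi_sigma: "\<And>m. m \<in> total M \<Longrightarrow> \<pi> (\<sigma> m) = m"
    and minimal: "\<And>x n. x \<in> total (free_mod G dg) \<Longrightarrow> \<pi> x = 0 \<Longrightarrow> c0 (x n) = 0"
begin

sublocale M: gmodule M by (rule gmod_M)

abbreviation F where "F \<equiv> free_mod G dg"

sublocale F: gmodule F by (rule gmodule_free)

text \<open>The first syzygy of \<open>M\<close> with respect to this cover.\<close>

definition K where "K = \<lparr>piece = (\<lambda>d. {x \<in> piece F d. \<pi> x = 0}), act = act F\<rparr>"

lemma pi_add: "x \<in> total F \<Longrightarrow> y \<in> total F \<Longrightarrow> \<pi> (x + y) = \<pi> x + \<pi> y"
  using pi_map by (simp add: gmap_def)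

lemma sigma_add: "x \<in> total M \<Longrightarrow> y \<in> total M \<Longrightarrow> \<sigma> (x + y) = \<sigma> x + \<sigma> y"
  using sigma_map by (simp add: gmap_def)

lemma pi_total: "x \<in> total F \<Longrightarrow> \<pi> x \<in> total M"
  by (rule gmap_total[OF F.gmodule_axioms M.gmodule_axioms pi_map])

lemma sigma_total: "x \<in> total M \<Longrightarrow> \<sigma> x \<in> total F"
  by (rule gmap_total[OF M.gmodule_axioms F.gmodule_axioms sigma_map])

lemma pi_zero [simp]: "\<pi> 0 = 0"
  using pi_add[of 0 0] by simp

lemma sigma_zero [simp]: "\<sigma> 0 = 0"
  using sigma_add[of 0 0] by simp

lemma pi_sum: "(\<And>i. i \<in> I \<Longrightarrow> f i \<in> total F) \<Longrightarrow> \<pi> (\<Sum>i\<in>I. f i) = (\<Sum>i\<in>I. \<pi> (f i))"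
  by (induction I rule: infinite_finite_induct) (simp_all add: pi_add F.total_sum)

text \<open>If a sum of homogeneous elements maps to 0, so does each summand, because the images lie
  in distinct degrees of \<open>M\<close>.\<close>

lemma total_K: "total K = {x \<in> total F. \<pi> x = 0}"
proof (intro equalityI subsetI CollectI)
  fix x assume "x \<in> total K"
  then obtain I f where f: "finite I" "\<forall>n\<in>I. f n \<in> piece K n" "x = (\<Sum>n\<in>I. f n)"
    by (auto simp: total_def)
  have ft: "f n \<in> total F" if "n \<in> I" for n
    using f(2) that by (intro F.piece_subset_total[of _ n]) (simp add: K_def)
  have "\<pi> x = (\<Sum>n\<in>I. \<pi> (f n))" unfolding f(3) by (rule pi_sum[OF ft])
  also have "\<dots> = 0" using f(2) by (intro sum.neutral) (simp add: K_def)
  finally show "x \<in> total F \<and> \<pi> x = 0" unfolding f(3) using ft by (simp add: F.total_sum)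
next
  fix x assume "x \<in> {x \<in> total F. \<pi> x = 0}"
  then have x: "x \<in> total F" "\<pi> x = 0" by auto
  obtain I f where f: "finite I" "\<And>n. f n \<in> piece F n" "x = (\<Sum>n\<in>I. f n)"
    by (rule F.totalE[OF x(1)]) blast
  have "(\<Sum>n\<in>I. \<pi> (f n)) = 0"
    using x(2) f F.piece_subset_total[OF f(2)] by (simp add: pi_sum)
  then have "\<pi> (f n) = 0" if "n \<in> I" for n
    using M.piece_indep[of I "\<lambda>n. \<pi> (f n)" n] f(1,2) pi_map that by (auto simp: gmap_def)
  then show "x \<in> total K"
    unfolding total_def using f by (intro CollectI exI[of _ I] exI[of _ f]) (simp add: K_def)
qed

lemma gmodule_K: "gmodule K"
proof -
  have 1: "x - y \<in> piece F n \<and> \<pi> (x - y) = 0" if "x \<in> piece F n" "y \<in> piece F n" "\<pi> x = 0" "\<pi> y = 0" for x y n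
  proof -
    have eq: "x - y = x + y" using that F.piece_subset_total by (intro F.diff_eq)
    show ?thesis unfolding eq using that F.piece_add[of x n y] pi_add[of x y] F.piece_subset_total by simp
  qed
  have 2: "\<pi> (act F a x) = 0" if "a \<in> A1" "x \<in> total F" "\<pi> x = 0" for a x
    using that by (simp add: pi_act M.act_zero_right)
  show ?thesis
    unfolding gmodule_def graded_A1_module_def total_K
  proof (intro conjI allI ballI impI; (elim conjE)?)
    fix I x n assume "finite I" "\<forall>n\<in>I. x n \<in> piece K n" "(\<Sum>n\<in>I. x n) = 0" "n \<in> I"
    then show "x n = 0" using F.piece_indep[of I x n] by (simp add: K_def)
  next
    fix p n a x assume "a \<in> A1 \<inter> steenrod_deg p" "x \<in> piece K n"
    then show "act K a x \<in> piece K (n + int p)"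
      using 2[of a x] F.act_piece[of a p x n] F.piece_subset_total[of x n] by (simp add: K_def)
  qed (use 1 in \<open>auto simp: K_def F.act_one F.act_mult F.act_plus F.act_add\<close>)
qed

sublocale K: gmodule K by (rule gmodule_K)

text \<open>An additive graded retraction of the cover onto \<open>K\<close>, with plus in place of
  minus; like \<open>\<sigma>\<close> it need not be linear.\<close>

definition proj where "proj x = x + \<sigma> (\<pi> x)"

lemma proj_in_K: "x \<in> total F \<Longrightarrow> proj x \<in> total K"
  by (simp add: total_K proj_def F.total_add sigma_total pi_total pi_add pi_sigma M.add_self)

lemma proj_K: "x \<in> total K \<Longrightarrow> proj x = x"
  by (simp add: total_K proj_def)

lemma gmap_proj: "gmap F K proj"
  unfolding gmap_def
proof (intro conjI ballI allI)
  fix x y assume "x \<in> total F" "y \<in> total F"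
  then show "proj (x + y) = proj x + proj y"
    by (simp add: proj_def pi_add sigma_add pi_total ac_simps)
next
  fix n x assume x: "x \<in> piece F n"
  then have "proj x \<in> piece F n"
    using sigma_map pi_map by (simp add: proj_def gmap_def F.piece_add)
  moreover have "\<pi> (proj x) = 0"
    using proj_in_K[OF F.piece_subset_total[OF x]] by (simp add: total_K)
  ultimately show "proj x \<in> piece K n" by (simp add: K_def)
qed

lemma gmap_incl: "gmap K F (\<lambda>x. x)"
  by (auto simp: gmap_def K_def)

section \<open>Restriction to the syzygy and acyclicity of the free cover\<close>

abbreviation res :: "nat \<Rightarrow> (steenrod list \<Rightarrow> (int \<Rightarrow> v8) \<Rightarrow> bit) \<Rightarrow> steenrod list \<Rightarrow> (int \<Rightarrow> v8) \<Rightarrow> bit" where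
  "res s \<equiv> pull s K (\<lambda>x. x)"

lemma res_cochain: "f \<in> coch s t F \<Longrightarrow> res s f \<in> coch s t K"
  by (rule pull_cochain[OF gmodule_K F.gmodule_axioms gmap_incl])

lemma coboundary_res: "coboundary s K (res s f) = res (Suc s) (coboundary s F f)"
  by (rule coboundary_pull[OF gmodule_K F.gmodule_axioms gmap_incl]) (simp add: K_def)

lemma pi_cochain: "f \<in> coch s t M \<Longrightarrow> pull s F \<pi> f \<in> coch s t F"
  by (rule pull_cochain[OF F.gmodule_axioms M.gmodule_axioms pi_map])

lemma coboundary_pi: "coboundary s F (pull s F \<pi> f) = (pull (Suc s) F \<pi> (coboundary s M f) :: _ \<Rightarrow> _ \<Rightarrow> bit)"
  by (rule coboundary_pull[OF F.gmodule_axioms M.gmodule_axioms pi_map]) (rule pi_act)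

text \<open>The extra degeneracy at the module end: the coordinates of \<open>x\<close> become a
  further bar entry, and only a basis vector stays behind in the module slot.\<close>

definition contr :: "nat \<Rightarrow> (steenrod list \<Rightarrow> (int \<Rightarrow> v8) \<Rightarrow> bit) \<Rightarrow> steenrod list \<Rightarrow> (int \<Rightarrow> v8) \<Rightarrow> bit" where
  "contr s f = (\<lambda>as x. if (as, x) \<in> bar_dom s F then \<Sum>n\<in>G. f (as @ [v8_elt (x n)]) (unit_vec n) else 0)"

lemma contr_zero: "contr s (\<lambda>_ _. 0) = (\<lambda>_ _. 0)"
  by (simp add: contr_def fun_eq_iff)

lemma contr_add: "contr s (\<lambda>as x. f as x + g as x) = (\<lambda>as x. contr s f as x + contr s g as x)"
  by (auto simp: contr_def fun_eq_iff sum.distrib)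

lemma bar_dom_snoc_unit: "(as, x) \<in> bar_dom s F \<Longrightarrow> n \<in> G \<Longrightarrow> a \<in> A1 \<Longrightarrow> (as @ [a], unit_vec n) \<in> bar_dom (Suc s) F"
  by (auto simp: bar_dom_iff unit_vec_total)

lemma slot_snoc:
  assumes f: "f \<in> coch (Suc s) t F" and "(as, x) \<in> bar_dom s F" "n \<in> G" "a \<in> A1" "b \<in> A1"
  shows "f (as @ [a + b]) (unit_vec n) = f (as @ [a]) (unit_vec n) + f (as @ [b]) (unit_vec n)"
proof -
  have "length as = Suc s" using assms(2) by (simp add: bar_dom_iff)
  then show ?thesis
    using cochain_slot[OF f bar_dom_snoc_unit[OF assms(2-4)], of "Suc s" a b] assms(4,5) by (simp add: list_update_append)
qed

lemma contr_cochain: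
  assumes f: "f \<in> coch (Suc s) t F"
  shows "contr s f \<in> coch s t F"
proof (rule cochainI)
  fix as x i a b assume *: "(as, x) \<in> bar_dom s F" "i \<le> s" "a \<in> A1" "b \<in> A1"
  then have "length as = Suc s" by (simp add: bar_dom_iff)
  then have "f (as[i := a + b] @ [v8_elt (x n)]) (unit_vec n) = f (as[i := a] @ [v8_elt (x n)]) (unit_vec n) +
     f (as[i := b] @ [v8_elt (x n)]) (unit_vec n)" if "n \<in> G" for n
    using cochain_slot[OF f bar_dom_snoc_unit[OF *(1) that v8_elt_in_A1] _ *(3,4), of i "x n"] *(2)
    by (simp add: list_update_append)
  then have "(\<Sum>n\<in>G. f (as[i := a + b] @ [v8_elt (x n)]) (unit_vec n)) =
     (\<Sum>n\<in>G. f (as[i := a] @ [v8_elt (x n)]) (unit_vec n)) + (\<Sum>n\<in>G. f (as[i := b] @ [v8_elt (x n)]) (unit_vec n))"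
    by (simp add: sum.distrib)
  moreover have "(as[i := c], x) \<in> bar_dom s F" if "c \<in> A1" for c
    using * that by (simp add: bar_dom_iff set_update_A1)
  ultimately show "contr s f (as[i := a + b]) x = contr s f (as[i := a]) x + contr s f (as[i := b]) x"
    using * by (simp add: contr_def A1.add)
next
  fix as x y assume *: "(as, x) \<in> bar_dom s F" "y \<in> total F"
  then have "(as, y) \<in> bar_dom s F" "(as, x + y) \<in> bar_dom s F"
    by (auto simp: bar_dom_iff F.total_add)
  then show "contr s f as (x + y) = contr s f as x + contr s f as y"
    using * slot_snoc[OF f *(1)] by (simp add: contr_def v8_elt_add v8_elt_in_A1 sum.distrib)
next
  fix as x a assume *: "(as, x) \<in> bar_dom s F" "a \<in> A1"
  then have l: "length as = Suc s" by (simp add: bar_dom_iff)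
  then have "f (as[0 := a * as ! 0] @ [v8_elt (x n)]) (unit_vec n) =
     augmentation a * f (as @ [v8_elt (x n)]) (unit_vec n)" if "n \<in> G" for n
    using cochain_aug[OF f bar_dom_snoc_unit[OF *(1) that v8_elt_in_A1] *(2), of "x n"]
    by (simp add: list_update_append nth_append)
  moreover have "(as[0 := a * as ! 0], x) \<in> bar_dom s F"
    using * l by (simp add: bar_dom_iff set_update_A1 A1.mult nth_A1)
  ultimately show "contr s f (as[0 := a * as ! 0]) x = augmentation a * contr s f as x"
    using * by (simp add: contr_def sum_distrib_left)
next
  fix as x ds d
  assume *: "(as, x) \<in> bar_dom s F" "list_all2 (\<lambda>d a. a \<in> steenrod_deg d) ds as" "x \<in> piece F d"
    "d + int (sum_list ds) \<noteq> t"
  have "f (as @ [v8_elt (x n)]) (unit_vec n) = 0" if n: "n \<in> G" for n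
  \<comment> \<open>The degrees of \<open>steenrod_deg\<close> are natural numbers, so negative
    degrees, where the coordinate is zero, are treated apart.\<close>
  proof (cases "d - dg n < 0")
    case True
    have "x n \<in> v8_piece (d - dg n)" using *(3) n by (rule free_pieceD)
    with True have "x n = 0" by (cases "x n") (auto simp: v8_piece_def zero_v8_def)
    then show ?thesis using slot_snoc[OF f *(1) n A1.zero A1.zero] by simp
  next
    case False
    then have eq: "int (nat (d - dg n)) = d - dg n" by simp
    have "x n \<in> v8_piece (d - dg n)" using *(3) n by (rule free_pieceD)
    then have "v8_elt (x n) \<in> steenrod_deg (nat (d - dg n))" using eq by (intro v8_elt_deg) simp
    then have "list_all2 (\<lambda>d a. a \<in> steenrod_deg d) (ds @ [nat (d - dg n)]) (as @ [v8_elt (x n)])"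
      using *(2) by (simp add: list_all2_appendI)
    from cochain_deg[OF f bar_dom_snoc_unit[OF *(1) n v8_elt_in_A1] this unit_vec_piece[OF n]] *(4) eq
    show ?thesis by simp
  qed
  then show "contr s f as x = 0" by (simp add: contr_def)
qed (simp add: contr_def)

lemma cochain_expand:
  assumes f: "f \<in> coch s t F" and dom: "(as, x) \<in> bar_dom s F"
  shows "(\<Sum>n\<in>G. f as (act F (v8_elt (x n)) (unit_vec n))) = f as x"
proof -
  let ?u = "\<lambda>n. act F (v8_elt (x n)) (unit_vec n)"
  have t: "?u n \<in> total F" if "n \<in> G" for n
    using that by (intro F.act_total v8_elt_in_A1 unit_vec_total)
  have "f as (\<Sum>n\<in>I. ?u n) = (\<Sum>n\<in>I. f as (?u n))" if "finite I" "I \<subseteq> G" for I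
    using that
  proof (induction I)
    case empty
    then show ?case using cochain_mod_zero[OF f F.zero_in_total] by (simp only: sum.empty)
  next
    case (insert n I)
    then have "(\<Sum>n\<in>I. ?u n) \<in> total F" "(as, ?u n) \<in> bar_dom s F"
      using t dom by (auto intro!: F.total_sum simp: bar_dom_iff)
    then have "f as (?u n + (\<Sum>n\<in>I. ?u n)) = f as (?u n) + f as (\<Sum>n\<in>I. ?u n)"
      by (intro cochain_mod[OF f])
    moreover have "f as (\<Sum>n\<in>I. ?u n) = (\<Sum>n\<in>I. f as (?u n))"
      using insert by simp
    ultimately show ?case unfolding sum.insert[OF insert.hyps(1,2)] by (simp only:)
  qed
  from this[OF fin subset_refl] have eq: "f as (\<Sum>n\<in>G. ?u n) = (\<Sum>n\<in>G. f as (?u n))" .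
  have "x = (\<Sum>n\<in>G. ?u n)"
    using dom by (intro free_expand fin) (simp add: bar_dom_iff total_free fin)
  then have "f as x = f as (\<Sum>n\<in>G. ?u n)" by (rule arg_cong)
  with eq show ?thesis by (simp only:)
qed

text \<open>The faces not touching the new entry occur in both terms and cancel, as does the product
  of the last entry with the new one, because coordinates are equivariant. The remaining face lets
  the coordinates act on the basis vectors and reassembles \<open>x\<close>.\<close>

lemma coboundary_contr:
  assumes f: "f \<in> coch (Suc s) t F" and dom: "(as, x) \<in> bar_dom (Suc s) F"
  shows "coboundary s F (contr s f) as x + contr (Suc s) (coboundary (Suc s) F f) as x = f as x"
proof -
  obtain bs b where as: "as = bs @ [b]" and bs: "(bs, x) \<in> bar_dom s F" and b: "b \<in> A1"
    using dom by (rule F.bar_domE_snoc)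
  have len: "length bs = Suc s" using bs by (simp add: bar_dom_iff)
  let ?v = "\<lambda>n. v8_elt (x n)"
  have x: "x \<in> total F" using dom by (simp add: bar_dom_iff)
  have *: "(\<Sum>n\<in>G. coboundary (Suc s) F f (as @ [?v n]) (unit_vec n)) =
    (\<Sum>i\<le>s. \<Sum>n\<in>G. f (merge i as @ [?v n]) (unit_vec n)) + (\<Sum>n\<in>G. f (bs @ [b * ?v n]) (unit_vec n))
    + (\<Sum>n\<in>G. f as (act F (?v n) (unit_vec n)))"
  proof -
    have "coboundary (Suc s) F f (as @ [?v n]) (unit_vec n) =
      (\<Sum>i\<le>s. f (merge i as @ [?v n]) (unit_vec n)) + f (bs @ [b * ?v n]) (unit_vec n)
      + f as (act F (?v n) (unit_vec n))" if n: "n \<in> G" for n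
    proof -
      have "(as, unit_vec n) \<in> bar_dom (Suc s) F" using dom n by (simp add: bar_dom_iff unit_vec_total)
      then have "coboundary (Suc s) F f (as @ [?v n]) (unit_vec n) =
        (\<Sum>i\<le>Suc s. f (merge i (as @ [?v n])) (unit_vec n)) + f as (act F (?v n) (unit_vec n))"
        by (intro F.coboundary_snoc v8_elt_in_A1)
      moreover have "merge i (as @ [?v n]) = merge i as @ [?v n]" if "i \<le> s" for i
        using that len by (intro merge_snoc) (simp add: as)
      moreover have "merge (Suc s) (as @ [?v n]) = bs @ [b * ?v n]"
        using merge_snoc_last[of "Suc s" bs b "?v n"] len by (simp add: as)
      ultimately show ?thesis by simp
    qed
    then have "(\<Sum>n\<in>G. coboundary (Suc s) F f (as @ [?v n]) (unit_vec n)) =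
      (\<Sum>n\<in>G. (\<Sum>i\<le>s. f (merge i as @ [?v n]) (unit_vec n)) + f (bs @ [b * ?v n]) (unit_vec n)
      + f as (act F (?v n) (unit_vec n)))" by (rule sum.cong[OF refl])
    then show ?thesis by (simp add: sum.distrib sum.swap[of _ "{..s}" G])
  qed
  have "v8_elt (act F b x n) = b * ?v n" for n
    using b by (simp add: act_free A1_mult_v8_elt)
  then have "coboundary s F (contr s f) as x = (\<Sum>i\<le>s. \<Sum>n\<in>G. f (merge i as @ [?v n]) (unit_vec n)) +
     (\<Sum>n\<in>G. f (bs @ [b * ?v n]) (unit_vec n))"
    using F.bar_dom_merge[OF dom] F.bar_dom_act[OF bs b]
    unfolding as F.coboundary_snoc[OF bs b] by (simp add: contr_def)
  then show ?thesis using * dom cochain_expand[OF f dom] by (simp add: contr_def ac_simps)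
qed

lemma coboundary_contr_cocycle:
  assumes "f \<in> cocy (Suc s) t F"
  shows "coboundary s F (contr s f) = f"
proof (intro ext)
  fix as x
  show "coboundary s F (contr s f) as x = f as x"
  proof (cases "(as, x) \<in> bar_dom (Suc s) F")
    case True
    from coboundary_contr[OF cocyclesD(1)[OF assms] this] show ?thesis
      by (simp add: cocyclesD(2)[OF assms] contr_zero)
  qed (use cochain_outside[OF cocyclesD(1)[OF assms]] in \<open>simp add: coboundary_outside\<close>)
qed

text \<open>In positive degree \<open>contr\<close> already makes \<open>w\<close> a coboundary. In
  degree 0 a cocycle is an equivariant map to Z/2; it sees only the augmentations of the
  coordinates, and \<open>minimal\<close> makes these vanish on \<open>K\<close>.\<close>

lemma res_cocycle:
  assumes w: "w \<in> cocy s t F"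
  shows "res s w \<in> cobo s t K"
proof (cases s)
  case (Suc r)
  then have "w = coboundary r F (contr r w)" using w coboundary_contr_cocycle by simp
  then have "res s w = coboundary r K (res r (contr r w))" by (simp only: Suc coboundary_res)
  moreover have "res r (contr r w) \<in> coch r t K"
    using w by (intro res_cochain contr_cochain) (simp add: Suc cocyclesD)
  ultimately show ?thesis by (simp add: Suc cobo_Suc)
next
  case 0
  note wc = cocyclesD(1)[OF w]
  have "res 0 w as x = 0" for as x
  proof (cases "(as, x) \<in> bar_dom 0 K")
    case True
    then obtain a where as: "as = [a]" "a \<in> A1" and x: "x \<in> total F" "\<pi> x = 0"
      by (cases as) (auto simp: bar_dom_iff total_K)
    have "w [a] (act F (v8_elt (x n)) (unit_vec n)) = 0" if n: "n \<in> G" for n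
    proof -
      have d: "([a * v8_elt (x n)], unit_vec n) \<in> bar_dom 0 F" "([a, v8_elt (x n)], unit_vec n) \<in> bar_dom (Suc 0) F"
        using as n by (auto simp: bar_dom_iff unit_vec_total v8_elt_in_A1 A1.mult)
      have "0 = coboundary 0 F w [a, v8_elt (x n)] (unit_vec n)" using cocyclesD(2)[OF w] by (simp add: 0)
      also have "\<dots> = w [a * v8_elt (x n)] (unit_vec n) + w [a] (act F (v8_elt (x n)) (unit_vec n))"
        using d by (simp add: coboundary_eq)
      also have "w [a * v8_elt (x n)] (unit_vec n) = 0"
        using cochain_head[OF wc[unfolded 0] d(1)] minimal[OF x, of n]
        by (simp add: augmentation_A1_coords[OF v8_elt_in_A1])
      finally show ?thesis by simp
    qed
    then show ?thesis using True cochain_expand[OF wc[unfolded 0], of as x] x as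
      by (simp add: pull_def bar_dom_iff)
  qed (simp add: pull_def)
  then show ?thesis by (simp add: 0 cobo_0 fun_eq_iff)
qed

text \<open>On cohomology this inverts the connecting map of 0 -> K -> F -> M -> 0: pull back to the
  cover, take the primitive provided by \<open>contr\<close>, restrict it to the kernel.\<close>

definition shift :: "nat \<Rightarrow> (steenrod list \<Rightarrow> 'm \<Rightarrow> bit) \<Rightarrow> steenrod list \<Rightarrow> (int \<Rightarrow> v8) \<Rightarrow> bit" where
  "shift s f = res s (contr s (pull (Suc s) F \<pi> f))"

lemma shift_add: "shift s (\<lambda>as m. f as m + g as m) = (\<lambda>as m. shift s f as m + shift s g as m)"
  by (simp add: shift_def pull_add contr_add)

lemma pi_cocycle:
  assumes f: "f \<in> cocy s t M" shows "pull s F \<pi> f \<in> cocy s t F"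
  using cocyclesD[OF f] by (intro cocyclesI pi_cochain) (simp_all add: coboundary_pi pull_zero)

lemma contr_pi_cochain: "f \<in> cocy (Suc s) t M \<Longrightarrow> contr s (pull (Suc s) F \<pi> f) \<in> coch s t F"
  by (intro contr_cochain pi_cochain cocyclesD)

lemma coboundary_contr_pi: "f \<in> cocy (Suc s) t M \<Longrightarrow> coboundary s F (contr s (pull (Suc s) F \<pi> f)) = pull (Suc s) F \<pi> f"
  by (rule coboundary_contr_cocycle[OF pi_cocycle])

lemma res_pi:
  assumes f: "f \<in> coch s t M" shows "res s (pull s F \<pi> f) = (\<lambda>_ _. 0)"
  using cochain_mod_zero[OF f] by (auto simp: pull_def fun_eq_iff bar_dom_iff total_K)

lemma shift_cocy:
  assumes "f \<in> cocy (Suc s) t M" shows "shift s f \<in> cocy s t K"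
  using assms by (intro cocyclesI)
    (simp_all add: shift_def res_cochain contr_pi_cochain coboundary_res coboundary_contr_pi
      res_pi[OF cocyclesD(1)[OF assms]])

text \<open>If \<open>g\<close> bounds \<open>f\<close>, then the primitive chosen by
  \<open>contr\<close> and the pullback of \<open>g\<close> differ by a cocycle on the cover. The
  pullback of \<open>g\<close> dies on \<open>K\<close>, and \<open>res_cocycle\<close> handles the
  difference.\<close>

lemma shift_cobo:
  assumes "f \<in> cobo (Suc s) t M" shows "shift s f \<in> cobo s t K"
proof -
  from assms obtain g where g: "g \<in> coch s t M" "f = coboundary s M g" by (auto simp: cobo_Suc)
  have fc: "f \<in> cocy (Suc s) t M" using assms by (rule M.cobo_cocy)
  let ?u = "contr s (pull (Suc s) F \<pi> f)"
  have "(\<lambda>as x. ?u as x + pull s F \<pi> g as x) \<in> cocy s t F"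
    using coboundary_contr_pi[OF fc]
    by (intro cocyclesI cochain_add contr_pi_cochain[OF fc] pi_cochain g(1) ext)
      (simp add: coboundary_add coboundary_pi g(2))
  from res_cocycle[OF this] show ?thesis
    by (simp add: pull_add res_pi[OF g(1)] shift_def)
qed

text \<open>Exactness in the middle: \<open>x\<close> and \<open>\<sigma> (\<pi> x)\<close> differ
  by the element \<open>proj x\<close> of \<open>K\<close>, on which \<open>f\<close>
  vanishes.\<close>

lemma pull_pi_sigma:
  assumes f: "f \<in> coch s t F" and "res s f = (\<lambda>_ _. 0)"
  shows "pull s F \<pi> (pull s M \<sigma> f) = f"
proof (intro ext)
  fix as x
  show "pull s F \<pi> (pull s M \<sigma> f) as x = f as x"
  proof (cases "(as, x) \<in> bar_dom s F")
    case True
    then have x: "x \<in> total F" by (simp add: bar_dom_iff)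
    have d: "(as, proj x) \<in> bar_dom s F" "(as, proj x) \<in> bar_dom s K"
      using True proj_in_K[OF x] by (auto simp: bar_dom_iff total_K)
    have "f as (proj x) = 0" using fun_cong[OF fun_cong[OF assms(2)], of as "proj x"] d by (simp add: pull_def)
    moreover have "f as (proj x) = f as x + f as (\<sigma> (\<pi> x))"
      unfolding proj_def by (rule cochain_mod[OF f True sigma_total[OF pi_total[OF x]]])
    ultimately have "f as (\<sigma> (\<pi> x)) = f as x" by (metis bit_add_self(2) add.right_neutral)
    then show ?thesis using True pi_total[OF x] by (simp add: pull_def bar_dom_iff)
  qed (use cochain_outside[OF f] in \<open>simp add: pull_def\<close>)
qed

lemma sigma_cochain: "f \<in> coch s t F \<Longrightarrow> pull s M \<sigma> f \<in> coch s t M"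
  by (rule pull_cochain[OF M.gmodule_axioms F.gmodule_axioms sigma_map])

lemma pull_pi_inject:
  assumes "pull s F \<pi> f = pull s F \<pi> g" "\<And>as m. (as, m) \<notin> bar_dom s M \<Longrightarrow> f as m = g as m"
  shows "f = g"
proof (intro ext)
  fix as m
  show "f as m = g as m"
  proof (cases "(as, m) \<in> bar_dom s M")
    case True
    then show ?thesis using fun_cong[OF fun_cong[OF assms(1)], of as "\<sigma> m"]
      by (simp add: pull_def bar_dom_iff sigma_total pi_sigma)
  qed (rule assms(2))
qed

text \<open>Extend \<open>g\<close> to the cover along \<open>proj\<close>. The coboundary of the
  extension vanishes on \<open>K\<close> and descends to a cocycle on \<open>M\<close>; extension
  and chosen primitive then differ by a cocycle on the cover.\<close>

lemma shift_surj:
  assumes g: "g \<in> cocy s t K"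
  shows "\<exists>f\<in>cocy (Suc s) t M. (\<lambda>as m. shift s f as m + g as m) \<in> cobo s t K"
proof -
  define u where "u = pull s F proj g"
  have u: "u \<in> coch s t F"
    unfolding u_def by (rule pull_cochain[OF F.gmodule_axioms gmodule_K gmap_proj cocyclesD(1)[OF g]])
  have res_u: "res s u = g"
    using cochain_outside[OF cocyclesD(1)[OF g]] by (auto simp: fun_eq_iff u_def pull_def bar_dom_iff proj_K) (auto simp: total_K)
  define f where "f = pull (Suc s) M \<sigma> (coboundary s F u)"
  have "res (Suc s) (coboundary s F u) = (\<lambda>_ _. 0)"
    using coboundary_res[of s u] cocyclesD(2)[OF g] by (simp add: res_u)
  from pull_pi_sigma[OF F.coboundary_cochain[OF u] this] have pf: "pull (Suc s) F \<pi> f = coboundary s F u"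
    by (simp add: f_def)
  have fc: "f \<in> coch (Suc s) t M" unfolding f_def by (intro sigma_cochain F.coboundary_cochain u)
  have "coboundary (Suc s) M f = (\<lambda>_ _. 0)"
    by (rule pull_pi_inject[of "Suc (Suc s)"])
      (simp_all add: coboundary_pi[symmetric] pf F.coboundary_coboundary pull_zero coboundary_outside)
  with fc have f: "f \<in> cocy (Suc s) t M" by (rule cocyclesI)
  have "(\<lambda>as x. contr s (pull (Suc s) F \<pi> f) as x + u as x) \<in> cocy s t F"
    using coboundary_contr_pi[OF f] pf
    by (intro cocyclesI cochain_add contr_pi_cochain[OF f] u ext) (simp add: coboundary_add)
  from res_cocycle[OF this] have "(\<lambda>as m. shift s f as m + g as m) \<in> cobo s t K"
    by (simp add: pull_add res_u shift_def)
  with f show ?thesis by blast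
qed

text \<open>Correct the primitive by a cocycle \<open>w\<close> on the cover with the same
  restriction to \<open>K\<close>. The corrected primitive vanishes on \<open>K\<close>, so it
  descends to \<open>M\<close> and bounds \<open>f\<close> there.\<close>

lemma shift_inj:
  assumes f: "f \<in> cocy (Suc s) t M" and "shift s f \<in> cobo s t K"
  shows "f \<in> cobo (Suc s) t M"
proof -
  have "\<exists>w\<in>coch s t F. coboundary s F w = (\<lambda>_ _. 0) \<and> res s w = shift s f"
  proof (cases s)
    case 0
    with assms(2) have "shift s f = (\<lambda>_ _. 0)" by (simp add: cobo_0)
    then show ?thesis using cochain_zero[of s t F] by (intro bexI[of _ "\<lambda>_ _. 0"]) (simp_all add: pull_zero)
  next
    case (Suc r)
    with assms(2) obtain v where v: "v \<in> coch r t K" "shift s f = coboundary r K v" by (auto simp: cobo_Suc)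
    have "res r (pull r F proj v) = v"
      using cochain_outside[OF v(1)] by (auto simp: fun_eq_iff pull_def bar_dom_iff proj_K) (auto simp: total_K)
    moreover have "pull r F proj v \<in> coch r t F"
      by (rule pull_cochain[OF F.gmodule_axioms gmodule_K gmap_proj v(1)])
    ultimately show ?thesis using v(2) coboundary_res[of r "pull r F proj v"]
      by (intro bexI[of _ "coboundary r F (pull r F proj v)"])
        (simp_all add: Suc F.coboundary_coboundary F.coboundary_cochain)
  qed
  then obtain w where w: "w \<in> coch s t F" "coboundary s F w = (\<lambda>_ _. 0)" "res s w = shift s f" by blast
  define v where "v = (\<lambda>as x. contr s (pull (Suc s) F \<pi> f) as x + w as x)"
  have v: "v \<in> coch s t F" unfolding v_def by (intro cochain_add contr_pi_cochain[OF f] w(1))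
  have dv: "coboundary s F v = pull (Suc s) F \<pi> f"
    using coboundary_contr_pi[OF f] by (intro ext) (simp add: v_def coboundary_add w(2))
  have "res s v = (\<lambda>_ _. 0)" by (simp add: v_def pull_add w(3) shift_def[symmetric])
  from pull_pi_sigma[OF v this] have "pull s F \<pi> (pull s M \<sigma> v) = v" .
  then have "pull (Suc s) F \<pi> (coboundary s M (pull s M \<sigma> v)) = pull (Suc s) F \<pi> f"
    by (simp add: coboundary_pi[symmetric] dv)
  then have "coboundary s M (pull s M \<sigma> v) = f"
    by (rule pull_pi_inject) (use cochain_outside[OF cocyclesD(1)[OF f]] in \<open>simp add: coboundary_outside\<close>)
  then show ?thesis using sigma_cochain[OF v] by (auto simp: cobo_Suc)
qed

text \<open>The product works at the front of the bar list, \<open>contr\<close> at its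
  back.\<close>

lemma shift_h0m:
  assumes f: "f \<in> cocy (Suc s) t M"
  shows "shift (Suc s) (h0m (Suc s) M f) = h0m s K (shift s f)"
proof -
  have "contr (Suc s) (h0m (Suc s) F g) = h0m s F (contr s g)" for g
  proof (intro ext)
    fix as x
    show "contr (Suc s) (h0m (Suc s) F g) as x = h0m s F (contr s g) as x"
    proof (cases "(as, x) \<in> bar_dom (Suc s) F")
      case True
      then obtain a b bs where as: "as = a # b # bs" and ab: "a \<in> A1" "b \<in> A1" and bs: "(1 # bs, x) \<in> bar_dom s F"
        by (rule bar_domE_Cons2)
      have "(1 # bs @ [v8_elt (x n)], unit_vec n) \<in> bar_dom (Suc s) F" if "n \<in> G" for n
        using bar_dom_snoc_unit[OF bs that v8_elt_in_A1] by simp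
      then show ?thesis using True bs ab
        by (simp add: contr_def as F.h0m_Cons sum_distrib_left)
    qed (simp add: contr_def h0m_def)
  qed
  then show ?thesis
    by (simp add: shift_def h0m_pull[OF gmodule_K F.gmodule_axioms gmap_incl]
        h0m_pull[OF F.gmodule_axioms M.gmodule_axioms pi_map, symmetric])
qed

end

text \<open>These three predicates speak of cocycles instead of quotient groups: dimension shifting
  compares modules over different types, and statements about cochains transport without
  isomorphisms.\<close>

definition ext_trivial :: "nat \<Rightarrow> int \<Rightarrow> 'm::ab_group_add gmod \<Rightarrow> bool" where
  "ext_trivial s t M \<longleftrightarrow> cocy s t M \<subseteq> cobo s t M"

definition ext_one_dim :: "nat \<Rightarrow> int \<Rightarrow> 'm::ab_group_add gmod \<Rightarrow> bool" where
  "ext_one_dim s t M \<longleftrightarrow> (\<exists>f\<in>cocy s t M. f \<notin> cobo s t M \<and>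
     (\<forall>g\<in>cocy s t M. g \<in> cobo s t M \<or> (\<lambda>as m. g as m + f as m) \<in> cobo s t M))"

definition ext_h0_inj :: "nat \<Rightarrow> int \<Rightarrow> 'm::ab_group_add gmod \<Rightarrow> bool" where
  "ext_h0_inj s t M \<longleftrightarrow> (\<forall>f\<in>cocy s t M. f \<notin> cobo s t M \<longrightarrow> h0m s M f \<notin> cobo (Suc s) (t + 1) M)"

context cover
begin

lemma ext_trivial_shift: "ext_trivial s t K \<Longrightarrow> ext_trivial (Suc s) t M"
  unfolding ext_trivial_def by (meson shift_cocy shift_inj subset_iff)

lemma ext_h0_inj_shift: "ext_h0_inj s t K \<Longrightarrow> ext_h0_inj (Suc s) t M"
  unfolding ext_h0_inj_def by (metis shift_cocy shift_inj shift_cobo shift_h0m)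

lemma ext_one_dim_shift:
  assumes "ext_one_dim s t K" shows "ext_one_dim (Suc s) t M"
proof -
  from assms obtain g where g: "g \<in> cocy s t K" "g \<notin> cobo s t K"
    "\<And>h. h \<in> cocy s t K \<Longrightarrow> h \<in> cobo s t K \<or> (\<lambda>as m. h as m + g as m) \<in> cobo s t K"
    by (auto simp: ext_one_dim_def)
  obtain f where f: "f \<in> cocy (Suc s) t M" "(\<lambda>as m. shift s f as m + g as m) \<in> cobo s t K"
    using shift_surj[OF g(1)] by blast
  have "f \<notin> cobo (Suc s) t M"
  proof
    assume "f \<in> cobo (Suc s) t M"
    from cobo_add[OF f(2) shift_cobo[OF this]] have "g \<in> cobo s t K"
      by (simp add: add.commute add.left_commute)
    with g(2) show False ..
  qed
  moreover have "h \<in> cobo (Suc s) t M \<or> (\<lambda>as m. h as m + f as m) \<in> cobo (Suc s) t M"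
    if h: "h \<in> cocy (Suc s) t M" for h
    using g(3)[OF shift_cocy[OF h]]
  proof
    assume "shift s h \<in> cobo s t K"
    then show ?thesis using shift_inj[OF h] by blast
  next
    assume "(\<lambda>as m. shift s h as m + g as m) \<in> cobo s t K"
    from cobo_add[OF this f(2)] have "shift s (\<lambda>as m. h as m + f as m) \<in> cobo s t K"
      by (simp add: shift_add ac_simps)
    then show ?thesis using shift_inj[OF cocy_add[OF h f(1)]] by blast
  qed
  ultimately show ?thesis using f(1) by (auto simp: ext_one_dim_def)
qed

end

section \<open>Ext from a minimal resolution\<close>

context cover
begin

text \<open>Two lifts of one element differ by an element of the kernel, whose augmentations vanish
  by minimality.\<close>

lemma c0_sigma_pi:
  assumes x: "x \<in> total F" shows "c0 (\<sigma> (\<pi> x) n) = c0 (x n)"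
proof -
  have "c0 (proj x n) = 0" using proj_in_K[OF x] by (intro minimal) (auto simp: total_K)
  then have "c0 (x n) + c0 (\<sigma> (\<pi> x) n) = 0" by (simp add: proj_def)
  then show ?thesis by (metis bit_add_self(2) add.right_neutral)
qed

lemma cocycle0_act:
  assumes f: "f \<in> cocy 0 t M" and "a \<in> A1" "m \<in> total M"
  shows "f [1] (act M a m) = augmentation a * f [1] m"
proof -
  have d: "([a], m) \<in> bar_dom 0 M" "([1, a], m) \<in> bar_dom (Suc 0) M"
    using assms by (auto simp: bar_dom_iff A1.one)
  have "0 = coboundary 0 M f [1, a] m" using cocyclesD(2)[OF f] by simp
  also have "\<dots> = f [a] m + f [1] (act M a m)" using d by (simp add: coboundary_eq)
  also have "f [a] m = augmentation a * f [1] m" by (rule cochain_head[OF cocyclesD(1)[OF f] d(1)])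
  finally show ?thesis by (metis bit_add_self(2) add.right_neutral)
qed

lemma bar_dom_0: "m \<in> total M \<Longrightarrow> ([1], m) \<in> bar_dom 0 M"
  by (simp add: bar_dom_iff A1.one)

lemma cochain0_sum:
  assumes f: "f \<in> coch 0 t M" and "\<And>n. n \<in> I \<Longrightarrow> u n \<in> total M"
  shows "f [1] (\<Sum>n\<in>I. u n) = (\<Sum>n\<in>I. f [1] (u n))"
  using assms(2)
proof (induction I rule: infinite_finite_induct)
  case (insert n I)
  then show ?case using cochain_mod[OF f bar_dom_0] by (simp add: M.total_sum)
qed (simp_all add: cochain_mod_zero[OF f])

lemma pi_expand:
  assumes "x \<in> total F"
  shows "\<pi> x = (\<Sum>n\<in>G. act M (v8_elt (x n)) (\<pi> (unit_vec n)))"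
proof -
  have "\<pi> x = \<pi> (\<Sum>n\<in>G. act F (v8_elt (x n)) (unit_vec n))"
    using assms by (intro arg_cong[where f = \<pi>] free_expand fin) (simp add: total_free fin)
  also have "\<dots> = (\<Sum>n\<in>G. \<pi> (act F (v8_elt (x n)) (unit_vec n)))"
    by (intro pi_sum F.act_total v8_elt_in_A1 unit_vec_total)
  finally show ?thesis by (simp add: pi_act unit_vec_total v8_elt_in_A1)
qed

lemma pi_unit_vec_total: "n \<in> G \<Longrightarrow> \<pi> (unit_vec n) \<in> total M"
  by (rule pi_total[OF unit_vec_total])

lemma cocycle0_pi:
  assumes f: "f \<in> cocy 0 t M" and x: "x \<in> total F"
  shows "f [1] (\<pi> x) = (\<Sum>n\<in>G. c0 (x n) * f [1] (\<pi> (unit_vec n)))"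
  unfolding pi_expand[OF x]
  by (simp add: cochain0_sum[OF cocyclesD(1)[OF f]] M.act_total v8_elt_in_A1 pi_unit_vec_total
      cocycle0_act[OF f] augmentation_A1_coords)

lemma cochain0_unit_vec:
  assumes f: "f \<in> coch 0 t M" and "n \<in> G" "dg n \<noteq> t"
  shows "f [1] (\<pi> (unit_vec n)) = 0"
proof -
  have "\<pi> (unit_vec n) \<in> piece M (dg n)" using pi_map unit_vec_piece[OF assms(2)] by (auto simp: gmap_def)
  from cochain_deg[OF f bar_dom_0[OF pi_unit_vec_total] _ this, of "[0]"] show ?thesis
    using assms(2,3) by (simp add: one_in_steenrod_deg)
qed

lemma cochain0_ext:
  assumes f: "f \<in> coch 0 t M" and g: "g \<in> coch 0 t M" and "\<And>m. m \<in> total M \<Longrightarrow> f [1] m = g [1] m"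
  shows "f = g"
proof (intro ext)
  fix as m
  show "f as m = g as m"
  proof (cases "(as, m) \<in> bar_dom 0 M")
    case True
    then obtain a where "as = [a]" "m \<in> total M" by (cases as) (auto simp: bar_dom_iff)
    then show ?thesis using True assms(3) cochain_head[OF f] cochain_head[OF g] by simp
  qed (simp add: cochain_outside[OF f] cochain_outside[OF g])
qed

lemma cocycle0_eq_zero:
  assumes f: "f \<in> cocy 0 t M" and "\<And>n. n \<in> G \<Longrightarrow> dg n = t \<Longrightarrow> f [1] (\<pi> (unit_vec n)) = 0"
  shows "f = (\<lambda>_ _. 0)"
proof (rule cochain0_ext[OF cocyclesD(1)[OF f] cochain_zero])
  fix m assume m: "m \<in> total M"
  have "f [1] (\<pi> (\<sigma> m)) = 0"
    unfolding cocycle0_pi[OF f sigma_total[OF m]]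
    using assms(2) cochain0_unit_vec[OF cocyclesD(1)[OF f]] by (intro sum.neutral) (metis mult_zero_right)
  then show "f [1] m = 0" by (simp add: pi_sigma m)
qed

lemma ext_trivial_base:
  assumes "\<And>n. n \<in> G \<Longrightarrow> dg n \<noteq> t" shows "ext_trivial 0 t M"
  using cocycle0_eq_zero assms by (auto simp: ext_trivial_def cobo_0)

text \<open>The functional dual to generator \<open>n\<close>. By \<open>c0_sigma_pi\<close> every
  lift of \<open>m\<close> gives the same value, and this makes the functional equivariant although
  \<open>\<sigma>\<close> is not.\<close>

definition dual :: "int \<Rightarrow> steenrod list \<Rightarrow> 'm \<Rightarrow> bit" where
  "dual n = (\<lambda>as m. if (as, m) \<in> bar_dom 0 M then augmentation (hd as) * c0 (\<sigma> m n) else 0)"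

lemma dual_cocy:
  assumes n: "n \<in> G" shows "dual n \<in> cocy 0 (dg n) M"
proof (rule cocyclesI)
  have *: "(as, m) \<in> bar_dom 0 M \<longleftrightarrow> (\<exists>a. as = [a] \<and> a \<in> A1 \<and> m \<in> total M)" for as m
    by (cases as) (auto simp: bar_dom_iff)
  have **: "([a], m) \<in> bar_dom 0 M \<longleftrightarrow> a \<in> A1 \<and> m \<in> total M" for a m
    by (simp add: bar_dom_iff)
  show "dual n \<in> coch 0 (dg n) M"
  proof (rule cochainI)
    fix as m ds d
    assume "(as, m) \<in> bar_dom 0 M" "list_all2 (\<lambda>d a. a \<in> steenrod_deg d) ds as" "m \<in> piece M d"
      "d + int (sum_list ds) \<noteq> dg n"
    then obtain a e where a: "as = [a]" "ds = [e]" "a \<in> A1" "a \<in> steenrod_deg e" "m \<in> piece M d" "d + int e \<noteq> dg n"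
      by (auto simp: * list_all2_Cons2)
    have "\<sigma> m \<in> piece F d" using sigma_map a(5) by (simp add: gmap_def)
    then have "\<sigma> m n \<in> v8_piece (d - dg n)" using n by (rule free_pieceD)
    then show "dual n as m = 0"
      using a c0_deg[of a e] by (cases "augmentation a") (auto simp: dual_def v8_piece_def)
  next
    fix as m a b and i :: nat assume "(as, m) \<in> bar_dom 0 M" "i \<le> 0" "a \<in> A1" "b \<in> A1"
    then show "dual n (as[i := a + b]) m = dual n (as[i := a]) m + dual n (as[i := b]) m"
      using *[of as m] by (auto simp: dual_def ** A1.add distrib_right)
  next
    fix as m m' assume "(as, m) \<in> bar_dom 0 M" "m' \<in> total M"
    then show "dual n as (m + m') = dual n as m + dual n as m'"
      using *[of as m] by (auto simp: dual_def ** sigma_add M.total_add distrib_left)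
  next
    fix as m a assume "(as, m) \<in> bar_dom 0 M" "a \<in> A1"
    then show "dual n (as[0 := a * as ! 0]) m = augmentation a * dual n as m"
      using *[of as m] by (auto simp: dual_def ** A1.mult mult.assoc)
  qed (simp add: dual_def)
  show "coboundary 0 M (dual n) = (\<lambda>_ _. 0)"
  proof (intro ext)
    fix as m
    show "coboundary 0 M (dual n) as m = 0"
    proof (cases "(as, m) \<in> bar_dom (Suc 0) M")
      case True
      then obtain a b bs where as': "as = a # b # bs" and ab: "a \<in> A1" "b \<in> A1" and "(1 # bs, m) \<in> bar_dom 0 M"
        by (rule bar_domE_Cons2)
      then have as: "as = [a, b]" and m: "m \<in> total M" by (auto simp: bar_dom_iff)
      have "\<pi> (act F b (\<sigma> m)) = act M b m" by (simp add: pi_act ab m sigma_total pi_sigma)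
      then have "c0 (\<sigma> (act M b m) n) = c0 (act F b (\<sigma> m) n)"
        using c0_sigma_pi[of "act F b (\<sigma> m)" n] by (simp add: F.act_total ab m sigma_total)
      then show ?thesis using True ab m
        by (simp add: coboundary_eq as dual_def bar_dom_iff M.act_total A1.mult act_free c0_st_act mult.assoc)
    qed (rule coboundary_outside)
  qed
qed

lemma dual_unit_vec: "n \<in> G \<Longrightarrow> dual n [1] (\<pi> (unit_vec n)) = 1"
  by (simp add: dual_def bar_dom_0 pi_unit_vec_total c0_sigma_pi unit_vec_total) (simp add: unit_vec_def)

lemma ext_one_dim_base:
  assumes n: "n \<in> G" and uniq: "\<And>m. m \<in> G \<Longrightarrow> dg m = dg n \<Longrightarrow> m = n"
  shows "ext_one_dim 0 (dg n) M"
  unfolding ext_one_dim_def cobo_0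
proof (intro bexI[of _ "dual n"] conjI ballI)
  show "dual n \<notin> {\<lambda>_ _. 0}" using dual_unit_vec[OF n] by auto
  fix g assume g: "g \<in> cocy 0 (dg n) M"
  show "g \<in> {\<lambda>_ _. 0} \<or> (\<lambda>as m. g as m + dual n as m) \<in> {\<lambda>_ _. 0}"
  proof (cases "g [1] (\<pi> (unit_vec n)) = 0")
    case True
    then have "g = (\<lambda>_ _. 0)" using cocycle0_eq_zero[OF g] uniq by blast
    then show ?thesis by blast
  next
    case False
    then have "g [1] (\<pi> (unit_vec n)) + dual n [1] (\<pi> (unit_vec n)) = 0" by (simp add: dual_unit_vec n)
    then have "(\<lambda>as m. g as m + dual n as m) = (\<lambda>_ _. 0)"
      using cocycle0_eq_zero[OF cocy_add[OF g dual_cocy[OF n]]] uniq by blast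
    then show ?thesis by blast
  qed
qed (rule dual_cocy[OF n])

text \<open>If \<open>w\<close> bounds the product of h_0 with \<open>f\<close>, evaluate
  \<open>w [1]\<close> on \<open>\<pi> r = 0\<close>. Each \<open>r m\<close> has augmentation 0, so
  its term is \<open>c1 (r m)\<close> times the value of \<open>f\<close> on generator
  \<open>m\<close>; for degree reasons only \<open>m = n\<close> contributes, and \<open>f\<close>
  vanishes there.\<close>

lemma ext_h0_inj_base:
  assumes n: "n \<in> G" and uniq: "\<And>m. m \<in> G \<Longrightarrow> dg m = dg n \<Longrightarrow> m = n"
    and r: "r \<in> total F" "\<pi> r = 0" "c1 (r n) = 1"
  shows "ext_h0_inj 0 (dg n) M"
  unfolding ext_h0_inj_def
proof (intro ballI impI notI)
  fix f assume f: "f \<in> cocy 0 (dg n) M" and "f \<notin> cobo 0 (dg n) M"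
  then have f0: "f \<noteq> (\<lambda>_ _. 0)" by (simp add: cobo_0)
  assume "h0m 0 M f \<in> cobo (Suc 0) (dg n + 1) M"
  then obtain w where w: "w \<in> coch 0 (dg n + 1) M" "h0m 0 M f = coboundary 0 M w" by (auto simp: cobo_Suc)
  have "w [1] (act M (v8_elt (r m)) (\<pi> (unit_vec m))) = c1 (r m) * f [1] (\<pi> (unit_vec m))" if m: "m \<in> G" for m
  proof -
    have d: "([v8_elt (r m)], \<pi> (unit_vec m)) \<in> bar_dom 0 M" "([1, v8_elt (r m)], \<pi> (unit_vec m)) \<in> bar_dom (Suc 0) M"
      using m by (auto simp: bar_dom_iff A1.one v8_elt_in_A1 pi_unit_vec_total)
    have "h0m 0 M f [1, v8_elt (r m)] (\<pi> (unit_vec m)) =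
        w [v8_elt (r m)] (\<pi> (unit_vec m)) + w [1] (act M (v8_elt (r m)) (\<pi> (unit_vec m)))"
      using d by (simp add: w(2) coboundary_eq)
    moreover have "w [v8_elt (r m)] (\<pi> (unit_vec m)) = 0"
      using cochain_head[OF w(1) d(1)] minimal[OF r(1,2), of m]
      by (simp add: augmentation_A1_coords v8_elt_in_A1)
    moreover have "h0m 0 M f [1, v8_elt (r m)] (\<pi> (unit_vec m)) = c1 (r m) * f [1] (\<pi> (unit_vec m))"
      using M.h0m_Cons[of 1 "v8_elt (r m)" "[]" _ 0 f] bar_dom_0[OF pi_unit_vec_total[OF m]]
      by (simp add: A1.one v8_elt_in_A1)
    ultimately show ?thesis by simp
  qed
  then have "(\<Sum>m\<in>G. c1 (r m) * f [1] (\<pi> (unit_vec m))) = (\<Sum>m\<in>G. w [1] (act M (v8_elt (r m)) (\<pi> (unit_vec m))))"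
    by simp
  also have "\<dots> = w [1] (\<pi> r)"
    unfolding pi_expand[OF r(1)]
    by (simp add: cochain0_sum[OF w(1)] M.act_total v8_elt_in_A1 pi_unit_vec_total)
  also have "\<dots> = 0" using cochain_mod_zero[OF w(1)] by (simp add: r(2))
  also have "(\<Sum>m\<in>G. c1 (r m) * f [1] (\<pi> (unit_vec m))) = (\<Sum>m\<in>{n}. c1 (r m) * f [1] (\<pi> (unit_vec m)))"
    using n uniq cochain0_unit_vec[OF cocyclesD(1)[OF f]]
    by (intro sum.mono_neutral_right fin) auto
  finally have "f [1] (\<pi> (unit_vec n)) = 0" using r(3) by simp
  then have "f = (\<lambda>_ _. 0)" using cocycle0_eq_zero[OF f] uniq by blast
  with f0 show False ..
qed

end

text \<open>The maps \<open>h\<close> are additive only. By \<open>exact_0\<close> and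
  \<open>exact\<close> they lift kernel elements, so \<open>h q\<close> is the section of the cover
  \<open>d q\<close> of the next syzygy.\<close>

locale resolution = cover M "G 0" "dg 0" \<epsilon> \<sigma>
  for M :: "'m::ab_group_add gmod" and G :: "nat \<Rightarrow> int set" and dg :: "nat \<Rightarrow> int \<Rightarrow> int"
    and \<epsilon> :: "(int \<Rightarrow> v8) \<Rightarrow> 'm" and \<sigma> :: "'m \<Rightarrow> int \<Rightarrow> v8"
    and d h :: "nat \<Rightarrow> (int \<Rightarrow> v8) \<Rightarrow> int \<Rightarrow> v8" +
  assumes fin_G: "\<And>q. finite (G q)"
    and d_map: "\<And>q. gmap (free_mod (G (Suc q)) (dg (Suc q))) (free_mod (G q) (dg q)) (d q)"
    and d_act: "\<And>q a x n. a \<in> A1 \<Longrightarrow> d q (\<lambda>n. st_act a (x n)) n = st_act a (d q x n)"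
    and h_map: "\<And>q. gmap (free_mod (G q) (dg q)) (free_mod (G (Suc q)) (dg (Suc q))) (h q)"
    and eps_d: "\<And>x. x \<in> total (free_mod (G 1) (dg 1)) \<Longrightarrow> \<epsilon> (d 0 x) = 0"
    and d_d: "\<And>q x. x \<in> total (free_mod (G (Suc (Suc q))) (dg (Suc (Suc q)))) \<Longrightarrow> d q (d (Suc q) x) = 0"
    and exact_0: "\<And>x. x \<in> total (free_mod (G 0) (dg 0)) \<Longrightarrow> \<epsilon> x = 0 \<Longrightarrow> d 0 (h 0 x) = x"
    and exact: "\<And>q x. x \<in> total (free_mod (G (Suc q)) (dg (Suc q))) \<Longrightarrow> d q x = 0 \<Longrightarrow> d (Suc q) (h (Suc q) x) = x"
    and d_min: "\<And>q x n. c0 (d q x n) = 0"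
begin

text \<open>Numbering starts at the first syzygy, because \<open>M\<close> itself lives in another
  type.\<close>

fun syz :: "nat \<Rightarrow> (int \<Rightarrow> v8) gmod" where
  "syz 0 = cover.K (G 0) (dg 0) \<epsilon>"
| "syz (Suc q) = cover.K (G (Suc q)) (dg (Suc q)) (d q)"

text \<open>Describing the syzygy by \<open>d q (h q x) = x\<close> gives the section property at
  once. Minimality holds since cycles are boundaries and differentials have no unit entries.\<close>

lemma cover_syz_step:
  assumes "gmodule (syz q)"
    and tot: "total (syz q) = {x \<in> total (free_mod (G q) (dg q)). d q (h q x) = x}"
    and ker: "\<And>x. x \<in> total (free_mod (G (Suc q)) (dg (Suc q))) \<Longrightarrow> d q x \<in> total (syz q)"
    and piece: "\<And>x n. x \<in> piece (syz q) n \<longleftrightarrow> x \<in> piece (free_mod (G q) (dg q)) n \<and> x \<in> total (syz q)"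
    and act: "act (syz q) = act (free_mod (G q) (dg q))"
  shows "cover (syz q) (G (Suc q)) (dg (Suc q)) (d q) (h q)"
proof (rule cover.intro)
  show "gmap (free_mod (G (Suc q)) (dg (Suc q))) (syz q) (d q)"
    using d_map[of q] ker gmodule.piece_subset_total[OF gmodule_free] by (auto simp: gmap_def piece)
  show "gmap (syz q) (free_mod (G (Suc q)) (dg (Suc q))) (h q)"
    using h_map[of q] by (auto simp: gmap_def piece tot)
  show "d q (act (free_mod (G (Suc q)) (dg (Suc q))) a x) = act (syz q) a (d q x)" if "a \<in> A1" for a x
    using d_act[OF that] by (auto simp: act act_free)
  have e: "h q 0 = 0"
    using h_map[of q] gmodule.zero_in_total[OF gmodule_free] unfolding gmap_def by (metis add_cancel_right_left)
  show "c0 (x n) = 0" if "x \<in> total (free_mod (G (Suc q)) (dg (Suc q)))" "d q x = 0" for x n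
    using exact[OF that] d_min[of "Suc q" "h (Suc q) x" n] by simp
qed (use assms fin_G in auto)

lemma cover_syz: "cover (syz q) (G (Suc q)) (dg (Suc q)) (d q) (h q)"
proof (induction q)
  case 0
  have d0: "d 0 x \<in> total (free_mod (G 0) (dg 0))" if "x \<in> total (free_mod (G 1) (dg 1))" for x
    using gmap_total[OF gmodule_free gmodule_free d_map[of 0]] that by simp
  have h0: "h 0 x \<in> total (free_mod (G 1) (dg 1))" if "x \<in> total (free_mod (G 0) (dg 0))" for x
    using gmap_total[OF gmodule_free gmodule_free h_map[of 0]] that by simp
  show ?case
  proof (rule cover_syz_step)
    show "total (syz 0) = {x \<in> total (free_mod (G 0) (dg 0)). d 0 (h 0 x) = x}"
      using exact_0 eps_d[OF h0] by (force simp: total_K)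
    show "d 0 x \<in> total (syz 0)" if "x \<in> total (free_mod (G (Suc 0)) (dg (Suc 0)))" for x
      using that d0 eps_d by (simp add: total_K)
    show "x \<in> piece (syz 0) n \<longleftrightarrow> x \<in> piece (free_mod (G 0) (dg 0)) n \<and> x \<in> total (syz 0)" for x n
      using F.piece_subset_total by (auto simp: total_K) (auto simp: K_def)
  qed (simp_all add: gmodule_K, simp add: K_def)
next
  case (Suc q)
  interpret C: cover "syz q" "G (Suc q)" "dg (Suc q)" "d q" "h q" by (rule Suc)
  let ?F1 = "free_mod (G (Suc q)) (dg (Suc q))" and ?F2 = "free_mod (G (Suc (Suc q))) (dg (Suc (Suc q)))"
  have d1: "d (Suc q) x \<in> total ?F1" if "x \<in> total ?F2" for x
    using gmap_total[OF gmodule_free gmodule_free d_map[of "Suc q"]] that by simp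
  have h1: "h (Suc q) x \<in> total ?F2" if "x \<in> total ?F1" for x
    using gmap_total[OF gmodule_free gmodule_free h_map[of "Suc q"]] that by simp
  show ?case
  proof (rule cover_syz_step)
    show "total (syz (Suc q)) = {x \<in> total ?F1. d (Suc q) (h (Suc q) x) = x}"
      using exact d_d[OF h1] by (force simp: C.total_K)
    show "d (Suc q) x \<in> total (syz (Suc q))" if "x \<in> total ?F2" for x
      using that d1 d_d by (simp add: C.total_K)
    show "x \<in> piece (syz (Suc q)) n \<longleftrightarrow> x \<in> piece ?F1 n \<and> x \<in> total (syz (Suc q))" for x n
      using C.F.piece_subset_total by (auto simp: C.total_K) (auto simp: C.K_def)
  qed (simp_all add: C.gmodule_K, simp add: C.K_def)
qed

text \<open>Iterated dimension shifting, with \<open>P\<close> one of the three predicates: each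
  step trades one syzygy for one cohomological degree.\<close>

lemma unique_transfer:
  assumes "\<And>q s t. P s t (syz (Suc q)) \<Longrightarrow> P (Suc s) t (syz q)"
    and "P 0 t (syz (s + q))"
  shows "P s t (syz q)"
  using assms(2)
proof (induction s arbitrary: q)
  case (Suc s)
  then have "P s t (syz (Suc q))" by (simp del: syz.simps)
  then show ?case by (rule assms(1))
qed simp

lemma ext_trivial_syz: "ext_trivial s t (syz (Suc q)) \<Longrightarrow> ext_trivial (Suc s) t (syz q)"
  using cover.ext_trivial_shift[OF cover_syz] by (simp only: syz.simps(2))

lemma ext_one_dim_syz: "ext_one_dim s t (syz (Suc q)) \<Longrightarrow> ext_one_dim (Suc s) t (syz q)"
  using cover.ext_one_dim_shift[OF cover_syz] by (simp only: syz.simps(2))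

lemma ext_h0_inj_syz: "ext_h0_inj s t (syz (Suc q)) \<Longrightarrow> ext_h0_inj (Suc s) t (syz q)"
  using cover.ext_h0_inj_shift[OF cover_syz] by (simp only: syz.simps(2))

theorem ext_trivial_resolution:
  assumes "\<And>n. n \<in> G s \<Longrightarrow> dg s n \<noteq> t"
  shows "ext_trivial s t M"
proof (cases s)
  case 0
  then show ?thesis using ext_trivial_base assms by simp
next
  case (Suc r)
  have "ext_trivial 0 t (syz r)"
    using cover.ext_trivial_base[OF cover_syz] assms Suc by blast
  then have "ext_trivial r t (syz 0)"
    by - (rule unique_transfer[where P = ext_trivial], erule ext_trivial_syz, simp add: Suc del: syz.simps)
  then show ?thesis using ext_trivial_shift by (simp add: Suc)
qed

theorem ext_one_dim_resolution:
  assumes "n \<in> G s" "\<And>m. m \<in> G s \<Longrightarrow> dg s m = dg s n \<Longrightarrow> m = n"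
  shows "ext_one_dim s (dg s n) M"
proof (cases s)
  case 0
  then show ?thesis using ext_one_dim_base assms by simp
next
  case (Suc r)
  have "ext_one_dim 0 (dg s n) (syz r)"
    using cover.ext_one_dim_base[OF cover_syz] assms Suc by blast
  then have "ext_one_dim r (dg s n) (syz 0)"
    by - (rule unique_transfer[where P = ext_one_dim], erule ext_one_dim_syz, simp add: Suc del: syz.simps)
  then show ?thesis using ext_one_dim_shift by (simp add: Suc)
qed

text \<open>The relation fed to \<open>ext_h0_inj_base\<close> is the differential of generator
  \<open>m\<close>, whose coefficient at \<open>n\<close> contains Sq1.\<close>

theorem ext_h0_inj_resolution:
  assumes "n \<in> G s" "\<And>m. m \<in> G s \<Longrightarrow> dg s m = dg s n \<Longrightarrow> m = n"
    and m: "m \<in> G (Suc s)" "c1 (d s (unit_vec m) n) = 1"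
  shows "ext_h0_inj s (dg s n) M"
proof -
  have r: "d s (unit_vec m) \<in> total (free_mod (G s) (dg s))"
    by (rule gmap_total[OF gmodule_free gmodule_free d_map unit_vec_total[OF m(1)]])
  show ?thesis
  proof (cases s)
    case 0
    show ?thesis unfolding 0
      by (rule ext_h0_inj_base[of _ "d 0 (unit_vec m)"])
        (use assms r eps_d[OF unit_vec_total] 0 in auto)
  next
    case (Suc q)
    have "ext_h0_inj 0 (dg (Suc q) n) (syz q)"
      by (rule cover.ext_h0_inj_base[OF cover_syz, of _ _ "d (Suc q) (unit_vec m)"])
        (use assms r d_d[OF unit_vec_total] Suc in auto)
    then have "ext_h0_inj q (dg s n) (syz 0)"
      by - (rule unique_transfer[where P = ext_h0_inj], erule ext_h0_inj_syz, simp add: Suc del: syz.simps)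
    then show ?thesis using ext_h0_inj_shift by (simp add: Suc)
  qed
qed

end

section \<open>The groups \<open>Ext\<close> and the product with \<open>h\<^sub>0\<close>\<close>

context gmodule
begin

lemma comm_group_cocycle_group: "comm_group (cocycle_group s t M Z2_mod)"
proof (rule comm_groupI)
  show "\<exists>y\<in>carrier (cocycle_group s t M Z2_mod). y \<otimes>\<^bsub>cocycle_group s t M Z2_mod\<^esub> x = \<one>\<^bsub>cocycle_group s t M Z2_mod\<^esub>"
    if "x \<in> carrier (cocycle_group s t M Z2_mod)" for x
    using that by (intro bexI[of _ x]) (simp_all add: cocycle_group_def)
qed (auto simp: cocycle_group_def cocy_add ac_simps cobo_cocy[OF zero_in_cobo])

lemma subgroup_cobo: "subgroup (cobo s t M) (cocycle_group s t M Z2_mod)"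
proof -
  interpret Z: comm_group "cocycle_group s t M Z2_mod" by (rule comm_group_cocycle_group)
  have inv: "inv\<^bsub>cocycle_group s t M Z2_mod\<^esub> x = x" if "x \<in> cobo s t M" for x
    by (rule Z.inv_equality) (use cobo_cocy[OF that] in \<open>simp_all add: cocycle_group_def\<close>)
  show ?thesis
  proof (rule Z.subgroupI)
    show "cobo s t M \<noteq> {}" using zero_in_cobo by blast
  qed (use inv cobo_cocy cobo_add in \<open>auto simp: cocycle_group_def\<close>)
qed

lemma normal_cobo: "cobo s t M \<lhd> cocycle_group s t M Z2_mod"
  by (rule comm_group.subgroup_imp_normal[OF comm_group_cocycle_group subgroup_cobo])

lemma group_Ext: "group (Ext s t M Z2_mod)"
  unfolding Ext_def by (rule normal.factorgroup_is_group[OF normal_cobo])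

lemma carrier_Ext: "carrier (Ext s t M Z2_mod) =
    (\<lambda>f. cobo s t M #>\<^bsub>cocycle_group s t M Z2_mod\<^esub> f) ` cocy s t M"
  by (auto simp: Ext_def FactGroup_def RCOSETS_def cocycle_group_def)

lemma one_Ext: "\<one>\<^bsub>Ext s t M Z2_mod\<^esub> = cobo s t M"
  by (simp add: Ext_def FactGroup_def)

lemma coset_eq: "cobo s t M #>\<^bsub>cocycle_group s t M Z2_mod\<^esub> f = {(\<lambda>as m. g as m + f as m) |g. g \<in> cobo s t M}"
  by (auto simp: r_coset_def cocycle_group_def)

lemma coset_mem: "g \<in> cobo s t M #>\<^bsub>cocycle_group s t M Z2_mod\<^esub> f \<longleftrightarrow> (\<lambda>as m. g as m + f as m) \<in> cobo s t M"
proof -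
  have "g = (\<lambda>as m. (g as m + f as m) + f as m)" by (simp add: add.assoc)
  then have "(\<lambda>as m. g as m + f as m) \<in> cobo s t M \<Longrightarrow> \<exists>h. g = (\<lambda>as m. h as m + f as m) \<and> h \<in> cobo s t M"
    by (intro exI[of _ "\<lambda>as m. g as m + f as m"]) simp
  then show ?thesis unfolding coset_eq by (auto simp: add.assoc)
qed

lemma coset_eq_one: "cobo s t M #>\<^bsub>cocycle_group s t M Z2_mod\<^esub> f = cobo s t M \<longleftrightarrow> f \<in> cobo s t M"
proof
  assume "cobo s t M #>\<^bsub>cocycle_group s t M Z2_mod\<^esub> f = cobo s t M"
  moreover have "f \<in> cobo s t M #>\<^bsub>cocycle_group s t M Z2_mod\<^esub> f" by (simp add: coset_mem zero_in_cobo)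
  ultimately show "f \<in> cobo s t M" by simp
next
  assume f: "f \<in> cobo s t M"
  show "cobo s t M #>\<^bsub>cocycle_group s t M Z2_mod\<^esub> f = cobo s t M"
  proof (rule Set.set_eqI)
    fix g
    show "g \<in> cobo s t M #>\<^bsub>cocycle_group s t M Z2_mod\<^esub> f \<longleftrightarrow> g \<in> cobo s t M"
      unfolding coset_mem
      using cobo_add[OF _ f, of g] cobo_add[OF _ f, of "\<lambda>as m. g as m + f as m"] by (auto simp: add.assoc)
  qed
qed

lemma coset_cong:
  assumes "(\<lambda>as m. f as m + g as m) \<in> cobo s t M"
  shows "cobo s t M #>\<^bsub>cocycle_group s t M Z2_mod\<^esub> f = cobo s t M #>\<^bsub>cocycle_group s t M Z2_mod\<^esub> g"
proof -
  have "(\<lambda>as m. h as m + g as m) \<in> cobo s t M \<longleftrightarrow> (\<lambda>as m. h as m + f as m) \<in> cobo s t M" for h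
  proof
    assume "(\<lambda>as m. h as m + g as m) \<in> cobo s t M"
    from cobo_add[OF this assms] show "(\<lambda>as m. h as m + f as m) \<in> cobo s t M" by (simp add: ac_simps)
  next
    assume "(\<lambda>as m. h as m + f as m) \<in> cobo s t M"
    from cobo_add[OF this assms] show "(\<lambda>as m. h as m + g as m) \<in> cobo s t M" by (simp add: ac_simps)
  qed
  then show ?thesis by (auto simp: coset_mem)
qed

lemma trivial_group_Ext:
  assumes "ext_trivial s t M" shows "trivial_group (Ext s t M Z2_mod)"
proof -
  have "carrier (Ext s t M Z2_mod) = {\<one>\<^bsub>Ext s t M Z2_mod\<^esub>}"
  proof -
    have "carrier (Ext s t M Z2_mod) = (\<lambda>f. cobo s t M) ` cocy s t M"
      unfolding carrier_Ext using assms coset_eq_one by (intro image_cong refl) (auto simp: ext_trivial_def)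
    moreover have "cocy s t M \<noteq> {}" using cobo_cocy[OF zero_in_cobo] by blast
    ultimately show ?thesis by (auto simp: one_Ext)
  qed
  then show ?thesis by (simp add: trivial_group_def group_Ext)
qed

text \<open>With a single nonzero class, the indicator of not being a coboundary is additive modulo
  2. It is onto Z/2, and its kernel consists of the coboundaries.\<close>

lemma Ext_iso_Z2:
  assumes "ext_one_dim s t M" shows "Ext s t M Z2_mod \<cong> integer_mod_group 2"
proof -
  let ?Z = "cocycle_group s t M Z2_mod"
  from assms obtain f where f: "f \<in> cocy s t M" "f \<notin> cobo s t M"
    and sp: "\<And>g. g \<in> cocy s t M \<Longrightarrow> g \<in> cobo s t M \<or> (\<lambda>as m. g as m + f as m) \<in> cobo s t M"
    by (auto simp: ext_one_dim_def)
  define \<phi> where "\<phi> g = (if g \<in> cobo s t M then 0 else 1 :: int)" for g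
  have add: "(\<lambda>as m. g as m + h as m) \<in> cobo s t M \<longleftrightarrow> (g \<in> cobo s t M \<longleftrightarrow> h \<in> cobo s t M)"
    if gh: "g \<in> cocy s t M" "h \<in> cocy s t M" for g h
  proof (cases "g \<in> cobo s t M")
    case True
    then show ?thesis using cobo_add[OF True, of h] cobo_add[OF True, of "\<lambda>as m. g as m + h as m"] by auto
  next
    case False
    then have gf: "(\<lambda>as m. g as m + f as m) \<in> cobo s t M" using sp[OF gh(1)] by blast
    show ?thesis
    proof (cases "h \<in> cobo s t M")
      case True
      from cobo_add[OF _ True, of "\<lambda>as m. g as m + h as m"] True False show ?thesis
        by (auto simp: add.assoc)
    next
      case False
      then have "(\<lambda>as m. h as m + f as m) \<in> cobo s t M" using sp[OF gh(2)] by blast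
      from cobo_add[OF gf this] have "(\<lambda>as m. g as m + h as m) \<in> cobo s t M" by (simp add: ac_simps)
      then show ?thesis using False \<open>g \<notin> cobo s t M\<close> by simp
    qed
  qed
  have hom: "\<phi> \<in> hom ?Z (integer_mod_group 2)"
    by (rule homI) (auto simp: \<phi>_def cocycle_group_def add carrier_integer_mod_group mult_integer_mod_group)
  have "group_hom ?Z (integer_mod_group 2) \<phi>"
    using comm_group_cocycle_group hom by (simp add: group_hom_def group_hom_axioms_def comm_group_def)
  moreover have "\<phi> ` carrier ?Z = carrier (integer_mod_group 2)"
  proof -
    have "carrier (integer_mod_group 2) = {0, 1}" by (auto simp: carrier_integer_mod_group)
    moreover have "0 \<in> \<phi> ` cocy s t M" using cobo_cocy[OF zero_in_cobo] zero_in_cobo by (force simp: \<phi>_def)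
    moreover have "1 \<in> \<phi> ` cocy s t M" using f by (force simp: \<phi>_def)
    ultimately show ?thesis by (auto simp: cocycle_group_def \<phi>_def)
  qed
  moreover have "kernel ?Z (integer_mod_group 2) \<phi> = cobo s t M"
    using cobo_cocy by (auto simp: kernel_def \<phi>_def cocycle_group_def one_integer_mod_group split: if_splits)
  ultimately show ?thesis unfolding Ext_def using group_hom.FactGroup_iso by metis
qed

end

section \<open>The class h_0 and the product with it\<close>

lemma gmodule_Z2: "gmodule Z2_mod"
  unfolding gmodule_def graded_A1_module_def
proof (intro conjI allI ballI impI; (elim conjE)?)
  fix I x n assume I: "finite I" "\<forall>n\<in>I. x n \<in> piece Z2_mod n" "(\<Sum>n\<in>I. x n) = 0" "n \<in> I"
  show "x n = 0"
  proof (cases "n = 0")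
    case True
    show ?thesis by (rule bit_sum_single[of I n x]) (use I True in \<open>auto simp: Z2_mod_def split: if_splits\<close>)
  qed (use I in \<open>auto simp: Z2_mod_def split: if_splits\<close>)
next
  fix p n a x assume "a \<in> A1 \<inter> steenrod_deg p" "x \<in> piece Z2_mod n"
  then show "act Z2_mod a x \<in> piece Z2_mod (n + int p)"
    using c0_deg[of a p] by (cases "augmentation a") (auto simp: Z2_mod_def split: if_splits)
qed (auto simp: Z2_mod_def distrib_left distrib_right mult.assoc split: if_splits)

text \<open>For degree reasons the cocycle vanishes on every monomial other than Sq1, and additivity
  in the slot determines the rest.\<close>

lemma h0_class_eval:
  assumes h: "h \<in> h0_class" and a: "a \<in> A1"
  shows "h [1, a] b = c1 (A1_coords a) * b"
proof -
  have hc: "h \<in> coch 1 1 Z2_mod" and h1: "h [1, Sq 1] 1 = 1"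
    using h by (auto simp: h0_class_def cocycles_def)
  have dom: "([1, a], b) \<in> bar_dom 1 Z2_mod" if "a \<in> A1" for a b
    using that by (simp add: bar_dom_iff A1.one)
  have add: "h [1, a + b] 1 = h [1, a] 1 + h [1, b] 1" if "a \<in> A1" "b \<in> A1" for a b
    using cochain_slot[OF hc dom[OF that(1), of 1], of 1 a b] that by simp
  have deg: "h [1, a] 1 = 0" if "a \<in> A1" "a \<in> steenrod_deg d" "d \<noteq> 1" for a d
    using cochain_deg[OF hc dom[OF that(1)], of "[0, d]" 1 0] that
    by (simp add: one_in_steenrod_deg Z2_mod_def)
  have bsc: "h [1, bscale c a] 1 = c * h [1, a] 1" if "a \<in> A1" for a c
    using deg[OF A1.zero zero_in_steenrod_deg, of 0] by (cases c) simp_all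
  have mono: "Sq 1 * Sq 2 \<in> A1" "Sq 2 * Sq 1 \<in> A1" "Sq 1 * Sq 2 * Sq 1 \<in> A1" "Sq 2 * Sq 1 * Sq 2 \<in> A1"
     "Sq 1 * Sq 2 * Sq 1 * Sq 2 \<in> A1"
    by (intro A1.intros)+
  have bA: "bscale c a \<in> A1" if "a \<in> A1" for a c using that by (cases c) (simp_all add: A1.zero)
  define v where "v = A1_coords a"
  have "h [1, v8_elt v] 1 = c1 v"
    unfolding v8_elt_def
    by (simp add: add bsc A1.add bA mono A1.one A1.Sq1 A1.Sq2 h1 deg[OF _ one_in_steenrod_deg]
       deg[OF _ Sq_in_steenrod_deg, of 2] deg[OF _ steenrod_deg_Sqs(1)] deg[OF _ steenrod_deg_Sqs(2)]
       deg[OF _ steenrod_deg_Sqs(3)] deg[OF _ steenrod_deg_Sqs(4)] deg[OF _ steenrod_deg_Sqs(5)] del: One_nat_def)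
  then have "h [1, a] 1 = c1 (A1_coords a)" by (simp add: v_def v8_elt_A1_coords a)
  moreover have "h [1, a] 0 = 0" by (rule cochain_mod_zero[OF hc]) simp
  ultimately show ?thesis by (cases b) simp_all
qed

text \<open>Otherwise the union in \<open>yoneda\<close> would be empty. The witness is
  \<open>h0m\<close> applied to the augmentation cocycle of bidegree 0, 0.\<close>

lemma h0_class_nonempty: "h0_class \<noteq> {}"
proof -
  define f where "f = (\<lambda>as (m::bit). if (as, m) \<in> bar_dom 0 Z2_mod then augmentation (hd as) * m else 0)"
  have **: "([a], m) \<in> bar_dom 0 Z2_mod \<longleftrightarrow> a \<in> A1" for a m
    by (simp add: bar_dom_iff)
  have *: "(as, m) \<in> bar_dom 0 Z2_mod \<Longrightarrow> \<exists>a. as = [a] \<and> a \<in> A1" for as m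
    by (cases as) (auto simp: bar_dom_iff)
  have "f \<in> coch 0 0 Z2_mod"
  proof (rule cochainI)
    fix as m ds d
    assume "(as, m) \<in> bar_dom 0 Z2_mod" "list_all2 (\<lambda>d a. a \<in> steenrod_deg d) ds as" "m \<in> piece Z2_mod d"
      "d + int (sum_list ds) \<noteq> 0"
    then show "f as m = 0"
      using *[of as m] c0_deg[of "hd as" "hd ds"]
      by (cases "augmentation (hd as)") (auto simp: f_def list_all2_Cons2 Z2_mod_def split: if_splits)
  next
    fix as m a b and i :: nat assume "(as, m) \<in> bar_dom 0 Z2_mod" "i \<le> 0" "a \<in> A1" "b \<in> A1"
    then show "f (as[i := a + b]) m = f (as[i := a]) m + f (as[i := b]) m"
      using *[of as m] by (auto simp: f_def ** A1.add distrib_right)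
  next
    fix as m m' assume "(as, m) \<in> bar_dom 0 Z2_mod" "m' \<in> total Z2_mod"
    then show "f as (m + m') = f as m + f as m'"
      using *[of as m] by (auto simp: f_def ** distrib_left)
  next
    fix as m a assume "(as, m) \<in> bar_dom 0 Z2_mod" "a \<in> A1"
    then show "f (as[0 := a * as ! 0]) m = augmentation a * f as m"
      using *[of as m] by (auto simp: f_def ** A1.mult mult.assoc)
  qed (simp add: f_def)
  moreover have "coboundary 0 Z2_mod f = (\<lambda>_ _. 0)"
  proof (intro ext)
    fix as m
    show "coboundary 0 Z2_mod f as m = 0"
    proof (cases "(as, m) \<in> bar_dom (Suc 0) Z2_mod")
      case True
      then obtain a b bs where "as = a # b # bs" "a \<in> A1" "b \<in> A1" "(1 # bs, m) \<in> bar_dom 0 Z2_mod"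
        by (rule bar_domE_Cons2)
      then have "as = [a, b]" "a \<in> A1" "b \<in> A1" by (auto simp: bar_dom_iff)
      then show ?thesis using True by (simp add: coboundary_eq f_def ** A1.mult act_Z2 mult.assoc)
    qed (rule coboundary_outside)
  qed
  ultimately have "h0m 0 Z2_mod f \<in> cocy 1 1 Z2_mod"
    using gmodule.h0m_cocy[OF gmodule_Z2, of f 0 0] by (simp add: cocyclesI)
  moreover have "h0m 0 Z2_mod f [1, Sq 1] 1 = 1"
    using gmodule.h0m_Cons[OF gmodule_Z2, of 1 "Sq 1" "[]" 1 0 f]
    by (simp add: f_def ** A1.one A1.Sq1[simplified])
  ultimately show ?thesis by (auto simp: h0_class_def)
qed

context gmodule
begin

lemma yoneda_h0:
  assumes h: "h \<in> h0_class"
  shows "yoneda_cochain 1 s M h f = h0m s M f"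
proof (intro ext)
  fix as m
  show "yoneda_cochain 1 s M h f as m = h0m s M f as m"
  proof (cases "(as, m) \<in> bar_dom (Suc s) M")
    case True
    then obtain a b bs where as: "as = a # b # bs" "a \<in> A1" "b \<in> A1" and bs: "(1 # bs, m) \<in> bar_dom s M"
      by (rule bar_domE_Cons2)
    have hc: "h \<in> coch 1 1 Z2_mod" using h by (auto simp: h0_class_def cocycles_def)
    have "h [a, b] c = augmentation a * c1 (A1_coords b) * c" for c
      using cochain_head[OF hc, of a "[b]" c] h0_class_eval[OF h as(3)] as by (simp add: bar_dom_iff mult.assoc)
    then show ?thesis using True as bs by (simp add: yoneda_cochain_def h0m_Cons numeral_2_eq_2)
  qed (simp add: yoneda_cochain_def h0m_def)
qed

text \<open>All cosets in the union defining the product coincide, since \<open>h0m\<close>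
  preserves coboundaries.\<close>

lemma h0_mult_coset:
  assumes f: "f \<in> cocy s t M"
  shows "h0_mult s t M (cobo s t M #>\<^bsub>cocycle_group s t M Z2_mod\<^esub> f) =
    cobo (Suc s) (t + 1) M #>\<^bsub>cocycle_group (Suc s) (t + 1) M Z2_mod\<^esub> h0m s M f"
proof -
  let ?Y = "cobo s t M #>\<^bsub>cocycle_group s t M Z2_mod\<^esub> f"
  have *: "cobo (Suc s) (t + 1) M #>\<^bsub>cocycle_group (Suc s) (t + 1) M Z2_mod\<^esub> h0m s M g =
    cobo (Suc s) (t + 1) M #>\<^bsub>cocycle_group (Suc s) (t + 1) M Z2_mod\<^esub> h0m s M f" if "g \<in> ?Y" for g
    using h0m_cobo[of "\<lambda>as m. g as m + f as m" s t] that by (intro coset_cong) (simp add: coset_mem h0m_add)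
  have "f \<in> ?Y" by (simp add: coset_mem zero_in_cobo)
  moreover define R where "R = cobo (Suc s) (t + 1) M #>\<^bsub>cocycle_group (Suc s) (t + 1) M Z2_mod\<^esub> h0m s M f"
  ultimately have "(\<Union>h\<in>h0_class. \<Union>g\<in>?Y. R) = R" using h0_class_nonempty by blast
  moreover have "(\<Union>h\<in>h0_class. \<Union>g\<in>?Y. cobo (Suc s) (t + 1) M
      #>\<^bsub>cocycle_group (Suc s) (t + 1) M Z2_mod\<^esub> yoneda_cochain 1 s M h g) = (\<Union>h\<in>h0_class. \<Union>g\<in>?Y. R)"
    unfolding R_def by (intro SUP_cong refl) (simp only: yoneda_h0 *)
  ultimately show ?thesis by (simp add: h0_mult_def yoneda_def add.commute R_def)
qed

lemma h0_mult_nonzero: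
  assumes "ext_h0_inj s t M" "x \<in> carrier (Ext s t M Z2_mod)" "x \<noteq> \<one>\<^bsub>Ext s t M Z2_mod\<^esub>"
  shows "h0_mult s t M x \<in> carrier (Ext (Suc s) (t + 1) M Z2_mod) - {\<one>\<^bsub>Ext (Suc s) (t + 1) M Z2_mod\<^esub>}"
proof -
  obtain f where f: "f \<in> cocy s t M" "x = cobo s t M #>\<^bsub>cocycle_group s t M Z2_mod\<^esub> f"
    using assms(2) by (auto simp: carrier_Ext)
  with assms(3) have "f \<notin> cobo s t M" by (auto simp: one_Ext coset_eq_one)
  with f(1) assms(1) have "h0m s M f \<notin> cobo (Suc s) (t + 1) M" by (simp add: ext_h0_inj_def)
  then show ?thesis using f h0m_cocy[OF f(1)]
    by (simp add: h0_mult_coset carrier_Ext one_Ext coset_eq_one)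
qed

lemma stem_zeroI: "(\<And>s. ext_trivial s (int s + int n) M) \<Longrightarrow> stem_zero M n"
  by (simp add: stem_zero_def trivial_group_Ext)

lemma stem_cyclicI:
  assumes "\<And>s. f \<le> s \<Longrightarrow> s < f + d \<Longrightarrow> ext_one_dim s (int s + int n) M"
    and "\<And>s. \<not> (f \<le> s \<and> s < f + d) \<Longrightarrow> ext_trivial s (int s + int n) M"
    and "\<And>s. f \<le> s \<Longrightarrow> Suc s < f + d \<Longrightarrow> ext_h0_inj s (int s + int n) M"
  shows "stem_cyclic M n d f"
proof -
  have eq: "int (Suc s) + int n = (int s + int n) + 1" for s by simp
  show ?thesis
    unfolding stem_cyclic_def eq
  proof (intro conjI allI impI ballI)
    fix s
    show "if f \<le> s \<and> s < f + d then Ext s (int s + int n) M Z2_mod \<cong> integer_mod_group 2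
      else trivial_group (Ext s (int s + int n) M Z2_mod)"
      using Ext_iso_Z2[OF assms(1)] trivial_group_Ext[OF assms(2)] by (cases "f \<le> s \<and> s < f + d") simp_all
  next
    fix s x
    assume "f \<le> s \<and> Suc s < f + d" "x \<in> carrier (Ext s (int s + int n) M Z2_mod)"
      "x \<noteq> \<one>\<^bsub>Ext s (int s + int n) M Z2_mod\<^esub>"
    then show "h0_mult s (int s + int n) M x \<in> carrier (Ext (Suc s) (int s + int n + 1) M Z2_mod)
        - {\<one>\<^bsub>Ext (Suc s) (int s + int n + 1) M Z2_mod\<^esub>}"
      using h0_mult_nonzero[OF assms(3)] by blast
  qed
qed

end

section \<open>A periodic complex of free modules\<close>

text \<open>Right multiplications by Sq1, Sq2, Sq1 Sq2, Sq2 Sq1 and Sq2 Sq1 Sq2. They commute with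
  the left action, so matrices of them are maps of free left modules.\<close>

definition rmul1 :: "v8 \<Rightarrow> v8" where "rmul1 v = V8 0 (c0 v) 0 0 (c2 v) (c3 v) 0 (c6 v)"
definition rmul2 :: "v8 \<Rightarrow> v8" where "rmul2 v = V8 0 0 (c0 v) (c1 v) 0 (c2 v) (c4 v) (c5 v)"
definition rmul12 :: "v8 \<Rightarrow> v8" where "rmul12 v = V8 0 0 0 (c0 v) 0 0 (c2 v) (c3 v)"
definition rmul21 :: "v8 \<Rightarrow> v8" where "rmul21 v = V8 0 0 0 0 (c0 v) (c1 v) 0 (c4 v)"
definition rmul212 :: "v8 \<Rightarrow> v8" where "rmul212 v = V8 0 0 0 0 0 0 (c0 v) (c1 v)"

lemmas rmul_defs = rmul1_def rmul2_def rmul12_def rmul21_def rmul212_def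

text \<open>
  \<open>gen k s n\<close>: the complex has a generator in homological degree \<open>s\<close> and stem \<open>n\<close>. The part \<open>s \<ge> 4\<close>
  resolves the desuspension of \<open>M\<^sub>k\<close> after lowering \<open>s\<close> by \<open>4\<close> and \<open>n\<close> by \<open>8\<close>.
\<close>

definition gen :: "int \<Rightarrow> int \<Rightarrow> int \<Rightarrow> bool" where
  "gen k s n = (let i = n div 8; m = n mod 8 in
     if m = 1 then s = 4 * i
     else if m = 2 then s = 4 * i + 1
     else if m = 3 then 4 * i + 5 \<le> s + k \<and> s \<le> 4 * i + 2
     else if m = 4 then s + k = 4 * i + 6
     else if m = 5 then s + k = 4 * i + 7
     else if m = 7 then 4 * i + 8 \<le> s + k \<and> s \<le> 4 * i + 3
     else False)"

text \<open>The homological degree drops by one, so an entry from stem \<open>n + e\<close> to stem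
  \<open>n\<close> has degree \<open>e + 1\<close>. The only nonzero choice is Sq1 for
  \<open>e = 0\<close>, Sq2 for \<open>e = 1\<close> and Sq2 Sq1 Sq2 for \<open>e = 4\<close>; for
  \<open>e = 2\<close> both Sq1 Sq2 and Sq2 Sq1 occur. Absent source generators contribute 0 because
  \<open>x\<close> vanishes there.\<close>

definition dmap :: "int \<Rightarrow> int \<Rightarrow> (int \<Rightarrow> v8) \<Rightarrow> int \<Rightarrow> v8" where
  "dmap k s x n = (if gen k s n then
     (let m = n mod 8 in
      if m = 1 then rmul2 (x (n + 1)) + rmul21 (x (n + 2))
      else if m = 2 then rmul2 (x (n + 1))
      else if m = 3 then rmul1 (x n) + rmul212 (x (n + 4)) + rmul2 (x (n + 1)) + rmul12 (x (n + 2))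
      else if m = 4 then rmul2 (x (n + 1))
      else if m = 5 then rmul12 (x (n + 2)) + rmul212 (x (n + 4))
      else rmul1 (x n) + rmul212 (x (n + 4)) + rmul21 (x (n + 2))) else 0)"

text \<open>In \<open>dmap k s\<close> and \<open>hmap k s\<close>, the degree \<open>s\<close> is that of the target.\<close>

definition hmap :: "int \<Rightarrow> int \<Rightarrow> (int \<Rightarrow> v8) \<Rightarrow> int \<Rightarrow> v8" where
  "hmap k s x n = (if gen k s n then
     (let m = n mod 8; i = n div 8; y = x (n - 1); z = x (n - 2); w = x (n - 4) in
      if m = 1 then V8 (c4 z + c6 w) (c5 z + c7 w) 0 0 (c7 z) 0 0 0
      else if m = 2 then V8 (c2 y) (c3 y) (c5 y) 0 (c6 y) (c7 y) 0 0
      else if m = 3 then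
        V8 (c1 (x n) + (if s + k = 4 * i + 5 then c6 w else 0) + (if k = 4 then c4 z else 0))
          (c3 y) (c4 (x n)) (c5 (x n)) (c6 y) (c7 y) (c7 (x n)) 0
      else if m = 4 then V8 (c2 y) (c3 y) 0 0 (c6 y) 0 0 0
      else if m = 5 then V8 (c2 y) (c3 y) (c5 y) (if k = 4 then c7 z else 0) (c6 y) (c7 y) 0 0
      else V8 (c1 (x n) + c3 z) (if s = 4 * i + 3 then c7 w else 0) (c4 (x n) + c6 z) (c5 (x n) + c7 z)
          0 0 (c7 (x n)) 0) else 0)"

lemma stem_cases:
  obtains i :: int where "n = 8 * i" | i where "n = 8 * i + 1" | i where "n = 8 * i + 2" | i where "n = 8 * i + 3"
  | i where "n = 8 * i + 4" | i where "n = 8 * i + 5" | i where "n = 8 * i + 6" | i where "n = 8 * i + 7"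
proof -
  have n: "n = 8 * (n div 8) + n mod 8" by simp
  have "n mod 8 \<in> {0,1,2,3,4,5,6,7}" using pos_mod_bound[of 8 n] pos_mod_sign[of 8 n] by force
  then show thesis using n that by (elim insertE emptyE) (metis add.right_neutral)+
qed

lemma mod8 [simp]:
  "(8 * i + 1) mod 8 = (1::int)" "(8 * i + 2) mod 8 = (2::int)" "(8 * i + 3) mod 8 = (3::int)"
  "(8 * i + 4) mod 8 = (4::int)" "(8 * i + 5) mod 8 = (5::int)" "(8 * i + 6) mod 8 = (6::int)"
  "(8 * i + 7) mod 8 = (7::int)" "(8 * i + 8) mod 8 = (0::int)" "(8 * i + 9) mod 8 = (1::int)"
  "(8 * i + 10) mod 8 = (2::int)" "(8 * i + 11) mod 8 = (3::int)" "(8 * i + 12) mod 8 = (4::int)"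
  "(8 * i + 13) mod 8 = (5::int)" "(8 * i + 15) mod 8 = (7::int)"
  "(8 * i - 1) mod 8 = (7::int)" "(8 * i - 2) mod 8 = (6::int)" "(8 * i - 3) mod 8 = (5::int)"
  and div8 [simp]:
  "(8 * i + 1) div 8 = (i::int)" "(8 * i + 2) div 8 = (i::int)" "(8 * i + 3) div 8 = (i::int)"
  "(8 * i + 4) div 8 = (i::int)" "(8 * i + 5) div 8 = (i::int)" "(8 * i + 7) div 8 = (i::int)"
  "(8 * i + 9) div 8 = (i + 1::int)" "(8 * i + 10) div 8 = (i + 1::int)" "(8 * i + 11) div 8 = (i + 1::int)"
  "(8 * i + 12) div 8 = (i + 1::int)" "(8 * i + 13) div 8 = (i + 1::int)" "(8 * i + 15) div 8 = (i + 1::int)"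
  "(8 * i - 1) div 8 = (i - 1::int)" "(8 * i - 3) div 8 = (i - 1::int)"
proof -
  have m: "(8 * i + c) mod 8 = c mod 8" and d: "(8 * i + c) div 8 = i + c div 8" for c :: int by simp_all
  show "(8 * i + 1) mod 8 = (1::int)" using m[of "1"] by simp
  show "(8 * i + 2) mod 8 = (2::int)" using m[of "2"] by simp
  show "(8 * i + 3) mod 8 = (3::int)" using m[of "3"] by simp
  show "(8 * i + 4) mod 8 = (4::int)" using m[of "4"] by simp
  show "(8 * i + 5) mod 8 = (5::int)" using m[of "5"] by simp
  show "(8 * i + 6) mod 8 = (6::int)" using m[of "6"] by simp
  show "(8 * i + 7) mod 8 = (7::int)" using m[of "7"] by simp
  show "(8 * i + 8) mod 8 = (0::int)" using m[of "8"] by simp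
  show "(8 * i + 9) mod 8 = (1::int)" using m[of "9"] by simp
  show "(8 * i + 10) mod 8 = (2::int)" using m[of "10"] by simp
  show "(8 * i + 11) mod 8 = (3::int)" using m[of "11"] by simp
  show "(8 * i + 12) mod 8 = (4::int)" using m[of "12"] by simp
  show "(8 * i + 13) mod 8 = (5::int)" using m[of "13"] by simp
  show "(8 * i + 15) mod 8 = (7::int)" using m[of "15"] by simp
  show "(8 * i - 1) mod 8 = (7::int)" using m[of "-1"] by simp
  show "(8 * i - 2) mod 8 = (6::int)" using m[of "-2"] by simp
  show "(8 * i - 3) mod 8 = (5::int)" using m[of "-3"] by simp
  show "(8 * i + 1) div 8 = (i::int)" using d[of "1"] by simp
  show "(8 * i + 2) div 8 = (i::int)" using d[of "2"] by simp
  show "(8 * i + 3) div 8 = (i::int)" using d[of "3"] by simp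
  show "(8 * i + 4) div 8 = (i::int)" using d[of "4"] by simp
  show "(8 * i + 5) div 8 = (i::int)" using d[of "5"] by simp
  show "(8 * i + 7) div 8 = (i::int)" using d[of "7"] by simp
  show "(8 * i + 9) div 8 = (i + 1::int)" using d[of "9"] by simp
  show "(8 * i + 10) div 8 = (i + 1::int)" using d[of "10"] by simp
  show "(8 * i + 11) div 8 = (i + 1::int)" using d[of "11"] by simp
  show "(8 * i + 12) div 8 = (i + 1::int)" using d[of "12"] by simp
  show "(8 * i + 13) div 8 = (i + 1::int)" using d[of "13"] by simp
  show "(8 * i + 15) div 8 = (i + 1::int)" using d[of "15"] by simp
  show "(8 * i - 1) div 8 = (i - 1::int)" using d[of "-1"] by simp
  show "(8 * i - 3) div 8 = (i - 1::int)" using d[of "-3"] by simp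
qed

lemma gen_simps [simp]:
  "\<not> gen k s (8 * i)" "\<not> gen k s (8 * i + 6)" "\<not> gen k s (8 * i + 8)" "\<not> gen k s (8 * i - 2)" 
  "gen k s (8 * i + 1) \<longleftrightarrow> s = 4 * i" "gen k s (8 * i + 9) \<longleftrightarrow> s = 4 * i + 4"
  "gen k s (8 * i + 2) \<longleftrightarrow> s = 4 * i + 1" "gen k s (8 * i + 10) \<longleftrightarrow> s = 4 * i + 5"
  "gen k s (8 * i + 3) \<longleftrightarrow> 4 * i + 5 \<le> s + k \<and> s \<le> 4 * i + 2"
  "gen k s (8 * i + 11) \<longleftrightarrow> 4 * i + 9 \<le> s + k \<and> s \<le> 4 * i + 6"
  "gen k s (8 * i + 4) \<longleftrightarrow> s + k = 4 * i + 6"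
  "gen k s (8 * i + 12) \<longleftrightarrow> s + k = 4 * i + 10"
  "gen k s (8 * i + 5) \<longleftrightarrow> s + k = 4 * i + 7"
  "gen k s (8 * i - 3) \<longleftrightarrow> s + k = 4 * i + 3"
  "gen k s (8 * i + 13) \<longleftrightarrow> s + k = 4 * i + 11"
  "gen k s (8 * i + 7) \<longleftrightarrow> 4 * i + 8 \<le> s + k \<and> s \<le> 4 * i + 3"
  "gen k s (8 * i - 1) \<longleftrightarrow> 4 * i + 4 \<le> s + k \<and> s \<le> 4 * i - 1"
  "gen k s (8 * i + 15) \<longleftrightarrow> 4 * i + 12 \<le> s + k \<and> s \<le> 4 * i + 7"
  by (auto simp: gen_def Let_def)

lemma rmul_sel [simp]:
  "c0 (rmul1 v) = 0" "c1 (rmul1 v) = c0 v" "c2 (rmul1 v) = 0" "c3 (rmul1 v) = 0"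
  "c4 (rmul1 v) = c2 v" "c5 (rmul1 v) = c3 v" "c6 (rmul1 v) = 0" "c7 (rmul1 v) = c6 v"
  "c0 (rmul2 v) = 0" "c1 (rmul2 v) = 0" "c2 (rmul2 v) = c0 v" "c3 (rmul2 v) = c1 v"
  "c4 (rmul2 v) = 0" "c5 (rmul2 v) = c2 v" "c6 (rmul2 v) = c4 v" "c7 (rmul2 v) = c5 v"
  "c0 (rmul12 v) = 0" "c1 (rmul12 v) = 0" "c2 (rmul12 v) = 0" "c3 (rmul12 v) = c0 v"
  "c4 (rmul12 v) = 0" "c5 (rmul12 v) = 0" "c6 (rmul12 v) = c2 v" "c7 (rmul12 v) = c3 v"
  "c0 (rmul21 v) = 0" "c1 (rmul21 v) = 0" "c2 (rmul21 v) = 0" "c3 (rmul21 v) = 0"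
  "c4 (rmul21 v) = c0 v" "c5 (rmul21 v) = c1 v" "c6 (rmul21 v) = 0" "c7 (rmul21 v) = c4 v"
  "c0 (rmul212 v) = 0" "c1 (rmul212 v) = 0" "c2 (rmul212 v) = 0" "c3 (rmul212 v) = 0"
  "c4 (rmul212 v) = 0" "c5 (rmul212 v) = 0" "c6 (rmul212 v) = c0 v" "c7 (rmul212 v) = c1 v"
  by (simp_all add: rmul_defs)

lemma supp_simps:
  fixes x :: "int \<Rightarrow> v8"
  assumes "\<forall>n. \<not> gen k s n \<longrightarrow> x n = 0"
  shows "x (8 * i) = 0" "x (8 * i + 6) = 0" "x (8 * i + 8) = 0" "x (8 * i - 2) = 0"
    "s \<noteq> 4 * i \<Longrightarrow> x (8 * i + 1) = 0" "s \<noteq> 4 * i + 4 \<Longrightarrow> x (8 * i + 9) = 0"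
    "s \<noteq> 4 * i + 1 \<Longrightarrow> x (8 * i + 2) = 0" "s \<noteq> 4 * i + 5 \<Longrightarrow> x (8 * i + 10) = 0"
    "s + k < 4 * i + 5 \<Longrightarrow> x (8 * i + 3) = 0" "4 * i + 2 < s \<Longrightarrow> x (8 * i + 3) = 0"
    "s + k < 4 * i + 9 \<Longrightarrow> x (8 * i + 11) = 0" "4 * i + 6 < s \<Longrightarrow> x (8 * i + 11) = 0"
    "s + k \<noteq> 4 * i + 6 \<Longrightarrow> x (8 * i + 4) = 0"
    "s + k \<noteq> 4 * i + 10 \<Longrightarrow> x (8 * i + 12) = 0"
    "s + k \<noteq> 4 * i + 7 \<Longrightarrow> x (8 * i + 5) = 0"
    "s + k \<noteq> 4 * i + 11 \<Longrightarrow> x (8 * i + 13) = 0"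
    "s + k \<noteq> 4 * i + 3 \<Longrightarrow> x (8 * i - 3) = 0"
    "s + k < 4 * i + 8 \<Longrightarrow> x (8 * i + 7) = 0" "4 * i + 3 < s \<Longrightarrow> x (8 * i + 7) = 0"
    "s + k < 4 * i + 4 \<Longrightarrow> x (8 * i - 1) = 0" "4 * i - 1 < s \<Longrightarrow> x (8 * i - 1) = 0"
    "\<not> (4 * i + 5 \<le> s + k \<and> s \<le> 4 * i + 2) \<Longrightarrow> x (8 * i + 3) = 0"
    "\<not> (4 * i + 8 \<le> s + k \<and> s \<le> 4 * i + 3) \<Longrightarrow> x (8 * i + 7) = 0"
    "s + k < 4 * i + 12 \<Longrightarrow> x (8 * i + 15) = 0" "4 * i + 7 < s \<Longrightarrow> x (8 * i + 15) = 0"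
  by (rule assms[rule_format]; simp)+

lemma dmap_simps:
  "dmap k s x (8 * i + 1) = (if gen k s (8 * i + 1) then rmul2 (x (8 * i + 2)) + rmul21 (x (8 * i + 3)) else 0)"
  "dmap k s x (8 * i + 2) = (if gen k s (8 * i + 2) then rmul2 (x (8 * i + 3)) else 0)"
  "dmap k s x (8 * i + 3) = (if gen k s (8 * i + 3) then rmul1 (x (8 * i + 3)) + rmul212 (x (8 * i + 7)) + rmul2 (x (8 * i + 4)) + rmul12 (x (8 * i + 5)) else 0)"
  "dmap k s x (8 * i + 4) = (if gen k s (8 * i + 4) then rmul2 (x (8 * i + 5)) else 0)"
  "dmap k s x (8 * i + 5) = (if gen k s (8 * i + 5) then rmul12 (x (8 * i + 7)) + rmul212 (x (8 * i + 9)) else 0)"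
  "dmap k s x (8 * i + 7) = (if gen k s (8 * i + 7) then rmul1 (x (8 * i + 7)) + rmul212 (x (8 * i + 11)) + rmul21 (x (8 * i + 9)) else 0)"
  "dmap k s x (8 * i + 9) = (if gen k s (8 * i + 9) then rmul2 (x (8 * i + 10)) + rmul21 (x (8 * i + 11)) else 0)"
  "dmap k s x (8 * i + 11) = (if gen k s (8 * i + 11) then rmul1 (x (8 * i + 11)) + rmul212 (x (8 * i + 15)) + rmul2 (x (8 * i + 12)) + rmul12 (x (8 * i + 13)) else 0)"
  by (simp_all add: dmap_def Let_def algebra_simps)

lemma dmap_simps_neg:
  "dmap k s x (8 * i - 3) = (if gen k s (8 * i - 3) then rmul12 (x (8 * i - 1)) + rmul212 (x (8 * i + 1)) else 0)"
  "dmap k s x (8 * i - 1) = (if gen k s (8 * i - 1) then rmul1 (x (8 * i - 1)) + rmul212 (x (8 * i + 3)) + rmul21 (x (8 * i + 1)) else 0)"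
  by (simp_all add: dmap_def Let_def add.commute)

lemma hmap_simps:
  "hmap k s x (8 * i + 1) = (if gen k s (8 * i + 1) then V8 (c4 (x (8 * i - 1)) + c6 (x (8 * i - 3))) (c5 (x (8 * i - 1)) + c7 (x (8 * i - 3))) 0 0 (c7 (x (8 * i - 1))) 0 0 0 else 0)"
  "hmap k s x (8 * i + 2) = (if gen k s (8 * i + 2) then V8 (c2 (x (8 * i + 1))) (c3 (x (8 * i + 1))) (c5 (x (8 * i + 1))) 0 (c6 (x (8 * i + 1))) (c7 (x (8 * i + 1))) 0 0 else 0)"
  "hmap k s x (8 * i + 3) = (if gen k s (8 * i + 3) then V8 (c1 (x (8 * i + 3)) + (if s + k = 4 * i + 5 then c6 (x (8 * i - 1)) else 0) + (if k = 4 then c4 (x (8 * i + 1)) else 0)) (c3 (x (8 * i + 2))) (c4 (x (8 * i + 3))) (c5 (x (8 * i + 3))) (c6 (x (8 * i + 2))) (c7 (x (8 * i + 2))) (c7 (x (8 * i + 3))) 0 else 0)"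
  "hmap k s x (8 * i + 4) = (if gen k s (8 * i + 4) then V8 (c2 (x (8 * i + 3))) (c3 (x (8 * i + 3))) 0 0 (c6 (x (8 * i + 3))) 0 0 0 else 0)"
  "hmap k s x (8 * i + 5) = (if gen k s (8 * i + 5) then V8 (c2 (x (8 * i + 4))) (c3 (x (8 * i + 4))) (c5 (x (8 * i + 4))) (if k = 4 then c7 (x (8 * i + 3)) else 0) (c6 (x (8 * i + 4))) (c7 (x (8 * i + 4))) 0 0 else 0)"
  "hmap k s x (8 * i + 7) = (if gen k s (8 * i + 7) then V8 (c1 (x (8 * i + 7)) + c3 (x (8 * i + 5))) (if s = 4 * i + 3 then c7 (x (8 * i + 3)) else 0) (c4 (x (8 * i + 7)) + c6 (x (8 * i + 5))) (c5 (x (8 * i + 7)) + c7 (x (8 * i + 5))) 0 0 (c7 (x (8 * i + 7))) 0 else 0)"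
  "hmap k s x (8 * i + 9) = (if gen k s (8 * i + 9) then V8 (c4 (x (8 * i + 7)) + c6 (x (8 * i + 5))) (c5 (x (8 * i + 7)) + c7 (x (8 * i + 5))) 0 0 (c7 (x (8 * i + 7))) 0 0 0 else 0)"
  "hmap k s x (8 * i + 11) = (if gen k s (8 * i + 11) then V8 (c1 (x (8 * i + 11)) + (if s + k = 4 * i + 9 then c6 (x (8 * i + 7)) else 0) + (if k = 4 then c4 (x (8 * i + 9)) else 0)) (c3 (x (8 * i + 10))) (c4 (x (8 * i + 11))) (c5 (x (8 * i + 11))) (c6 (x (8 * i + 10))) (c7 (x (8 * i + 10))) (c7 (x (8 * i + 11))) 0 else 0)"
  by (simp_all add: hmap_def Let_def algebra_simps)

section \<open>The contracting homotopy\<close>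

context
  fixes k s :: int and x :: "int \<Rightarrow> v8"
  assumes k: "4 \<le> k" and supp: "\<forall>n. \<not> gen k s n \<longrightarrow> x n = 0"
begin

lemmas supp' = supp_simps[OF supp]

text \<open>The conditional terms of \<open>hmap\<close> come from the ends of the towers. At the
  bottom of stem 8i + 3 no Sq1 entry is available, and \<open>c6\<close> of stem 8i - 1 recovers the
  generator; at the top of stem 8i + 3 the coefficient \<open>c7\<close> is covered from stem 8i +
  7. For \<open>k = 4\<close> the stems 8i - 1 and 8i + 7 are empty, and the stems 8i + 1 and 8i + 5
  take over.\<close>

lemma homotopy_1: "dmap k s (hmap k (s + 1) x) (8 * i + 1) + hmap k s (dmap k (s - 1) x) (8 * i + 1) = x (8 * i + 1)"
  using k by (intro v8.expand conjI; simp add: dmap_simps dmap_simps_neg hmap_simps supp'; (intro conjI impI)?; simp add: supp')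

lemma homotopy_2: "dmap k s (hmap k (s + 1) x) (8 * i + 2) + hmap k s (dmap k (s - 1) x) (8 * i + 2) = x (8 * i + 2)"
  using k by (intro v8.expand conjI; simp add: dmap_simps dmap_simps_neg hmap_simps supp'; (intro conjI impI)?; simp add: supp')

lemma homotopy_3: "dmap k s (hmap k (s + 1) x) (8 * i + 3) + hmap k s (dmap k (s - 1) x) (8 * i + 3) = x (8 * i + 3)"
  using k by (intro v8.expand conjI; simp add: dmap_simps dmap_simps_neg hmap_simps supp'; (intro conjI impI)?; simp add: supp')

lemma homotopy_4: "dmap k s (hmap k (s + 1) x) (8 * i + 4) + hmap k s (dmap k (s - 1) x) (8 * i + 4) = x (8 * i + 4)"
  using k by (intro v8.expand conjI; simp add: dmap_simps dmap_simps_neg hmap_simps supp'; (intro conjI impI)?; simp add: supp')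

lemma homotopy_5: "dmap k s (hmap k (s + 1) x) (8 * i + 5) + hmap k s (dmap k (s - 1) x) (8 * i + 5) = x (8 * i + 5)"
  using k by (intro v8.expand conjI; simp add: dmap_simps dmap_simps_neg hmap_simps supp'; (intro conjI impI)?; simp add: supp')

lemma homotopy_7: "dmap k s (hmap k (s + 1) x) (8 * i + 7) + hmap k s (dmap k (s - 1) x) (8 * i + 7) = x (8 * i + 7)"
  using k by (intro v8.expand conjI; simp add: dmap_simps dmap_simps_neg hmap_simps supp'; (intro conjI impI)?; simp add: supp')

end

lemma homotopy:
  assumes "4 \<le> k" "\<forall>n. \<not> gen k s n \<longrightarrow> x n = 0"
  shows "dmap k s (hmap k (s + 1) x) + hmap k s (dmap k (s - 1) x) = x"
proof
  fix n
  show "(dmap k s (hmap k (s + 1) x) + hmap k s (dmap k (s - 1) x)) n = x n"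
    by (rule stem_cases[of n])
      (simp_all add: homotopy_1 homotopy_2 homotopy_3 homotopy_4 homotopy_5 homotopy_7 assms
        supp_simps[OF assms(2)], simp_all add: dmap_def hmap_def)
qed

text \<open>The composites vanish by Sq1 Sq1 = 0 and Sq2 Sq2 = Sq1 Sq2 Sq1. For example, the paths
  from stem 8i + 3 to stem 8i + 1 give Sq2 Sq2 and Sq1 Sq2 Sq1.\<close>

lemma dmap_dmap:
  assumes "\<forall>n. \<not> gen k (s + 2) n \<longrightarrow> x n = 0" "4 \<le> k"
  shows "dmap k s (dmap k (s + 1) x) n = 0"
proof (rule stem_cases[of n])
  fix i assume "n = 8 * i + 1"
  then show ?thesis using assms(2)
    by (simp only:) (intro v8.expand conjI; simp add: dmap_simps supp_simps[OF assms(1)])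
next
  fix i assume "n = 8 * i + 2"
  then show ?thesis using assms(2)
    by (simp only:) (intro v8.expand conjI; simp add: dmap_simps supp_simps[OF assms(1)])
next
  fix i assume "n = 8 * i + 3"
  then show ?thesis using assms(2)
    by (simp only:) (intro v8.expand conjI; simp add: dmap_simps supp_simps[OF assms(1)])
next
  fix i assume "n = 8 * i + 4"
  then show ?thesis using assms(2)
    by (simp only:) (intro v8.expand conjI; simp add: dmap_simps supp_simps[OF assms(1)])
next
  fix i assume "n = 8 * i + 5"
  then show ?thesis using assms(2)
    by (simp only:) (intro v8.expand conjI; simp add: dmap_simps supp_simps[OF assms(1)])
next
  fix i assume "n = 8 * i + 7"
  then show ?thesis using assms(2)
    by (simp only:) (intro v8.expand conjI; simp add: dmap_simps supp_simps[OF assms(1)])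
qed (simp_all add: dmap_def)

lemma dmap_outside: "\<not> gen k s n \<Longrightarrow> dmap k s x n = 0"
  and hmap_outside: "\<not> gen k s n \<Longrightarrow> hmap k s x n = 0"
  by (simp_all add: dmap_def hmap_def)

lemma c0_dmap: "c0 (dmap k s x n) = 0"
  by (simp add: dmap_def Let_def)

lemma rmul_add:
  "rmul1 (u + v) = rmul1 u + rmul1 v" "rmul2 (u + v) = rmul2 u + rmul2 v"
  "rmul12 (u + v) = rmul12 u + rmul12 v" "rmul21 (u + v) = rmul21 u + rmul21 v"
  "rmul212 (u + v) = rmul212 u + rmul212 v"
  by (simp_all add: rmul_defs plus_v8_def)

lemma dmap_add: "dmap k s (x + y) = dmap k s x + dmap k s y"
  by (rule ext) (simp add: dmap_def Let_def rmul_add ac_simps)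

lemma hmap_add: "hmap k s (x + y) = hmap k s x + hmap k s y"
  by (rule ext) (simp add: hmap_def Let_def plus_v8_def[of "V8 _ _ _ _ _ _ _ _"] ac_simps)

lemma st_act_rmul:
  assumes "a \<in> A1"
  shows "st_act a (rmul1 v) = rmul1 (st_act a v)" "st_act a (rmul2 v) = rmul2 (st_act a v)"
    "st_act a (rmul12 v) = rmul12 (st_act a v)" "st_act a (rmul21 v) = rmul21 (st_act a v)"
    "st_act a (rmul212 v) = rmul212 (st_act a v)"
proof -
  have *: "st_act a (R v) = R (st_act a v)"
    if "\<And>v. R (lmul1 v) = lmul1 (R v)" "\<And>v. R (lmul2 v) = lmul2 (R v)" "R 0 = 0" "\<And>u v. R (u + v) = R u + R v" for R
    using assms
  proof (induction a arbitrary: v rule: A1.induct)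
    case Sq1
    show ?case using st_act_Sq(1) that(1) by simp
  next
    case Sq2
    show ?case using st_act_Sq(2) that(2) by simp
  qed (simp_all add: that st_act_plus st_act_times)
  show "st_act a (rmul1 v) = rmul1 (st_act a v)"
    by (rule *[of rmul1]) (simp_all add: rmul_defs lmul1_def lmul2_def zero_v8_def plus_v8_def)
  show "st_act a (rmul2 v) = rmul2 (st_act a v)"
    by (rule *[of rmul2]) (simp_all add: rmul_defs lmul1_def lmul2_def zero_v8_def plus_v8_def)
  show "st_act a (rmul12 v) = rmul12 (st_act a v)"
    by (rule *[of rmul12]) (simp_all add: rmul_defs lmul1_def lmul2_def zero_v8_def plus_v8_def)
  show "st_act a (rmul21 v) = rmul21 (st_act a v)"
    by (rule *[of rmul21]) (simp_all add: rmul_defs lmul1_def lmul2_def zero_v8_def plus_v8_def)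
  show "st_act a (rmul212 v) = rmul212 (st_act a v)"
    by (rule *[of rmul212]) (simp_all add: rmul_defs lmul1_def lmul2_def zero_v8_def plus_v8_def)
qed

lemma dmap_st_act: "a \<in> A1 \<Longrightarrow> dmap k s (\<lambda>n. st_act a (x n)) n = st_act a (dmap k s x n)"
  by (simp add: dmap_def Let_def st_act_rmul st_act_add)

lemma rmul_piece:
  "v \<in> v8_piece d \<Longrightarrow> e = d + 1 \<Longrightarrow> rmul1 v \<in> v8_piece e" "v \<in> v8_piece d \<Longrightarrow> e = d + 2 \<Longrightarrow> rmul2 v \<in> v8_piece e"
  "v \<in> v8_piece d \<Longrightarrow> e = d + 3 \<Longrightarrow> rmul12 v \<in> v8_piece e" "v \<in> v8_piece d \<Longrightarrow> e = d + 3 \<Longrightarrow> rmul21 v \<in> v8_piece e"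
  "v \<in> v8_piece d \<Longrightarrow> e = d + 5 \<Longrightarrow> rmul212 v \<in> v8_piece e"
  by (auto simp: v8_piece_def)

lemma dmap_piece:
  assumes "\<And>m. x m \<in> v8_piece (d - 1 - m)"
  shows "dmap k s x n \<in> v8_piece (d - n)"
  unfolding dmap_def Let_def
  by (auto intro!: v8_piece_add rmul_piece[OF assms])

lemma hmap_piece:
  assumes "\<And>m. x m \<in> v8_piece (d + 1 - m)"
  shows "hmap k s x n \<in> v8_piece (d - n)"
proof -
  have "d + 1 - m \<noteq> 0 \<Longrightarrow> c0 (x m) = 0" "d + 1 - m \<noteq> 1 \<Longrightarrow> c1 (x m) = 0" "d + 1 - m \<noteq> 2 \<Longrightarrow> c2 (x m) = 0"
    "d + 1 - m \<noteq> 3 \<Longrightarrow> c3 (x m) = 0" "d + 1 - m \<noteq> 3 \<Longrightarrow> c4 (x m) = 0" "d + 1 - m \<noteq> 4 \<Longrightarrow> c5 (x m) = 0"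
    "d + 1 - m \<noteq> 5 \<Longrightarrow> c6 (x m) = 0" "d + 1 - m \<noteq> 6 \<Longrightarrow> c7 (x m) = 0" for m
    using assms[of m] by (auto simp: v8_piece_def)
  then show ?thesis by (simp add: hmap_def Let_def v8_piece_def)
qed

text \<open>Each condition keeps \<open>4 * i\<close> within a bounded distance of the range from
  \<open>s\<close> to \<open>s + k\<close>, so \<open>n\<close> is near the range from 2s to 2s +
  2k; the margin 20 is generous.\<close>

lemma finite_gen:
  assumes "0 \<le> k" shows "finite {n. gen k s n}"
proof (rule finite_subset)
  show "{n. gen k s n} \<subseteq> {2 * s - 20..2 * s + 2 * k + 20}"
  proof
    fix n assume "n \<in> {n. gen k s n}"
    then have "gen k s n" by simp
    then show "n \<in> {2 * s - 20..2 * s + 2 * k + 20}"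
      using assms by (cases rule: stem_cases[of n]) auto
  qed
qed simp

section \<open>The modules \<open>M\<^sub>k\<close>\<close>

context gmodule
begin

lemma piece_sum: "(\<And>i. i \<in> I \<Longrightarrow> f i \<in> piece M n) \<Longrightarrow> (\<Sum>i\<in>I. f i) \<in> piece M n"
  by (induction I rule: infinite_finite_induct) (auto intro: piece_add)

lemma total_suspension: "total (suspension n M) = total M"
proof (intro equalityI subsetI)
  fix x assume "x \<in> total (suspension n M)"
  then obtain I f where f: "\<forall>d\<in>I. f d \<in> piece M (d - n)" "x = (\<Sum>d\<in>I. f d)"
    by (auto simp: total_def suspension_def)
  then have "f d \<in> total M" if "d \<in> I" for d using that piece_subset_total[of "f d" "d - n"] by blast
  then show "x \<in> total M" unfolding f(2) by (rule total_sum)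
next
  fix x assume "x \<in> total M"
  then obtain I f where f: "finite I" "\<And>d. f d \<in> piece M d" "x = (\<Sum>d\<in>I. f d)"
    by (rule totalE) blast
  have "x = (\<Sum>d\<in>(\<lambda>d. d + n) ` I. f (d - n))"
    unfolding f(3) by (subst sum.reindex) (auto simp: inj_on_def)
  then show "x \<in> total (suspension n M)"
    unfolding total_def suspension_def using f(1,2)
    by (intro CollectI exI[of _ "(\<lambda>d. d + n) ` I"] exI[of _ "\<lambda>d. f (d - n)"]) auto
qed

lemma gmodule_suspension: "gmodule (suspension n M)"
  unfolding gmodule_def graded_A1_module_def total_suspension
proof (intro conjI allI ballI impI; (elim conjE)?)
  fix I x d
  assume I: "finite I" "\<forall>d\<in>I. x d \<in> piece (suspension n M) d" "(\<Sum>d\<in>I. x d) = 0" "d \<in> I"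
  have "(\<Sum>e\<in>(\<lambda>d. d - n) ` I. x (e + n)) = 0"
    using I(3) by (subst sum.reindex) (auto simp: inj_on_def)
  then have "x (d - n + n) = 0"
    by (intro piece_indep[of "(\<lambda>d. d - n) ` I" "\<lambda>e. x (e + n)"]) (use I in \<open>auto simp: suspension_def\<close>)
  then show "x d = 0" by simp
next
  fix p d a x assume "a \<in> A1 \<inter> steenrod_deg p" "x \<in> piece (suspension n M) d"
  then show "act (suspension n M) a x \<in> piece (suspension n M) (d + int p)"
    using act_piece[of a p x "d - n"] by (simp add: suspension_def algebra_simps)
qed (auto simp: suspension_def act_one act_mult act_plus act_add intro: piece_diff)

definition free_map :: "int set \<Rightarrow> (int \<Rightarrow> 'm) \<Rightarrow> (int \<Rightarrow> v8) \<Rightarrow> 'm" where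
  "free_map G u x = (\<Sum>n\<in>G. act M (v8_elt (x n)) (u n))"

lemma free_map_add:
  assumes "\<And>n. n \<in> G \<Longrightarrow> u n \<in> total M"
  shows "free_map G u (x + y) = free_map G u x + free_map G u y"
  using assms by (simp add: free_map_def v8_elt_add act_plus v8_elt_in_A1 sum.distrib)

lemma gmap_free_map:
  assumes u: "\<And>n. n \<in> G \<Longrightarrow> u n \<in> piece M (dg n)"
  shows "gmap (free_mod G dg) M (free_map G u)"
  unfolding gmap_def
proof (intro conjI ballI allI)
  show "free_map G u (x + y) = free_map G u x + free_map G u y" for x y
    using u by (intro free_map_add) (auto intro: piece_subset_total)
  fix d x assume x: "x \<in> piece (free_mod G dg) d"
  show "free_map G u x \<in> piece M d"
    unfolding free_map_def
  proof (rule piece_sum)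
    fix n assume n: "n \<in> G"
    have xn: "x n \<in> v8_piece (d - dg n)" using x n by (rule free_pieceD)
    show "act M (v8_elt (x n)) (u n) \<in> piece M d"
    proof (cases "d - dg n < 0")
      case True
      with xn have "x n = 0" by (cases "x n") (auto simp: v8_piece_def zero_v8_def)
      then show ?thesis using piece_subset_total[OF u[OF n]] by (simp add: act_zero)
    next
      case False
      then have eq: "int (nat (d - dg n)) = d - dg n" by simp
      then have "v8_elt (x n) \<in> steenrod_deg (nat (d - dg n))" using xn by (intro v8_elt_deg) simp
      from act_piece[OF v8_elt_in_A1 this u[OF n]] show ?thesis by (simp only: eq) simp
    qed
  qed
qed

lemma act_sum: "a \<in> A1 \<Longrightarrow> (\<And>i. i \<in> I \<Longrightarrow> f i \<in> total M) \<Longrightarrow> act M a (\<Sum>i\<in>I. f i) = (\<Sum>i\<in>I. act M a (f i))"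
  by (induction I rule: infinite_finite_induct) (simp_all add: act_zero_right act_add total_sum)

lemma free_map_act:
  assumes "\<And>n. n \<in> G \<Longrightarrow> u n \<in> total M" and a: "a \<in> A1"
  shows "free_map G u (act (free_mod G dg) a x) = act M a (free_map G u x)"
  using assms
  by (simp add: free_map_def act_sum act_total v8_elt_in_A1 act_free act_mult[symmetric] A1_mult_v8_elt)

text \<open>Reduces every action to Sq1 and Sq2, the only operations that the tables list.\<close>

lemma act_v8_elt:
  assumes m: "m \<in> total M"
  defines "q1 \<equiv> act M (Sq 1)" and "q2 \<equiv> act M (Sq 2)"
  shows "act M (v8_elt v) m = bscale (c0 v) m + bscale (c1 v) (q1 m) + bscale (c2 v) (q2 m) + bscale (c3 v) (q1 (q2 m))
    + bscale (c4 v) (q2 (q1 m)) + bscale (c5 v) (q1 (q2 (q1 m))) + bscale (c6 v) (q2 (q1 (q2 m)))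
    + bscale (c7 v) (q1 (q2 (q1 (q2 m))))"
proof -
  have b: "bscale c a \<in> A1" if "a \<in> A1" for a c using that by (cases c) (simp_all add: A1.zero)
  have s: "act M (bscale c a) m = bscale c (act M a m)" for c a using m by (cases c) (simp_all add: act_zero)
  show ?thesis
    unfolding v8_elt_def q1_def q2_def
    by (simp add: act_plus act_mult s m b A1.add A1.mult A1.one A1.Sq1 A1.Sq2 act_one act_total del: One_nat_def)
qed

end

section \<open>The tables of the four families of modules\<close>

lemma Mk_cases:
  fixes k :: nat
  assumes "4 \<le> k"
  obtains l where "k = 4 * l + 4" "(k - 4) div 4 = l" "(k - 4) mod 4 = 0" | l where "k = 4 * l + 5" "(k - 4) div 4 = l" "(k - 4) mod 4 = 1"
  | l where "k = 4 * l + 6" "(k - 4) div 4 = l" "(k - 4) mod 4 = 2" | l where "k = 4 * l + 7" "(k - 4) div 4 = l" "(k - 4) mod 4 = 3"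
proof -
  have "x < 4 \<Longrightarrow> x \<in> {0,1,2,3}" for x :: nat by auto
  then have "(k - 4) mod 4 \<in> {0,1,2,3}" by simp
  moreover have "k = 4 * ((k - 4) div 4) + (k - 4) mod 4 + 4" using assms by simp
  ultimately show thesis using that by (elim insertE emptyE) auto
qed

lemma finite_Mk_basis: "finite (Mk_basis k)"
  by (simp add: Mk_basis_def Let_def)

lemma Mk_Sq1_g:
  "Mk_Sq1 k `` {g_lab i} = (if odd i \<and> g_lab i \<in> Mk_basis k then {g_lab (i + 1)} else {})"
proof -
  have aux: "(A \<union> (if p then B else if q then C else {})) `` {x} = A `` {x}" if "B `` {x} = {}" "C `` {x} = {}"
    for A B C :: "(label \<times> label) set" and p q x
    using that by (simp add: Un_Image)
  have "Mk_Sq1 k `` {g_lab i} = {(g_lab i, g_lab (i + 1)) |i. odd i \<and> g_lab i \<in> Mk_basis k} `` {g_lab i}"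
    unfolding Mk_Sq1_def Let_def by (rule aux) auto
  then show ?thesis by auto
qed

lemma Image_g_lab:
  "{(g_lab i, g_lab (i + m)) |i. P i} `` {g_lab i} = (if P i then {g_lab (i + m)} else {})"
  by auto

lemma divmod4: "r < 4 \<Longrightarrow> (r + l * 4) div 4 = (l::nat)" "r < 4 \<Longrightarrow> (r + l * 4) mod 4 = (r::nat)"
  by simp_all

lemma Image_g_h:
  "{(h_lab a, b), (h_lab c, d), (g_lab j, y)} `` {g_lab i} = (if i = j then {y} else {})"
  "{(g_lab j, y), (h_lab a, b), (h_lab c, d), (h_lab u, v)} `` {g_lab i} = (if i = j then {y} else {})"
  by auto

lemma Image_g_lab_h: "{(g_lab i, g_lab (i + m)) |i. P i} `` {h_lab j} = {}"
  by auto

lemma Mk_Sq2_cases: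
  "k = 4 * l + 4 \<Longrightarrow> Mk_Sq2 k `` {g_lab i} = (if i mod 4 \<in> {2, 3} \<and> i + 2 \<le> 8 * l + 2 then {g_lab (i + 2)} else {})"
  "k = 4 * l + 5 \<Longrightarrow> Mk_Sq2 k `` {g_lab i} = (if i mod 4 \<in> {2, 3} \<and> i + 2 \<le> 8 * l + 4 then {g_lab (i + 2)} else {})"
  "k = 4 * l + 6 \<Longrightarrow> Mk_Sq2 k `` {g_lab i} = (if i mod 4 \<in> {2, 3} \<and> i \<le> 8 * l + 3 then {g_lab (i + 2)} else {})
     \<union> (if i = 8 * l + 6 then {h_lab (8 * l + 8)} else {})"
  "k = 4 * l + 7 \<Longrightarrow> Mk_Sq2 k `` {g_lab i} = (if i mod 4 \<in> {2, 3} \<and> i \<le> 8 * l + 3 then {g_lab (i + 2)} else {})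
     \<union> (if i = 8 * l + 6 then {g_lab (8 * l + 8)} else {})"
proof -
  assume k: "k = 4 * l + 4"
  then have "k - 4 = 0 + l * 4" by simp
  have eq: "(k - 4) div 4 = l" "(k - 4) mod 4 = 0" unfolding \<open>k - 4 = _\<close> by (rule divmod4, simp)+
  show "Mk_Sq2 k `` {g_lab i} = (if i mod 4 \<in> {2, 3} \<and> i + 2 \<le> 8 * l + 2 then {g_lab (i + 2)} else {})"
    unfolding Mk_Sq2_def Let_def eq by (simp only: Image_g_lab simp_thms if_True)
next
  assume k: "k = 4 * l + 5"
  then have "k - 4 = 1 + l * 4" by simp
  have eq: "(k - 4) div 4 = l" "(k - 4) mod 4 = 1" unfolding \<open>k - 4 = _\<close> by (rule divmod4, simp)+
  show "Mk_Sq2 k `` {g_lab i} = (if i mod 4 \<in> {2, 3} \<and> i + 2 \<le> 8 * l + 4 then {g_lab (i + 2)} else {})"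
    unfolding Mk_Sq2_def Let_def eq by (simp only: Image_g_lab simp_thms if_True if_False one_neq_zero)
next
  assume k: "k = 4 * l + 6"
  then have "k - 4 = 2 + l * 4" by simp
  have eq: "(k - 4) div 4 = l" "(k - 4) mod 4 = 2" unfolding \<open>k - 4 = _\<close> by (rule divmod4, simp)+
  have ne: "(2::nat) = 0 \<longleftrightarrow> False" "(2::nat) = 1 \<longleftrightarrow> False" by simp_all
  show "Mk_Sq2 k `` {g_lab i} = (if i mod 4 \<in> {2, 3} \<and> i \<le> 8 * l + 3 then {g_lab (i + 2)} else {})
     \<union> (if i = 8 * l + 6 then {h_lab (8 * l + 8)} else {})"
    unfolding Mk_Sq2_def Let_def eq
    by (simp only: Image_g_lab simp_thms if_True if_False Un_Image Image_g_h ne)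
next
  assume k: "k = 4 * l + 7"
  then have "k - 4 = 3 + l * 4" by simp
  have eq: "(k - 4) div 4 = l" "(k - 4) mod 4 = 3" unfolding \<open>k - 4 = _\<close> by (rule divmod4, simp)+
  have ne: "(3::nat) = 0 \<longleftrightarrow> False" "(3::nat) = 1 \<longleftrightarrow> False" "(3::nat) = 2 \<longleftrightarrow> False" by simp_all
  show "Mk_Sq2 k `` {g_lab i} = (if i mod 4 \<in> {2, 3} \<and> i \<le> 8 * l + 3 then {g_lab (i + 2)} else {})
     \<union> (if i = 8 * l + 6 then {g_lab (8 * l + 8)} else {})"
    unfolding Mk_Sq2_def Let_def eq
    by (simp only: Image_g_lab simp_thms if_True if_False Un_Image Image_g_h ne)
qed

lemma mod4_add: "(8 * j + c) mod 4 = (c mod 4 :: nat)"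
  using mod_mult_self1[of c "2 * j" 4] by (simp add: ac_simps)

lemma mod4 [simp]:
  "(8 * j + 3) mod 4 = (3::nat)" "(8 * j + 6) mod 4 = (2::nat)" "(8 * j + 7) mod 4 = (3::nat)"
  "(8 * j + 10) mod 4 = (2::nat)"
  by (simp_all add: mod4_add)

text \<open>Sorted by index modulo 8, the four tables agree except at their ends, which show up when
  \<open>k\<close> is compared with \<open>4 * j\<close>.\<close>

lemma Mk_Sq2_g:
  assumes "4 \<le> k"
  shows "4 * j + 6 \<le> k \<Longrightarrow> Mk_Sq2 k `` {g_lab (8 * j + 3)} = {g_lab (8 * j + 5)}"
    "4 * j + 6 \<le> k \<Longrightarrow> Mk_Sq2 k `` {g_lab (8 * j + 6)} = {if k = 4 * j + 6 then h_lab (8 * j + 8) else g_lab (8 * j + 8)}"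
    "4 * j + 8 \<le> k \<Longrightarrow> Mk_Sq2 k `` {g_lab (8 * j + 7)} = {g_lab (8 * j + 9)}"
    "4 * j + 8 \<le> k \<Longrightarrow> Mk_Sq2 k `` {g_lab (8 * j + 10)} = (if k = 4 * j + 8 then {} else {g_lab (8 * j + 12)})"
    "k = 4 * j + 5 \<Longrightarrow> Mk_Sq2 k `` {g_lab (8 * j + 3)} = {}"
    "Mk_Sq2 k `` {g_lab 1} = {}"
    "Mk_Sq2 k `` {g_lab 2} = (if k = 4 then {} else {g_lab 4})"
proof -
  show "4 * j + 6 \<le> k \<Longrightarrow> Mk_Sq2 k `` {g_lab (8 * j + 3)} = {g_lab (8 * j + 5)}"
    using assms by (rule Mk_cases) (simp_all add: Mk_Sq2_cases)
  show "4 * j + 6 \<le> k \<Longrightarrow> Mk_Sq2 k `` {g_lab (8 * j + 6)} = {if k = 4 * j + 6 then h_lab (8 * j + 8) else g_lab (8 * j + 8)}"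
    using assms by (rule Mk_cases) (simp_all add: Mk_Sq2_cases, presburger+)
  show "4 * j + 8 \<le> k \<Longrightarrow> Mk_Sq2 k `` {g_lab (8 * j + 7)} = {g_lab (8 * j + 9)}"
    using assms by (rule Mk_cases) (simp_all add: Mk_Sq2_cases, presburger+)
  show "4 * j + 8 \<le> k \<Longrightarrow> Mk_Sq2 k `` {g_lab (8 * j + 10)} = (if k = 4 * j + 8 then {} else {g_lab (8 * j + 12)})"
    using assms by (rule Mk_cases) (simp_all add: Mk_Sq2_cases, presburger+)
  show "k = 4 * j + 5 \<Longrightarrow> Mk_Sq2 k `` {g_lab (8 * j + 3)} = {}"
    by (simp add: Mk_Sq2_cases(2))
  show "Mk_Sq2 k `` {g_lab 1} = {}"
    using assms by (rule Mk_cases) (simp_all add: Mk_Sq2_cases)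
  show "Mk_Sq2 k `` {g_lab 2} = (if k = 4 then {} else {g_lab 4})"
    using assms by (rule Mk_cases) (simp_all add: Mk_Sq2_cases)
qed

lemma Mk_h_2:
  assumes "k = 4 * j + 6"
  shows "Mk_Sq1 k `` {h_lab (8 * j + 4)} = {h_lab (8 * j + 5)}" "Mk_Sq2 k `` {h_lab (8 * j + 4)} = {g_lab (8 * j + 6)}"
    "Mk_Sq2 k `` {h_lab (8 * j + 5)} = {h_lab (8 * j + 7)}"
proof -
  from assms have "k - 4 = 2 + j * 4" by simp
  have eq: "(k - 4) div 4 = j" "(k - 4) mod 4 = 2" unfolding \<open>k - 4 = _\<close> by (rule divmod4, simp)+
  have ne: "(2::nat) = 0 \<longleftrightarrow> False" "(2::nat) = 1 \<longleftrightarrow> False" by simp_all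
  show "Mk_Sq1 k `` {h_lab (8 * j + 4)} = {h_lab (8 * j + 5)}" "Mk_Sq2 k `` {h_lab (8 * j + 4)} = {g_lab (8 * j + 6)}"
    "Mk_Sq2 k `` {h_lab (8 * j + 5)} = {h_lab (8 * j + 7)}"
    unfolding Mk_Sq1_def Mk_Sq2_def Let_def eq
    by (simp_all only: Image_g_lab_h simp_thms if_True if_False Un_Image Un_empty_left ne) auto
qed

lemma Mk_h_3:
  assumes "k = 4 * j + 7"
  shows "Mk_Sq1 k `` {h_lab (8 * j + 5)} = {h_lab (8 * j + 6)}" "Mk_Sq1 k `` {h_lab (8 * j + 7)} = {g_lab (8 * j + 8)}"
    "Mk_Sq1 k `` {h_lab (8 * j + 8)} = {h_lab (8 * j + 9)}"
    "Mk_Sq2 k `` {h_lab (8 * j + 5)} = {h_lab (8 * j + 7)}" "Mk_Sq2 k `` {h_lab (8 * j + 6)} = {h_lab (8 * j + 8)}"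
proof -
  from assms have "k - 4 = 3 + j * 4" by simp
  have eq: "(k - 4) div 4 = j" "(k - 4) mod 4 = 3" unfolding \<open>k - 4 = _\<close> by (rule divmod4, simp)+
  have ne: "(3::nat) = 0 \<longleftrightarrow> False" "(3::nat) = 1 \<longleftrightarrow> False" "(3::nat) = 2 \<longleftrightarrow> False" by simp_all
  show "Mk_Sq1 k `` {h_lab (8 * j + 5)} = {h_lab (8 * j + 6)}" "Mk_Sq1 k `` {h_lab (8 * j + 7)} = {g_lab (8 * j + 8)}"
    "Mk_Sq1 k `` {h_lab (8 * j + 8)} = {h_lab (8 * j + 9)}"
    "Mk_Sq2 k `` {h_lab (8 * j + 5)} = {h_lab (8 * j + 7)}" "Mk_Sq2 k `` {h_lab (8 * j + 6)} = {h_lab (8 * j + 8)}"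
    unfolding Mk_Sq1_def Mk_Sq2_def Let_def eq
    by (simp_all only: Image_g_lab_h simp_thms if_True if_False Un_Image Un_empty_left ne) auto
qed

lemma Mk_basis_cases:
  "k = 4 * l + 4 \<Longrightarrow> Mk_basis k = g_lab ` {1..8 * l + 2}"
  "k = 4 * l + 5 \<Longrightarrow> Mk_basis k = g_lab ` {1..8 * l + 4}"
  "k = 4 * l + 6 \<Longrightarrow> Mk_basis k = g_lab ` {1..8 * l + 6} \<union> h_lab ` {8 * l + 4, 8 * l + 5, 8 * l + 7, 8 * l + 8}"
  "k = 4 * l + 7 \<Longrightarrow> Mk_basis k = g_lab ` ({1..8 * l + 6} \<union> {8 * l + 8}) \<union>
     h_lab ` {8 * l + 5, 8 * l + 6, 8 * l + 7, 8 * l + 8, 8 * l + 9}"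
proof -
  assume k: "k = 4 * l + 4"
  then have "k - 4 = 0 + l * 4" by simp
  have eq: "(k - 4) div 4 = l" "(k - 4) mod 4 = 0" unfolding \<open>k - 4 = _\<close> by (rule divmod4, simp)+
  show "Mk_basis k = g_lab ` {1..8 * l + 2}" unfolding Mk_basis_def Let_def eq by simp
next
  assume k: "k = 4 * l + 5"
  then have "k - 4 = 1 + l * 4" by simp
  have eq: "(k - 4) div 4 = l" "(k - 4) mod 4 = 1" unfolding \<open>k - 4 = _\<close> by (rule divmod4, simp)+
  show "Mk_basis k = g_lab ` {1..8 * l + 4}" unfolding Mk_basis_def Let_def eq by simp
next
  assume k: "k = 4 * l + 6"
  then have "k - 4 = 2 + l * 4" by simp
  have eq: "(k - 4) div 4 = l" "(k - 4) mod 4 = 2" unfolding \<open>k - 4 = _\<close> by (rule divmod4, simp)+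
  show "Mk_basis k = g_lab ` {1..8 * l + 6} \<union> h_lab ` {8 * l + 4, 8 * l + 5, 8 * l + 7, 8 * l + 8}"
    unfolding Mk_basis_def Let_def eq by simp
next
  assume k: "k = 4 * l + 7"
  then have "k - 4 = 3 + l * 4" by simp
  have eq: "(k - 4) div 4 = l" "(k - 4) mod 4 = 3" unfolding \<open>k - 4 = _\<close> by (rule divmod4, simp)+
  show "Mk_basis k = g_lab ` ({1..8 * l + 6} \<union> {8 * l + 8}) \<union>
     h_lab ` {8 * l + 5, 8 * l + 6, 8 * l + 7, 8 * l + 8, 8 * l + 9}"
    unfolding Mk_basis_def Let_def eq by simp
qed

lemma g_in_image: "g_lab i \<in> g_lab ` A \<longleftrightarrow> i \<in> A" "g_lab i \<notin> h_lab ` A" "h_lab i \<in> h_lab ` A \<longleftrightarrow> i \<in> A"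
  "h_lab i \<notin> g_lab ` A"
  by auto

text \<open>A single conjunction, so that the four forms of \<open>k\<close> and the positions of
  \<open>j\<close> relative to \<open>l\<close> are gone through once.\<close>

lemma g_in_Mk_basis_conj:
  assumes "4 \<le> k"
  shows "(g_lab 1 \<in> Mk_basis k) \<and>
    (g_lab 2 \<in> Mk_basis k) \<and>
    (g_lab 4 \<in> Mk_basis k \<longleftrightarrow> 5 \<le> k) \<and>
    (g_lab 0 \<notin> Mk_basis k) \<and>
    (g_lab (8 * j + 3) \<in> Mk_basis k \<longleftrightarrow> 4 * j + 5 \<le> k) \<and>
    (g_lab (8 * j + 5) \<in> Mk_basis k \<longleftrightarrow> 4 * j + 6 \<le> k) \<and>
    (g_lab (8 * j + 6) \<in> Mk_basis k \<longleftrightarrow> 4 * j + 6 \<le> k) \<and>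
    (g_lab (8 * j + 7) \<in> Mk_basis k \<longleftrightarrow> 4 * j + 8 \<le> k) \<and>
    (g_lab (8 * j + 8) \<in> Mk_basis k \<longleftrightarrow> 4 * j + 7 \<le> k) \<and>
    (g_lab (8 * j + 9) \<in> Mk_basis k \<longleftrightarrow> 4 * j + 8 \<le> k) \<and>
    (g_lab (8 * j + 10) \<in> Mk_basis k \<longleftrightarrow> 4 * j + 8 \<le> k) \<and>
    (g_lab (8 * j + 12) \<in> Mk_basis k \<longleftrightarrow> 4 * j + 9 \<le> k)"
proof (cases rule: Mk_cases[OF assms])
  case (1 l)
  consider "Suc j < l" | "Suc j = l" | "j = l" | "l < j" by linarith
  then show ?thesis
    by cases (simp_all add: Mk_basis_cases(1)[OF refl] g_in_image 1(1))
next
  case (2 l)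
  consider "Suc j < l" | "Suc j = l" | "j = l" | "l < j" by linarith
  then show ?thesis
    by cases (simp_all add: Mk_basis_cases(2)[OF refl] g_in_image 2(1))
next
  case (3 l)
  consider "Suc j < l" | "Suc j = l" | "j = l" | "l < j" by linarith
  then show ?thesis
    by cases (simp_all add: Mk_basis_cases(3)[OF refl] g_in_image 3(1))
next
  case (4 l)
  consider "Suc j < l" | "Suc j = l" | "j = l" | "l < j" by linarith
  then show ?thesis
    by cases (simp_all add: Mk_basis_cases(4)[OF refl] g_in_image 4(1))
qed

lemma g_in_Mk_basis:
  assumes "4 \<le> k"
  shows "g_lab 1 \<in> Mk_basis k" "g_lab 2 \<in> Mk_basis k" "g_lab 4 \<in> Mk_basis k \<longleftrightarrow> 5 \<le> k" "g_lab 0 \<notin> Mk_basis k"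
    "g_lab (8 * j + 3) \<in> Mk_basis k \<longleftrightarrow> 4 * j + 5 \<le> k" "g_lab (8 * j + 5) \<in> Mk_basis k \<longleftrightarrow> 4 * j + 6 \<le> k"
    "g_lab (8 * j + 6) \<in> Mk_basis k \<longleftrightarrow> 4 * j + 6 \<le> k" "g_lab (8 * j + 7) \<in> Mk_basis k \<longleftrightarrow> 4 * j + 8 \<le> k"
    "g_lab (8 * j + 8) \<in> Mk_basis k \<longleftrightarrow> 4 * j + 7 \<le> k" "g_lab (8 * j + 9) \<in> Mk_basis k \<longleftrightarrow> 4 * j + 8 \<le> k"
    "g_lab (8 * j + 10) \<in> Mk_basis k \<longleftrightarrow> 4 * j + 8 \<le> k" "g_lab (8 * j + 12) \<in> Mk_basis k \<longleftrightarrow> 4 * j + 9 \<le> k"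
  using g_in_Mk_basis_conj[OF assms, of j] by blast+

text \<open>Indices are grouped by the generator that produces them: 1, 2, 4 belong together, as do
  8j + 3, 5, 6, 8 and 8j + 7, 9, 10, 12. This is why 12 appears in place of 4.\<close>

lemma Mk_basisE:
  assumes "4 \<le> k" "x \<in> Mk_basis k"
  obtains "x = g_lab 1" | "x = g_lab 2" | "x = g_lab 4" "5 \<le> k"
  | j where "x = g_lab (8 * j + 3)" "4 * j + 5 \<le> k" | j where "x = g_lab (8 * j + 5)" "4 * j + 6 \<le> k"
  | j where "x = g_lab (8 * j + 6)" "4 * j + 6 \<le> k" | j where "x = g_lab (8 * j + 8)" "4 * j + 7 \<le> k"
  | j where "x = g_lab (8 * j + 7)" "4 * j + 8 \<le> k" | j where "x = g_lab (8 * j + 9)" "4 * j + 8 \<le> k"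
  | j where "x = g_lab (8 * j + 10)" "4 * j + 8 \<le> k" | j where "x = g_lab (8 * j + 12)" "4 * j + 9 \<le> k"
  | j where "k = 4 * j + 6" "x \<in> h_lab ` {8 * j + 4, 8 * j + 5, 8 * j + 7, 8 * j + 8}"
  | j where "k = 4 * j + 7" "x \<in> h_lab ` {8 * j + 5, 8 * j + 6, 8 * j + 7, 8 * j + 8, 8 * j + 9}"
proof (cases x)
  case (g_lab i)
  define j where "j = i div 8"
  have i: "i = 8 * j + i mod 8" by (simp add: j_def)
  have "c < 8 \<Longrightarrow> c \<in> {0,1,2,3,4,5,6,7}" for c :: nat by auto
  then have "i mod 8 \<in> {0,1,2,3,4,5,6,7}" by simp
  then have "i = 0 \<or> i = 1 \<or> i = 2 \<or> i = 4 \<or> (\<exists>j. i = 8 * j + 3) \<or> (\<exists>j. i = 8 * j + 5) \<or> (\<exists>j. i = 8 * j + 6) \<or>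
    (\<exists>j. i = 8 * j + 8) \<or> (\<exists>j. i = 8 * j + 7) \<or> (\<exists>j. i = 8 * j + 9) \<or> (\<exists>j. i = 8 * j + 10) \<or> (\<exists>j. i = 8 * j + 12)"
  proof (elim insertE emptyE)
    assume "i mod 8 = 0"
    with i have *: "i = 8 * j + 0" by simp
    show ?thesis
    proof (cases j)
      case 0
      with * have "i = 0" by simp
      then show ?thesis by blast
    next
      case (Suc j')
      with * have "i = 8 * j' + 8" by simp
      then show ?thesis by blast
    qed
  next
    assume "i mod 8 = 1"
    with i have *: "i = 8 * j + 1" by simp
    show ?thesis
    proof (cases j)
      case 0
      with * have "i = 1" by simp
      then show ?thesis by blast
    next
      case (Suc j')
      with * have "i = 8 * j' + 9" by simp
      then show ?thesis by blast
    qed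
  next
    assume "i mod 8 = 2"
    with i have *: "i = 8 * j + 2" by simp
    show ?thesis
    proof (cases j)
      case 0
      with * have "i = 2" by simp
      then show ?thesis by blast
    next
      case (Suc j')
      with * have "i = 8 * j' + 10" by simp
      then show ?thesis by blast
    qed
  next
    assume "i mod 8 = 3"
    with i have "i = 8 * j + 3" by simp
    then show ?thesis by blast
  next
    assume "i mod 8 = 4"
    with i have *: "i = 8 * j + 4" by simp
    show ?thesis
    proof (cases j)
      case 0
      with * have "i = 4" by simp
      then show ?thesis by blast
    next
      case (Suc j')
      with * have "i = 8 * j' + 12" by simp
      then show ?thesis by blast
    qed
  next
    assume "i mod 8 = 5"
    with i have "i = 8 * j + 5" by simp
    then show ?thesis by blast
  next
    assume "i mod 8 = 6"
    with i have "i = 8 * j + 6" by simp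
    then show ?thesis by blast
  next
    assume "i mod 8 = 7"
    with i have "i = 8 * j + 7" by simp
    then show ?thesis by blast
  qed
  then show thesis using assms(2) g_in_Mk_basis[OF assms(1)] that(1-11) unfolding g_lab by metis
next
  case (h_lab i)
  from assms show thesis
  proof (cases rule: Mk_cases[OF assms(1)])
    case (3 l)
    then show thesis using that(12)[of l] assms(2) by (auto simp: Mk_basis_cases(3) h_lab)
  next
    case (4 l)
    then show thesis using that(13)[of l] assms(2) by (auto simp: Mk_basis_cases(4) h_lab)
  qed (auto simp: Mk_basis_cases(1,2) h_lab)
qed

section \<open>Normal forms in the free cover of M_k\<close>

abbreviation single_vec :: "int \<Rightarrow> v8 \<Rightarrow> int \<Rightarrow> v8" where
  "single_vec n v \<equiv> (\<lambda>m. if m = n then v else 0)"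

text \<open>The image of the generator of homological degree 4 in stem \<open>n\<close>. Residues 4
  and 5 modulo 8 give the extra generators, which occur only for \<open>k\<close> congruent to 2 or
  3 modulo 4.\<close>

definition lab :: "int \<Rightarrow> label" where
  "lab n = (if n mod 8 \<in> {4, 5} then h_lab (nat (n - 8)) else g_lab (nat (n - 8)))"

text \<open>Each basis element is written as one monomial on one generator. Where several are
  possible, as in g_4 = Sq2 Sq1 g_1 = Sq1 g_3, the lowest generator is taken: these are the
  coordinates left over by \<open>hmap\<close>, see \<open>hmap4_shape\<close>.\<close>

fun lift_lab :: "nat \<Rightarrow> label \<Rightarrow> int \<Rightarrow> v8" where
  "lift_lab k (g_lab i) =
    (if i = 1 then single_vec 9 (V8 1 0 0 0 0 0 0 0)
     else if i = 2 then single_vec 9 (V8 0 1 0 0 0 0 0 0)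
     else if i = 4 then single_vec 9 (V8 0 0 0 0 1 0 0 0)
     else if i mod 4 = 3 then single_vec (int i + 8) (V8 1 0 0 0 0 0 0 0)
     else if i mod 4 = 1 then single_vec (int i + 6) (V8 0 0 1 0 0 0 0 0)
     else if i mod 4 = 2 then single_vec (int i + 5) (V8 0 0 0 1 0 0 0 0)
     else single_vec (int i + 3) (V8 0 0 0 0 0 0 1 0))"
| "lift_lab k (h_lab i) =
    (if k mod 4 = 2 then
       if i mod 8 = 4 then single_vec (int i + 8) (V8 1 0 0 0 0 0 0 0)
       else if i mod 8 = 5 then single_vec (int i + 7) (V8 0 1 0 0 0 0 0 0)
       else if i mod 8 = 7 then single_vec (int i + 5) (V8 0 0 0 0 1 0 0 0)
       else single_vec (int i + 3) (V8 0 0 0 0 0 0 1 0)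
     else
       if i mod 8 = 5 then single_vec (int i + 8) (V8 1 0 0 0 0 0 0 0)
       else if i mod 8 = 6 then single_vec (int i + 7) (V8 0 1 0 0 0 0 0 0)
       else if i mod 8 = 7 then single_vec (int i + 6) (V8 0 0 1 0 0 0 0 0)
       else if i mod 8 = 0 then single_vec (int i + 5) (V8 0 0 0 0 1 0 0 0)
       else single_vec (int i + 4) (V8 0 0 0 0 0 1 0 0))"

declare lift_lab.simps [simp del]

lemma nat_mods:
  "(8 * j + 3) mod 4 = (3::nat)" "(8 * j + 5) mod 4 = (1::nat)" "(8 * j + 6) mod 4 = (2::nat)"
  "(8 * j + 7) mod 4 = (3::nat)" "(8 * j + 8) mod 4 = (0::nat)" "(8 * j + 9) mod 4 = (1::nat)"
  "(8 * j + 10) mod 4 = (2::nat)" "(8 * j + 12) mod 4 = (0::nat)"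
  "(8 * j + 4) mod 8 = (4::nat)" "(8 * j + 5) mod 8 = (5::nat)" "(8 * j + 6) mod 8 = (6::nat)"
  "(8 * j + 7) mod 8 = (7::nat)" "(8 * j + 8) mod 8 = (0::nat)" "(8 * j + 9) mod 8 = (1::nat)"
  "(4 * j + 6) mod 4 = (2::nat)" "(4 * j + 7) mod 4 = (3::nat)"
  using mod_mult_self4[of 8 j "_ :: nat"] mod_mult_self4[of 4 j "_ :: nat"] by (simp_all add: mod4_add)

lemma lift_lab_simps:
  "lift_lab k (g_lab 1) = single_vec 9 (V8 1 0 0 0 0 0 0 0)"
  "lift_lab k (g_lab 2) = single_vec 9 (V8 0 1 0 0 0 0 0 0)"
  "lift_lab k (g_lab 4) = single_vec 9 (V8 0 0 0 0 1 0 0 0)"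
  "lift_lab k (g_lab (8 * j + 3)) = single_vec (8 * int j + 11) (V8 1 0 0 0 0 0 0 0)"
  "lift_lab k (g_lab (8 * j + 5)) = single_vec (8 * int j + 11) (V8 0 0 1 0 0 0 0 0)"
  "lift_lab k (g_lab (8 * j + 6)) = single_vec (8 * int j + 11) (V8 0 0 0 1 0 0 0 0)"
  "lift_lab k (g_lab (8 * j + 8)) = single_vec (8 * int j + 11) (V8 0 0 0 0 0 0 1 0)"
  "lift_lab k (g_lab (8 * j + 7)) = single_vec (8 * int j + 15) (V8 1 0 0 0 0 0 0 0)"
  "lift_lab k (g_lab (8 * j + 9)) = single_vec (8 * int j + 15) (V8 0 0 1 0 0 0 0 0)"
  "lift_lab k (g_lab (8 * j + 10)) = single_vec (8 * int j + 15) (V8 0 0 0 1 0 0 0 0)"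
  "lift_lab k (g_lab (8 * j + 12)) = single_vec (8 * int j + 15) (V8 0 0 0 0 0 0 1 0)"
  "k = 4 * j + 6 \<Longrightarrow> lift_lab k (h_lab (8 * j + 4)) = single_vec (8 * int j + 12) (V8 1 0 0 0 0 0 0 0)"
  "k = 4 * j + 6 \<Longrightarrow> lift_lab k (h_lab (8 * j + 5)) = single_vec (8 * int j + 12) (V8 0 1 0 0 0 0 0 0)"
  "k = 4 * j + 6 \<Longrightarrow> lift_lab k (h_lab (8 * j + 7)) = single_vec (8 * int j + 12) (V8 0 0 0 0 1 0 0 0)"
  "k = 4 * j + 6 \<Longrightarrow> lift_lab k (h_lab (8 * j + 8)) = single_vec (8 * int j + 11) (V8 0 0 0 0 0 0 1 0)"
  "k = 4 * j + 7 \<Longrightarrow> lift_lab k (h_lab (8 * j + 5)) = single_vec (8 * int j + 13) (V8 1 0 0 0 0 0 0 0)"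
  "k = 4 * j + 7 \<Longrightarrow> lift_lab k (h_lab (8 * j + 6)) = single_vec (8 * int j + 13) (V8 0 1 0 0 0 0 0 0)"
  "k = 4 * j + 7 \<Longrightarrow> lift_lab k (h_lab (8 * j + 7)) = single_vec (8 * int j + 13) (V8 0 0 1 0 0 0 0 0)"
  "k = 4 * j + 7 \<Longrightarrow> lift_lab k (h_lab (8 * j + 8)) = single_vec (8 * int j + 13) (V8 0 0 0 0 1 0 0 0)"
  "k = 4 * j + 7 \<Longrightarrow> lift_lab k (h_lab (8 * j + 9)) = single_vec (8 * int j + 13) (V8 0 0 0 0 0 1 0 0)"
  by (simp_all add: lift_lab.simps nat_mods) (simp_all add: add.commute)

lemma lab_simps:
  "lab 9 = g_lab 1" "lab (8 * int j + 11) = g_lab (8 * j + 3)" "lab (8 * int j + 15) = g_lab (8 * j + 7)"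
  "lab (8 * int j + 12) = h_lab (8 * j + 4)" "lab (8 * int j + 13) = h_lab (8 * j + 5)"
proof -
  have n: "nat (8 * int j + int c) = 8 * j + c" for c by simp
  show "lab 9 = g_lab 1" "lab (8 * int j + 11) = g_lab (8 * j + 3)" "lab (8 * int j + 15) = g_lab (8 * j + 7)"
    "lab (8 * int j + 12) = h_lab (8 * j + 4)" "lab (8 * int j + 13) = h_lab (8 * j + 5)"
    using n[of 3] n[of 4] n[of 5] n[of 7] by (simp_all add: lab_def)
qed

lemma gen_9: "gen k 4 9"
  by (simp add: gen_def)

lemma gen4E:
  assumes "gen (int k) 4 n" "4 \<le> k"
  obtains "n = 9" | j where "n = 8 * int j + 11" "4 * j + 5 \<le> k" | j where "n = 8 * int j + 15" "4 * j + 8 \<le> k"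
  | j where "n = 8 * int j + 12" "k = 4 * j + 6" | j where "n = 8 * int j + 13" "k = 4 * j + 7"
proof (rule stem_cases[of n])
  fix i assume n: "n = 8 * i + 1" then show thesis using assms that(1) by simp
next
  fix i assume n: "n = 8 * i + 2" then show thesis using assms by simp presburger
next
  fix i assume n: "n = 8 * i + 3"
  then have "n = 8 * int (nat (i - 1)) + 11" "4 * nat (i - 1) + 5 \<le> k" using assms by auto
  then show thesis by (rule that(2))
next
  fix i assume n: "n = 8 * i + 4"
  then have "n = 8 * int (nat (i - 1)) + 12" "k = 4 * nat (i - 1) + 6" using assms by auto
  then show thesis by (rule that(4))
next
  fix i assume n: "n = 8 * i + 5"
  then have "n = 8 * int (nat (i - 1)) + 13" "k = 4 * nat (i - 1) + 7" using assms by auto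
  then show thesis by (rule that(5))
next
  fix i assume n: "n = 8 * i + 7"
  then have "n = 8 * int (nat (i - 1)) + 15" "4 * nat (i - 1) + 8 \<le> k" using assms by auto
  then show thesis by (rule that(3))
qed (use assms in simp_all)

text \<open>The image of the homotopy in degree 4 involves only the monomials chosen in
  \<open>lift_lab\<close>; the bounds on \<open>k\<close> remove those that leave the module at its
  top end.\<close>

lemma hmap4_shape:
  fixes z :: "int \<Rightarrow> v8"
  assumes z: "\<forall>n. \<not> gen k 3 n \<longrightarrow> z n = 0" and k: "4 \<le> k"
  defines "y \<equiv> hmap k 4 z"
  shows "y 9 = V8 (c0 (y 9)) (c1 (y 9)) 0 0 (c4 (y 9)) 0 0 0 \<and> (k = 4 \<longrightarrow> c4 (y 9) = 0)"
    and "gen k 4 (8 * i + 3) \<Longrightarrow> y (8 * i + 3) =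
       V8 (c0 (y (8 * i + 3))) 0 (c2 (y (8 * i + 3))) (c3 (y (8 * i + 3))) 0 0 (c6 (y (8 * i + 3))) 0
      \<and> (k < 4 * i + 2 \<longrightarrow> c2 (y (8 * i + 3)) = 0 \<and> c3 (y (8 * i + 3)) = 0 \<and> c6 (y (8 * i + 3)) = 0)"
    and "gen k 4 (8 * i + 4) \<Longrightarrow> y (8 * i + 4) = V8 (c0 (y (8 * i + 4))) (c1 (y (8 * i + 4))) 0 0 (c4 (y (8 * i + 4))) 0 0 0"
    and "gen k 4 (8 * i + 5) \<Longrightarrow> y (8 * i + 5) =
       V8 (c0 (y (8 * i + 5))) (c1 (y (8 * i + 5))) (c2 (y (8 * i + 5))) 0 (c4 (y (8 * i + 5))) (c5 (y (8 * i + 5))) 0 0"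
    and "gen k 4 (8 * i + 7) \<Longrightarrow> y (8 * i + 7) =
       V8 (c0 (y (8 * i + 7))) 0 (c2 (y (8 * i + 7))) (c3 (y (8 * i + 7))) 0 0 (c6 (y (8 * i + 7))) 0
      \<and> (k < 4 * i + 5 \<longrightarrow> c6 (y (8 * i + 7)) = 0)"
proof -
  have "hmap k 4 z 9 = V8 (c4 (z 7) + c6 (z 5)) (c5 (z 7) + c7 (z 5)) 0 0 (c7 (z 7)) 0 0 0"
    using hmap_simps(7)[of k 4 z 0] by (simp add: gen_9)
  moreover have "k = 4 \<Longrightarrow> z 7 = 0" using z by (simp add: gen_def)
  ultimately show "y 9 = V8 (c0 (y 9)) (c1 (y 9)) 0 0 (c4 (y 9)) 0 0 0 \<and> (k = 4 \<longrightarrow> c4 (y 9) = 0)"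
    by (auto simp: y_def)
  \<comment> \<open>Congruences modulo 4: they exclude generators of degree 3 in stem 8i + 2 and
    switch off the conditional terms of \<open>hmap\<close> in stems 8i + 5 and 8i + 7.\<close>
  have par: "(3::int) \<noteq> 4 * i + 1" "4 * i \<noteq> (1::int)" "(4::int) \<noteq> 4 * i + 3" by presburger+
  show "gen k 4 (8 * i + 3) \<Longrightarrow> y (8 * i + 3) = V8 (c0 (y (8 * i + 3))) 0 (c2 (y (8 * i + 3))) (c3 (y (8 * i + 3))) 0 0 (c6 (y (8 * i + 3))) 0 \<and> (k < 4 * i + 2 \<longrightarrow> c2 (y (8 * i + 3)) = 0 \<and> c3 (y (8 * i + 3)) = 0 \<and> c6 (y (8 * i + 3)) = 0)"
    unfolding y_def using k par by (simp add: hmap_simps supp_simps[OF z])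
  show "gen k 4 (8 * i + 4) \<Longrightarrow> y (8 * i + 4) = V8 (c0 (y (8 * i + 4))) (c1 (y (8 * i + 4))) 0 0 (c4 (y (8 * i + 4))) 0 0 0"
    unfolding y_def using k par by (simp add: hmap_simps supp_simps[OF z])
  show "gen k 4 (8 * i + 5) \<Longrightarrow> y (8 * i + 5) = V8 (c0 (y (8 * i + 5))) (c1 (y (8 * i + 5))) (c2 (y (8 * i + 5))) 0 (c4 (y (8 * i + 5))) (c5 (y (8 * i + 5))) 0 0"
    unfolding y_def using k par by (simp add: hmap_simps supp_simps[OF z])
  show "gen k 4 (8 * i + 7) \<Longrightarrow> y (8 * i + 7) = V8 (c0 (y (8 * i + 7))) 0 (c2 (y (8 * i + 7))) (c3 (y (8 * i + 7))) 0 0 (c6 (y (8 * i + 7))) 0 \<and> (k < 4 * i + 5 \<longrightarrow> c6 (y (8 * i + 7)) = 0)"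
    unfolding y_def using k par by (simp add: hmap_simps supp_simps[OF z])
qed

lemma bscale_sel:
  "c0 (bscale b v) = b * c0 v" "c1 (bscale b v) = b * c1 v" "c2 (bscale b v) = b * c2 v" "c3 (bscale b v) = b * c3 v"
  "c4 (bscale b v) = b * c4 v" "c5 (bscale b v) = b * c5 v" "c6 (bscale b v) = b * c6 v" "c7 (bscale b v) = b * c7 v"
  by (cases b; simp)+

lemma bscale_single_vec: "bscale b (single_vec n v) = single_vec n (bscale b v)"
  by (cases b) (auto simp: fun_eq_iff)

lemma single_vec_add: "single_vec n u + single_vec n v = single_vec n (u + v)"
  by (auto simp: fun_eq_iff)

locale Mk_module = gmodule N for N :: "'m::ab_group_add gmod" +
  fixes k :: nat and e :: "label \<Rightarrow> 'm"
  assumes k4: "4 \<le> k"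
    and piece_eq: "piece N n = {(\<Sum>x\<in>S. e x) | S. S \<subseteq> {x \<in> Mk_basis k. int (label_deg x) = n}}"
    and indep: "S \<subseteq> Mk_basis k \<Longrightarrow> (\<Sum>x\<in>S. e x) = 0 \<Longrightarrow> S = {}"
    and act_Sq1: "x \<in> Mk_basis k \<Longrightarrow> act N (Sq 1) (e x) = (\<Sum>y \<in> Mk_Sq1 k `` {x}. e y)"
    and act_Sq2: "x \<in> Mk_basis k \<Longrightarrow> act N (Sq 2) (e x) = (\<Sum>y \<in> Mk_Sq2 k `` {x}. e y)"
begin

abbreviation q1 where "q1 \<equiv> act N (Sq 1)"
abbreviation q2 where "q2 \<equiv> act N (Sq 2)"

lemma e_piece: "x \<in> Mk_basis k \<Longrightarrow> e x \<in> piece N (int (label_deg x))"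
  unfolding piece_eq by (intro CollectI exI[of _ "{x}"]) simp

lemma e_total: "x \<in> Mk_basis k \<Longrightarrow> e x \<in> total N"
  by (rule piece_subset_total[OF e_piece])

text \<open>Modulo 2, subset sums add as symmetric differences; linear algebra in the basis
  \<open>e\<close> becomes a matter of sets.\<close>

lemma sum_sym_diff:
  fixes f :: "label \<Rightarrow> 'b::ab_group_add"
  assumes "finite A" "finite B" "\<And>x. x \<in> A \<inter> B \<Longrightarrow> f x + f x = 0"
  shows "sum f A + sum f B = sum f (A - B \<union> (B - A))"
proof -
  have "sum f A = sum f (A - B) + sum f (A \<inter> B)" "sum f B = sum f (B - A) + sum f (A \<inter> B)"
    using assms(1,2) by (metis Int_commute sum.Int_Diff add.commute)+
  moreover have "sum f (A \<inter> B) + sum f (A \<inter> B) = 0" using assms(3) by (simp add: sum.distrib[symmetric])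
  moreover have "sum f (A - B \<union> (B - A)) = sum f (A - B) + sum f (B - A)"
    using assms(1,2) by (intro sum.union_disjoint) auto
  ultimately show ?thesis by (simp add: algebra_simps)
qed

lemma finite_Mk_subset: "S \<subseteq> Mk_basis k \<Longrightarrow> finite S"
  by (rule finite_subset[OF _ finite_Mk_basis])

lemma total_expand: "m \<in> total N \<Longrightarrow> \<exists>S\<subseteq>Mk_basis k. m = (\<Sum>x\<in>S. e x)"
proof (induction rule: total_induct)
  case (piece n x)
  then show ?case by (auto simp: piece_eq)
next
  case (add x y)
  then obtain S T where *: "S \<subseteq> Mk_basis k" "T \<subseteq> Mk_basis k" "x = sum e S" "y = sum e T" by blast
  moreover have "finite S" "finite T" using * by (auto intro: finite_Mk_subset)
  ultimately have "x + y = sum e (S - T \<union> (T - S))"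
    using sum_sym_diff[of S T e] add_self[OF e_total] by blast
  then show ?case using *(1,2) by (intro exI[of _ "S - T \<union> (T - S)"]) auto
qed

lemma sum_e_inject:
  assumes "S \<subseteq> Mk_basis k" "T \<subseteq> Mk_basis k" "sum e S = sum e T" shows "S = T"
proof -
  have "finite S" "finite T" using assms by (auto intro: finite_Mk_subset)
  then have "sum e S + sum e T = sum e (S - T \<union> (T - S))"
    using sum_sym_diff[of S T e] add_self[OF e_total] assms by blast
  moreover have "sum e S + sum e T = 0"
    using assms add_self[OF total_sum[of T e]] e_total by (simp add: subset_iff)
  ultimately have "S - T \<union> (T - S) = {}" using assms(1,2) by (intro indep) auto
  then show ?thesis by blast
qed

definition supp :: "'m \<Rightarrow> label set" where
  "supp m = (THE S. S \<subseteq> Mk_basis k \<and> m = sum e S)"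

lemma supp_sum: "S \<subseteq> Mk_basis k \<Longrightarrow> supp (sum e S) = S"
  unfolding supp_def by (rule the_equality) (auto dest: sum_e_inject)

text \<open>The additive section of \<open>eps\<close> that sends each basis element to its normal
  form.\<close>

definition lift :: "'m \<Rightarrow> int \<Rightarrow> v8" where
  "lift m = (\<Sum>x\<in>supp m. lift_lab k x)"

lemma lift_sum: "S \<subseteq> Mk_basis k \<Longrightarrow> lift (sum e S) = (\<Sum>x\<in>S. lift_lab k x)"
  by (simp add: lift_def supp_sum)

lemma lift_add:
  assumes "x \<in> total N" "y \<in> total N" shows "lift (x + y) = lift x + lift y"
proof -
  obtain S T where *: "S \<subseteq> Mk_basis k" "T \<subseteq> Mk_basis k" "x = sum e S" "y = sum e T"
    using total_expand[OF assms(1)] total_expand[OF assms(2)] by blast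
  have fin: "finite S" "finite T" using * by (auto intro: finite_Mk_subset)
  have self: "e u + e u = 0" if "u \<in> S \<inter> T" for u
    using that *(1) by (intro add_self e_total) auto
  have D: "S - T \<union> (T - S) \<subseteq> Mk_basis k" using * by auto
  have "lift (x + y) = lift (sum e (S - T \<union> (T - S)))"
    unfolding *(3,4) by (subst sum_sym_diff[OF fin self]) simp_all
  also have "\<dots> = sum (lift_lab k) (S - T \<union> (T - S))" by (rule lift_sum[OF D])
  also have "\<dots> = sum (lift_lab k) S + sum (lift_lab k) T"
    by (rule sum_sym_diff[OF fin, symmetric]) (simp add: fun_eq_iff)
  also have "\<dots> = lift x + lift y" unfolding *(3,4) by (simp only: lift_sum[OF *(1)] lift_sum[OF *(2)])
  finally show ?thesis .
qed

lemma lift_e: "x \<in> Mk_basis k \<Longrightarrow> lift (e x) = lift_lab k x"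
  using lift_sum[of "{x}"] by simp

lemma lift_zero [simp]: "lift 0 = 0"
  using lift_sum[of "{}"] by simp

lemma lift_total_sum: "(\<And>i. i \<in> I \<Longrightarrow> f i \<in> total N) \<Longrightarrow> lift (\<Sum>i\<in>I. f i) = (\<Sum>i\<in>I. lift (f i))"
  by (induction I rule: infinite_finite_induct) (simp_all add: lift_add total_sum)

lemma lift_bscale: "lift (bscale b m) = bscale b (lift m)"
  by (cases b) simp_all

lemmas in_basis = g_in_Mk_basis[OF k4]

lemma q_g_low:
  "q1 (e (g_lab 1)) = e (g_lab 2)" "q2 (e (g_lab 1)) = 0" "q2 (e (g_lab 2)) = (if k = 4 then 0 else e (g_lab 4))"
  using in_basis(1,2) act_Sq1[of "g_lab 1"] act_Sq2[of "g_lab 1"] act_Sq2[of "g_lab 2"]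
  by (simp_all add: Mk_Sq1_g Mk_Sq2_g(6,7)[OF k4] del: One_nat_def)

lemma q_g:
  "4 * j + 5 \<le> k \<Longrightarrow> q1 (e (g_lab (8 * j + 3))) = e (g_lab (8 * j + 4))"
  "4 * j + 6 \<le> k \<Longrightarrow> q2 (e (g_lab (8 * j + 3))) = e (g_lab (8 * j + 5))"
  "k = 4 * j + 5 \<Longrightarrow> q2 (e (g_lab (8 * j + 3))) = 0"
  "4 * j + 6 \<le> k \<Longrightarrow> q1 (e (g_lab (8 * j + 5))) = e (g_lab (8 * j + 6))"
  "4 * j + 6 \<le> k \<Longrightarrow> q2 (e (g_lab (8 * j + 6))) = e (if k = 4 * j + 6 then h_lab (8 * j + 8) else g_lab (8 * j + 8))"
  "4 * j + 8 \<le> k \<Longrightarrow> q1 (e (g_lab (8 * j + 7))) = e (g_lab (8 * j + 8))"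
  "4 * j + 8 \<le> k \<Longrightarrow> q2 (e (g_lab (8 * j + 7))) = e (g_lab (8 * j + 9))"
  "4 * j + 8 \<le> k \<Longrightarrow> q1 (e (g_lab (8 * j + 9))) = e (g_lab (8 * j + 10))"
  "4 * j + 8 \<le> k \<Longrightarrow> q2 (e (g_lab (8 * j + 10))) = (if k = 4 * j + 8 then 0 else e (g_lab (8 * j + 12)))"
  using in_basis act_Sq1 act_Sq2 k4
  by (simp_all add: Mk_Sq1_g Mk_Sq2_g) (simp_all add: add.commute)

lemma h_in_basis_2: "k = 4 * j + 6 \<Longrightarrow> x \<in> h_lab ` {8 * j + 4, 8 * j + 5, 8 * j + 7, 8 * j + 8} \<Longrightarrow> x \<in> Mk_basis k"
  by (simp only: Mk_basis_cases(3)) blast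

lemma h_in_basis_3: "k = 4 * j + 7 \<Longrightarrow> x \<in> h_lab ` {8 * j + 5, 8 * j + 6, 8 * j + 7, 8 * j + 8, 8 * j + 9} \<Longrightarrow> x \<in> Mk_basis k"
  by (simp only: Mk_basis_cases(4)) blast

lemma q_h_2:
  assumes "k = 4 * j + 6"
  shows "q1 (e (h_lab (8 * j + 4))) = e (h_lab (8 * j + 5))" "q2 (e (h_lab (8 * j + 4))) = e (g_lab (8 * j + 6))"
    "q2 (e (h_lab (8 * j + 5))) = e (h_lab (8 * j + 7))"
  using h_in_basis_2[OF assms] act_Sq1 act_Sq2 by (simp_all add: Mk_h_2[OF assms])

lemma q_h_3:
  assumes "k = 4 * j + 7"
  shows "q1 (e (h_lab (8 * j + 5))) = e (h_lab (8 * j + 6))" "q1 (e (h_lab (8 * j + 7))) = e (g_lab (8 * j + 8))"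
    "q1 (e (h_lab (8 * j + 8))) = e (h_lab (8 * j + 9))"
    "q2 (e (h_lab (8 * j + 5))) = e (h_lab (8 * j + 7))" "q2 (e (h_lab (8 * j + 6))) = e (h_lab (8 * j + 8))"
  using h_in_basis_3[OF assms] act_Sq1 act_Sq2 by (simp_all add: Mk_h_3[OF assms])

lemma lab_in_basis:
  assumes "gen (int k) 4 n" shows "lab n \<in> Mk_basis k"
  using assms k4
proof (cases rule: gen4E)
  case 1
  then show ?thesis using in_basis(1) by (simp only: lab_simps)
next
  case (2 j)
  then show ?thesis by (simp add: lab_simps in_basis)
next
  case (3 j)
  then show ?thesis by (simp add: lab_simps in_basis)
next
  case (4 j)
  then show ?thesis using h_in_basis_2[OF 4(2)] by (simp add: lab_simps)
next
  case (5 j)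
  then show ?thesis using h_in_basis_3[OF 5(2)] by (simp add: lab_simps)
qed

lemma lab_deg: "gen (int k) 4 n \<Longrightarrow> int (label_deg (lab n)) = n - 8"
  using k4 by (elim gen4E) (simp_all add: lab_simps)

abbreviation "G0 \<equiv> {n. gen (int k) 4 n}"
abbreviation "F0 \<equiv> free_mod G0 (\<lambda>n. n - 8)"

definition eps where "eps = free_map G0 (\<lambda>n. e (lab n))"

lemma e_lab_piece: "n \<in> G0 \<Longrightarrow> e (lab n) \<in> piece N (n - 8)"
  using e_piece[OF lab_in_basis] lab_deg by fastforce

lemma e_lab_total: "n \<in> G0 \<Longrightarrow> e (lab n) \<in> total N"
  by (rule piece_subset_total[OF e_lab_piece])

lemma gmap_eps: "gmap F0 N eps"
  unfolding eps_def by (rule gmap_free_map[OF e_lab_piece])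

lemma eps_act: "a \<in> A1 \<Longrightarrow> eps (act F0 a x) = act N a (eps x)"
  unfolding eps_def by (rule free_map_act[OF e_lab_total])

lemma eps_add: "eps (x + y) = eps x + eps y"
  unfolding eps_def by (rule free_map_add[OF e_lab_total])

lemma finite_G0: "finite G0"
  by (rule finite_gen) simp

lemma eps_single:
  assumes "gen (int k) 4 n"
  shows "eps (single_vec n v) = act N (v8_elt v) (e (lab n))"
proof -
  have "eps (single_vec n v) = (\<Sum>m\<in>G0. if m = n then act N (v8_elt v) (e (lab n)) else 0)"
    unfolding eps_def free_map_def using e_lab_total act_zero by (intro sum.cong) auto
  then show ?thesis using finite_G0 assms by simp
qed

lemma eps_lift_lab:
  assumes "x \<in> Mk_basis k" shows "eps (lift_lab k x) = e x"
  using k4 assms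
proof (cases rule: Mk_basisE)
  case (12 j)
  have ik: "int k = 4 * int j + 6" and le: "4 * j + 6 \<le> k" using 12(1) by simp_all
  have b: "h_lab (8 * j + 4) \<in> Mk_basis k" "g_lab (8 * j + 3) \<in> Mk_basis k" using h_in_basis_2[OF 12(1)] in_basis le by simp_all
  from 12(2) consider "x = h_lab (8 * j + 4)" | "x = h_lab (8 * j + 5)" | "x = h_lab (8 * j + 7)" | "x = h_lab (8 * j + 8)" by blast
  then show ?thesis
    by cases (simp_all add: lift_lab_simps(12-15)[OF 12(1)] eps_single ik lab_simps act_v8_elt e_total b
        q_h_2[OF 12(1)] q_g le 12(1)[symmetric] act_one del: One_nat_def)
next
  case (13 j)
  have ik: "int k = 4 * int j + 7" using 13(1) by simp
  have b: "h_lab (8 * j + 5) \<in> Mk_basis k" using h_in_basis_3[OF 13(1)] by simp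
  from 13(2) consider "x = h_lab (8 * j + 5)" | "x = h_lab (8 * j + 6)" | "x = h_lab (8 * j + 7)" | "x = h_lab (8 * j + 8)" | "x = h_lab (8 * j + 9)" by blast
  then show ?thesis
    by cases (simp_all add: lift_lab_simps(16-20)[OF 13(1)] eps_single ik lab_simps act_v8_elt e_total b
        q_h_3[OF 13(1)] act_one del: One_nat_def)
qed (use k4 in_basis in \<open>simp_all add: lift_lab_simps eps_single gen_9 lab_simps act_v8_elt act_one e_total q_g q_g_low
  del: One_nat_def\<close>)

lemma lift_lab_piece:
  assumes "x \<in> Mk_basis k" shows "lift_lab k x \<in> piece F0 (int (label_deg x))"
proof -
  have *: "single_vec n v \<in> piece F0 d" if "gen (int k) 4 n" "v \<in> v8_piece (d - (n - 8))" for n v d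
    using that by (simp add: free_mod_def)
  from k4 assms show ?thesis
  proof (cases rule: Mk_basisE)
    case (12 j)
    have ik: "int k = 4 * int j + 6" using 12(1) by simp
    from 12(2) consider "x = h_lab (8 * j + 4)" | "x = h_lab (8 * j + 5)" | "x = h_lab (8 * j + 7)" | "x = h_lab (8 * j + 8)" by blast
    then show ?thesis
      by cases (simp_all only: lift_lab_simps(12-15)[OF 12(1)] label_deg.simps; rule *; simp add: ik v8_piece_def)+
  next
    case (13 j)
    have ik: "int k = 4 * int j + 7" using 13(1) by simp
    from 13(2) consider "x = h_lab (8 * j + 5)" | "x = h_lab (8 * j + 6)" | "x = h_lab (8 * j + 7)" | "x = h_lab (8 * j + 8)" | "x = h_lab (8 * j + 9)" by blast
    then show ?thesis
      by cases (simp_all only: lift_lab_simps(16-20)[OF 13(1)] label_deg.simps; rule *; simp add: ik v8_piece_def)+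
  qed (use k4 in \<open>auto simp: lift_lab_simps gen_9 v8_piece_def simp del: One_nat_def intro!: *\<close>)
qed

lemma gmap_lift: "gmap N F0 lift"
  unfolding gmap_def
proof (intro conjI ballI allI)
  fix n x assume "x \<in> piece N n"
  then obtain S where S: "S \<subseteq> {x \<in> Mk_basis k. int (label_deg x) = n}" "x = sum e S" by (auto simp: piece_eq)
  then have "S \<subseteq> Mk_basis k" by auto
  moreover have "(\<Sum>x\<in>S. lift_lab k x) \<in> piece F0 n"
    using S(1) lift_lab_piece by (intro gmodule.piece_sum[OF gmodule_free]) auto
  ultimately show "lift x \<in> piece F0 n" by (simp add: S(2) lift_sum)
qed (rule lift_add)

lemma eps_lift:
  assumes "m \<in> total N" shows "eps (lift m) = m"
proof -
  obtain S where S: "S \<subseteq> Mk_basis k" "m = sum e S" using total_expand[OF assms] by blast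
  have "eps (\<Sum>x\<in>S. lift_lab k x) = (\<Sum>x\<in>S. eps (lift_lab k x))"
  proof (induction S rule: infinite_finite_induct)
    case (insert x S)
    then show ?case unfolding sum.insert[OF insert.hyps] eps_add by simp
  qed (simp_all add: eps_add[of 0 0, simplified] flip: zero_fun_def)
  also have "\<dots> = sum e S" using S(1) eps_lift_lab by (intro sum.cong) auto
  finally show ?thesis using S by (simp add: lift_sum)
qed

lemma bscale_total: "m \<in> total N \<Longrightarrow> bscale b m \<in> total N"
  by (cases b) simp_all

lemmas lift_bscale_sums = lift_add lift_bscale bscale_total total_add lift_e e_total

text \<open>On the image of the homotopy all coordinates are normal forms, which \<open>lift\<close>
  recovers. In general it does not undo \<open>eps\<close>: for \<open>k \<ge> 5\<close>, Sq1 on the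
  generator in stem 11 comes back as Sq2 Sq1 on the one in stem 9.\<close>

lemma lift_eps_hmap:
  assumes z: "\<forall>n. \<not> gen (int k) 3 n \<longrightarrow> z n = 0" and n: "gen (int k) 4 n"
  defines "y \<equiv> hmap (int k) 4 z"
  shows "lift (act N (v8_elt (y n)) (e (lab n))) = single_vec n (y n)"
  using n k4
proof (cases rule: gen4E)
  case 1
  obtain a b c where v: "y n = V8 a b 0 0 c 0 0 0" and c: "k = 4 \<longrightarrow> c = 0"
    using hmap4_shape(1)[OF z] k4 1 by (auto simp: y_def)
  show ?thesis
  proof (cases "k = 4")
    case True
    have q: "q2 (e (g_lab 2)) = 0" using q_g_low(3) True by simp
    have "c = 0" using c True by blast
    then show ?thesis unfolding v using in_basis(1,2)
      by (simp add: 1 lab_simps act_v8_elt q q_g_low(1,2) act_zero_right A1.Sq1 A1.Sq2 lift_bscale_sums lift_lab_simps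
          bscale_single_vec single_vec_add del: One_nat_def) (auto simp: bscale_sel intro!: ext v8.expand)
  next
    case False
    then have "5 \<le> k" using k4 by simp
    with False show ?thesis unfolding v using in_basis(1-3)
      by (simp add: 1 lab_simps act_v8_elt q_g_low act_zero_right A1.Sq1 A1.Sq2 lift_bscale_sums lift_lab_simps
          bscale_single_vec single_vec_add del: One_nat_def) (auto simp: bscale_sel intro!: ext v8.expand)
  qed
next
  case (2 j)
  obtain a b c d where v: "y n = V8 a 0 b c 0 0 d 0" and c: "k = 4 * j + 5 \<longrightarrow> b = 0 \<and> c = 0 \<and> d = 0"
    using hmap4_shape(2)[OF z, of "int j + 1"] k4 n 2 by (auto simp: y_def algebra_simps)
  consider "k = 4 * j + 5" | "k = 4 * j + 6" | "4 * j + 7 \<le> k" using 2 by linarith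
  then show ?thesis
  proof cases
    case 1
    then have "g_lab (8 * j + 3) \<in> Mk_basis k" "b = 0" "c = 0" "d = 0" using in_basis(5)[of j] c by auto
    then show ?thesis unfolding v
      by (simp add: \<open>n = _\<close> lab_simps act_v8_elt lift_bscale_sums lift_lab_simps bscale_single_vec del: One_nat_def)
        (auto simp: bscale_sel intro!: ext v8.expand)
  next
    case 2
    have b: "h_lab (8 * j + 8) \<in> Mk_basis k" using h_in_basis_2[OF 2] by simp
    have le: "4 * j + 6 \<le> k" "4 * j + 5 \<le> k" using 2 by simp_all
    have q: "q2 (e (g_lab (8 * j + 6))) = e (h_lab (8 * j + 8))" using q_g(5)[OF le(1)] 2 by simp
    show ?thesis unfolding v using in_basis(5-7)[of j] le b
      by (simp add: \<open>n = _\<close> lab_simps act_v8_elt q q_g(1,2,4) lift_bscale_sums lift_lab_simps(1-11)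
          lift_lab_simps(12-15)[OF 2] bscale_single_vec single_vec_add del: One_nat_def)
        (auto simp: bscale_sel intro!: ext v8.expand)
  next
    case 3
    then show ?thesis unfolding v using in_basis
      by (simp add: \<open>n = _\<close> lab_simps act_v8_elt q_g lift_bscale_sums lift_lab_simps bscale_single_vec single_vec_add del: One_nat_def)
        (auto simp: bscale_sel intro!: ext v8.expand)
  qed
next
  case (3 j)
  obtain a b c d where v: "y n = V8 a 0 b c 0 0 d 0" and c: "k = 4 * j + 8 \<longrightarrow> d = 0"
    using hmap4_shape(5)[OF z, of "int j + 1"] k4 n 3 by (auto simp: y_def algebra_simps)
  show ?thesis
  proof (cases "k = 4 * j + 8")
    case True
    have q: "q2 (e (g_lab (8 * j + 10))) = 0" using q_g(9)[OF 3(2)] True by simp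
    have "d = 0" using c True by blast
    then show ?thesis unfolding v using in_basis(8,10,11)[of j] 3(2)
      by (simp add: 3(1) lab_simps act_v8_elt q q_g(6-8) lift_bscale_sums lift_lab_simps(1-11) bscale_single_vec single_vec_add del: One_nat_def)
        (auto simp: bscale_sel intro!: ext v8.expand)
  next
    case False
    then have "4 * j + 9 \<le> k" using 3(2) by simp
    with False show ?thesis unfolding v using in_basis(8,10-12)[of j] 3(2)
      by (simp add: 3(1) lab_simps act_v8_elt q_g(6-9) lift_bscale_sums lift_lab_simps(1-11) bscale_single_vec single_vec_add del: One_nat_def)
        (auto simp: bscale_sel intro!: ext v8.expand)
  qed
next
  case (4 j)
  obtain a b c where v: "y n = V8 a b 0 0 c 0 0 0"
    using hmap4_shape(3)[OF z, of "int j + 1"] k4 n 4 by (auto simp: y_def algebra_simps)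
  have b: "h_lab (8 * j + 4) \<in> Mk_basis k" "h_lab (8 * j + 5) \<in> Mk_basis k" "h_lab (8 * j + 7) \<in> Mk_basis k"
    using h_in_basis_2[OF 4(2)] by simp_all
  then show ?thesis unfolding v
    by (simp add: 4(1) lab_simps act_v8_elt q_h_2[OF 4(2)] lift_bscale_sums lift_lab_simps(12-15)[OF 4(2)]
        bscale_single_vec single_vec_add del: One_nat_def)
      (auto simp: bscale_sel intro!: ext v8.expand)
next
  case (5 j)
  obtain a b c d f where v: "y n = V8 a b c 0 d f 0 0"
    using hmap4_shape(4)[OF z, of "int j + 1"] k4 n 5 by (auto simp: y_def algebra_simps)
  have b: "h_lab (8 * j + 5) \<in> Mk_basis k" "h_lab (8 * j + 6) \<in> Mk_basis k" "h_lab (8 * j + 7) \<in> Mk_basis k"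
    "h_lab (8 * j + 8) \<in> Mk_basis k" "h_lab (8 * j + 9) \<in> Mk_basis k"
    using h_in_basis_3[OF 5(2)] by simp_all
  then show ?thesis unfolding v
    by (simp add: 5(1) lab_simps act_v8_elt q_h_3[OF 5(2)] lift_bscale_sums lift_lab_simps(16-20)[OF 5(2)]
        bscale_single_vec single_vec_add del: One_nat_def)
      (auto simp: bscale_sel intro!: ext v8.expand)
qed

end

section \<open>The defining relations of M_k\<close>

lemma dmap_unit_vec:
  "dmap k s (unit_vec (8 * i + 2)) (8 * i + 1) = (if gen k s (8 * i + 1) then V8 0 0 1 0 0 0 0 0 else 0)"
  "dmap k s (unit_vec (8 * i + 3)) (8 * i + 1) = (if gen k s (8 * i + 1) then V8 0 0 0 0 1 0 0 0 else 0)"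
  "dmap k s (unit_vec (8 * i + 3)) (8 * i + 3) = (if gen k s (8 * i + 3) then V8 0 1 0 0 0 0 0 0 else 0)"
  "dmap k s (unit_vec (8 * i + 3)) (8 * i - 1) = (if gen k s (8 * i - 1) then V8 0 0 0 0 0 0 1 0 else 0)"
  "dmap k s (unit_vec (8 * i + 4)) (8 * i + 3) = (if gen k s (8 * i + 3) then V8 0 0 1 0 0 0 0 0 else 0)"
  "dmap k s (unit_vec (8 * i + 5)) (8 * i + 4) = (if gen k s (8 * i + 4) then V8 0 0 1 0 0 0 0 0 else 0)"
  "dmap k s (unit_vec (8 * i + 5)) (8 * i + 3) = (if gen k s (8 * i + 3) then V8 0 0 0 1 0 0 0 0 else 0)"
  "dmap k s (unit_vec (8 * i + 5)) (8 * i + 1) = 0"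
  "dmap k s (unit_vec (8 * i + 7)) (8 * i + 7) = (if gen k s (8 * i + 7) then V8 0 1 0 0 0 0 0 0 else 0)"
  "dmap k s (unit_vec (8 * i + 7)) (8 * i + 5) = (if gen k s (8 * i + 5) then V8 0 0 0 1 0 0 0 0 else 0)"
  "dmap k s (unit_vec (8 * i + 7)) (8 * i + 3) = (if gen k s (8 * i + 3) then V8 0 0 0 0 0 0 1 0 else 0)"
  by (simp_all only: dmap_simps dmap_simps_neg)
    (simp_all add: unit_vec_def rmul_defs zero_v8_def plus_v8_def del: gen_simps)

lemma gen5E:
  assumes "gen (int k) 5 n" "4 \<le> k"
  obtains "n = 10" | "n = 11" | j where "n = 8 * int j + 19" "4 * j + 8 \<le> k" | j where "n = 8 * int j + 12" "k = 4 * j + 5"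
  | j where "n = 8 * int j + 13" "k = 4 * j + 6" | j where "n = 8 * int j + 15" "4 * j + 7 \<le> k"
proof (rule stem_cases[of n])
  fix i assume n: "n = 8 * i + 1" then show thesis using assms by simp presburger
next
  fix i assume n: "n = 8 * i + 2" then show thesis using assms that(1) by simp
next
  fix i assume n: "n = 8 * i + 3"
  show thesis
  proof (cases "i = 1")
    case False
    then have "n = 8 * int (nat (i - 2)) + 19" "4 * nat (i - 2) + 8 \<le> k" using assms n by auto
    then show thesis by (rule that(3))
  qed (use n that(2) in simp)
next
  fix i assume n: "n = 8 * i + 4"
  then have "n = 8 * int (nat (i - 1)) + 12" "k = 4 * nat (i - 1) + 5" using assms by auto
  then show thesis by (rule that(4))
next
  fix i assume n: "n = 8 * i + 5"
  then have "n = 8 * int (nat (i - 1)) + 13" "k = 4 * nat (i - 1) + 6" using assms by auto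
  then show thesis by (rule that(5))
next
  fix i assume n: "n = 8 * i + 7"
  then have "n = 8 * int (nat (i - 1)) + 15" "4 * nat (i - 1) + 7 \<le> k" using assms by auto
  then show thesis by (rule that(6))
qed (use assms in simp_all)

text \<open>The differential of a generator in stem \<open>n\<close> meets at most these four
  stems.\<close>

lemma sum_four:
  fixes f :: "int \<Rightarrow> 'a::ab_group_add"
  assumes "finite G" "\<And>m. m \<in> G \<Longrightarrow> m \<notin> {n, n - 1, n - 2, n - 4} \<Longrightarrow> f m = 0"
  defines "g \<equiv> \<lambda>m. if m \<in> G then f m else 0"
  shows "sum f G = g n + g (n - 1) + g (n - 2) + g (n - 4)"
proof -
  have "sum f G = sum g (G \<inter> {n, n - 1, n - 2, n - 4})"
    using assms by (intro sum.mono_neutral_cong_right) auto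
  also have "\<dots> = sum g {n, n - 1, n - 2, n - 4}"
    by (intro sum.mono_neutral_left) (auto simp: g_def)
  finally show ?thesis by (simp add: add.assoc)
qed

context Mk_module
begin

text \<open>Consequently \<open>eps\<close> is injective on the image of \<open>hmap\<close> in
  degree 4.\<close>

lemma lift_eps_boundary:
  assumes z: "\<forall>n. \<not> gen (int k) 3 n \<longrightarrow> z n = 0"
  defines "y \<equiv> hmap (int k) 4 z"
  shows "lift (eps y) = y"
proof -
  have "lift (eps y) = (\<Sum>n\<in>G0. lift (act N (v8_elt (y n)) (e (lab n))))"
    unfolding eps_def free_map_def by (intro lift_total_sum act_total v8_elt_in_A1 e_lab_total)
  also have "\<dots> = (\<Sum>n\<in>G0. single_vec n (y n))"
    using lift_eps_hmap[OF z] by (intro sum.cong) (auto simp: y_def)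
  also have "\<dots> = y"
  proof
    fix m
    have "(\<Sum>n\<in>G0. single_vec n (y n)) m = (\<Sum>n\<in>G0. if m = n then y n else 0)"
      by (simp only: sum_fun_apply)
    also have "\<dots> = y m" using finite_G0 hmap_outside[of "int k" 4 m z] by (auto simp: y_def)
    finally show "(\<Sum>n\<in>G0. single_vec n (y n)) m = y m" .
  qed
  finally show ?thesis .
qed

lemma eps_dmap_unit_vec:
  fixes n :: int
  defines "z \<equiv> dmap (int k) 4 (unit_vec n)"
  defines "U \<equiv> \<lambda>m. if gen (int k) 4 m then act N (v8_elt (z m)) (e (lab m)) else 0"
  shows "eps z = U n + U (n - 1) + U (n - 2) + U (n - 4)"
proof -
  have "act N (v8_elt (z m)) (e (lab m)) = 0" if "m \<in> G0" "m \<notin> {n, n - 1, n - 2, n - 4}" for m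
  proof -
    have "z m = 0" using that(2) by (auto simp: z_def dmap_def Let_def unit_vec_def rmul_defs zero_v8_def[symmetric])
    then show ?thesis using e_lab_total[OF that(1)] by (simp add: act_zero)
  qed
  then show ?thesis
    unfolding eps_def free_map_def U_def
    by (subst sum_four[OF finite_G0]) simp_all
qed

text \<open>Each generator of degree 5 becomes a relation of the module: Sq2 g_1 = 0 in stem 10, Sq2
  Sq1 g_1 = Sq1 g_3 in stem 11, Sq2 Sq1 Sq2 g_(8j+7) = Sq1 g_(8j+11) in stem 8j + 19. A term drops
  out when its generator is missing.\<close>

lemma eps_dmap_unit:
  assumes "gen (int k) 5 n" shows "eps (dmap (int k) 4 (unit_vec n)) = 0"
  using assms k4
proof (cases rule: gen5E)
  case 1
  have "dmap (int k) 4 (unit_vec 10) 9 = V8 0 0 1 0 0 0 0 0" using dmap_unit_vec(1)[of "int k" 4 1] by (simp add: gen_9)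
  moreover have "\<not> gen (int k) 4 10" "\<not> gen (int k) 4 8" "\<not> gen (int k) 4 6" by (simp_all add: gen_def)
  ultimately show ?thesis using in_basis(1)
    by (simp add: eps_dmap_unit_vec 1 gen_9 lab_simps act_v8_elt e_total q_g_low del: One_nat_def)
next
  case 2
  have z: "dmap (int k) 4 (unit_vec 11) 9 = V8 0 0 0 0 1 0 0 0"
    "gen (int k) 4 11 \<Longrightarrow> dmap (int k) 4 (unit_vec 11) 11 = V8 0 1 0 0 0 0 0 0"
    using dmap_unit_vec(2,3)[of "int k" 4 1] by (simp_all add: gen_9)
  have g: "\<not> gen (int k) 4 10" "\<not> gen (int k) 4 7" "gen (int k) 4 11 \<longleftrightarrow> 5 \<le> k" by (simp_all add: gen_def)
  have l: "lab 11 = g_lab 3" using lab_simps(2)[of 0] by simp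
  have q: "5 \<le> k \<Longrightarrow> q1 (e (g_lab 3)) = e (g_lab 4)" using q_g(1)[of 0] by simp
  have b: "g_lab 3 \<in> Mk_basis k \<longleftrightarrow> 5 \<le> k" using in_basis(5)[of 0] by simp
  show ?thesis
  proof (cases "k = 4")
    case True
    then have "\<not> gen (int k) 4 11" "q2 (e (g_lab 2)) = 0" using g(3) q_g_low(3) by simp_all
    then show ?thesis using in_basis(1) z(1) g(1,2)
      by (simp add: eps_dmap_unit_vec 2 gen_9 lab_simps act_v8_elt e_total q_g_low(1) del: One_nat_def)
  next
    case False
    then have "5 \<le> k" using k4 by simp
    then show ?thesis using in_basis(1,3) z g False q b
      by (simp add: eps_dmap_unit_vec 2 gen_9 lab_simps l act_v8_elt e_total q_g_low add_self del: One_nat_def)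
  qed
next
  case (3 j)
  have n: "n = 8 * (int j + 2) + 3" using 3 by simp
  have m: "n - 1 = 8 * (int j + 2) + 2" "n - 2 = 8 * (int j + 2) + 1" "n - 4 = 8 * (int j + 2) - 1" using n by simp_all
  have g: "gen (int k) 4 n \<longleftrightarrow> 4 * j + 9 \<le> k" "\<not> gen (int k) 4 (n - 1)" "\<not> gen (int k) 4 (n - 2)" "gen (int k) 4 (n - 4)"
    unfolding m unfolding n using 3(2) by (simp_all only: gen_simps not_False_eq_True) presburger+
  have z: "gen (int k) 4 n \<Longrightarrow> dmap (int k) 4 (unit_vec n) n = V8 0 1 0 0 0 0 0 0"
    "dmap (int k) 4 (unit_vec n) (n - 4) = V8 0 0 0 0 0 0 1 0"
    using g(4) unfolding m unfolding n by (simp_all only: dmap_unit_vec if_True)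
  have l: "lab n = g_lab (8 * Suc j + 3)" "lab (n - 4) = g_lab (8 * j + 7)"
    using lab_simps(2)[of "Suc j"] lab_simps(3)[of j] 3(1) by (simp_all add: add.commute)
  have b: "g_lab (8 * j + 7) \<in> Mk_basis k" using in_basis 3 by simp
  show ?thesis
  proof (cases "k = 4 * j + 8")
    case True
    have q: "q2 (e (g_lab (8 * j + 10))) = 0" using q_g(9)[OF 3(2)] True by simp
    have "\<not> gen (int k) 4 n" using g(1) True by simp
    then show ?thesis using g(2-4) z(2)
      by (simp add: eps_dmap_unit_vec l act_v8_elt e_total b q q_g(6-8)[OF 3(2)] del: One_nat_def)
  next
    case False
    then have le: "4 * j + 9 \<le> k" using 3(2) by simp
    have q: "q2 (e (g_lab (8 * j + 10))) = e (g_lab (8 * j + 12))" using q_g(9)[OF 3(2)] False by simp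
    have q': "q1 (e (g_lab (8 * Suc j + 3))) = e (g_lab (8 * j + 12))" using q_g(1)[of "Suc j"] le by (simp add: add.commute)
    have b': "g_lab (8 * Suc j + 3) \<in> Mk_basis k" "g_lab (8 * j + 12) \<in> Mk_basis k"
      using in_basis(5)[of "Suc j"] in_basis(12)[of j] le by simp_all
    show ?thesis using g z 3(2) le
      by (simp add: eps_dmap_unit_vec l act_v8_elt e_total b b' q q' q_g(6-8) add_self
          del: One_nat_def mult_Suc_right)
  qed
next
  \<comment> \<open>This relation exists only for \<open>k = 4 * j + 5\<close>, where the module
    stops: Sq2 g_(8j+3) = 0.\<close>
  case (4 j)
  have n: "n = 8 * (int j + 1) + 4" using 4 by simp
  have m: "n - 1 = 8 * (int j + 1) + 3" "n - 2 = 8 * (int j + 1) + 2" "n - 4 = 8 * (int j + 1)" using n by simp_all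
  have g: "\<not> gen (int k) 4 n" "gen (int k) 4 (n - 1)" "\<not> gen (int k) 4 (n - 2)" "\<not> gen (int k) 4 (n - 4)"
    unfolding m unfolding n using 4(2) by (simp_all only: gen_simps not_False_eq_True) presburger+
  have z: "dmap (int k) 4 (unit_vec n) (n - 1) = V8 0 0 1 0 0 0 0 0"
    using g(2) unfolding m unfolding n by (simp_all only: dmap_unit_vec if_True)
  have l: "lab (n - 1) = g_lab (8 * j + 3)" using lab_simps(2)[of j] 4(1) by (simp_all add: add.commute)
  have b: "g_lab (8 * j + 3) \<in> Mk_basis k" using in_basis 4 by simp
  show ?thesis using g z by (simp add: eps_dmap_unit_vec l act_v8_elt e_total b q_g(3)[OF 4(2)] del: One_nat_def)
next
  \<comment> \<open>Here g_(8j+6) is both Sq1 Sq2 g_(8j+3) and Sq2 h_(8j+4).\<close>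
  case (5 j)
  have n: "n = 8 * (int j + 1) + 5" using 5 by simp
  have m: "n - 1 = 8 * (int j + 1) + 4" "n - 2 = 8 * (int j + 1) + 3" "n - 4 = 8 * (int j + 1) + 1" using n by simp_all
  have g: "\<not> gen (int k) 4 n" "gen (int k) 4 (n - 1)" "gen (int k) 4 (n - 2)"
    unfolding m unfolding n using 5(2) by (simp_all only: gen_simps not_False_eq_True) presburger+
  have z: "dmap (int k) 4 (unit_vec n) (n - 1) = V8 0 0 1 0 0 0 0 0" "dmap (int k) 4 (unit_vec n) (n - 2) = V8 0 0 0 1 0 0 0 0"
    using g(2,3) unfolding m unfolding n by (simp_all only: dmap_unit_vec if_True)
  have "dmap (int k) 4 (unit_vec n) (n - 4) = 0" unfolding m unfolding n by (rule dmap_unit_vec)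
  then have zero: "gen (int k) 4 (n - 4) \<Longrightarrow> act N (v8_elt (dmap (int k) 4 (unit_vec n) (n - 4))) (e (lab (n - 4))) = 0"
    using e_lab_total[of "n - 4"] by (simp add: act_zero)
  have l: "lab (n - 1) = h_lab (8 * j + 4)" "lab (n - 2) = g_lab (8 * j + 3)"
    using lab_simps(2)[of j] lab_simps(4)[of j] 5(1) by (simp_all add: add.commute)
  have b: "g_lab (8 * j + 3) \<in> Mk_basis k" "h_lab (8 * j + 4) \<in> Mk_basis k" "g_lab (8 * j + 6) \<in> Mk_basis k"
    using in_basis h_in_basis_2[OF 5(2)] 5(2) by simp_all
  have le: "4 * j + 6 \<le> k" using 5 by simp
  show ?thesis using g z zero
    by (simp add: eps_dmap_unit_vec l act_v8_elt e_total b q_g(2,4)[OF le] q_h_2[OF 5(2)] add_self del: One_nat_def)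
next
  \<comment> \<open>Here g_(8j+8) is Sq2 Sq1 Sq2 g_(8j+3), and also Sq1 g_(8j+7) or, for
    \<open>k = 4 * j + 7\<close>, Sq1 Sq2 h_(8j+5).\<close>
  case (6 j)
  have n: "n = 8 * (int j + 1) + 7" using 6 by simp
  have m: "n - 1 = 8 * (int j + 1) + 6" "n - 2 = 8 * (int j + 1) + 5" "n - 4 = 8 * (int j + 1) + 3" using n by simp_all
  have g: "gen (int k) 4 n \<longleftrightarrow> 4 * j + 8 \<le> k" "\<not> gen (int k) 4 (n - 1)" "gen (int k) 4 (n - 2) \<longleftrightarrow> k = 4 * j + 7" "gen (int k) 4 (n - 4)"
    unfolding m unfolding n using 6(2) by (simp_all only: gen_simps not_False_eq_True) presburger+
  have z: "gen (int k) 4 n \<Longrightarrow> dmap (int k) 4 (unit_vec n) n = V8 0 1 0 0 0 0 0 0"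
    "gen (int k) 4 (n - 2) \<Longrightarrow> dmap (int k) 4 (unit_vec n) (n - 2) = V8 0 0 0 1 0 0 0 0"
    "dmap (int k) 4 (unit_vec n) (n - 4) = V8 0 0 0 0 0 0 1 0"
    using g(4) unfolding m unfolding n by (simp_all only: dmap_unit_vec if_True)
  have l: "lab n = g_lab (8 * j + 7)" "lab (n - 2) = h_lab (8 * j + 5)" "lab (n - 4) = g_lab (8 * j + 3)"
    using lab_simps(2,3,5)[of j] 6(1) by (simp_all add: add.commute)
  have b: "g_lab (8 * j + 3) \<in> Mk_basis k" "g_lab (8 * j + 8) \<in> Mk_basis k" using in_basis 6(2) by simp_all
  have le: "4 * j + 6 \<le> k" using 6 by simp
  have q: "q2 (e (g_lab (8 * j + 6))) = e (g_lab (8 * j + 8))" using q_g(5)[OF le] 6(2) by simp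
  show ?thesis
  proof (cases "k = 4 * j + 7")
    case True
    then have g': "\<not> gen (int k) 4 n" "gen (int k) 4 (n - 2)" using g by simp_all
    have "h_lab (8 * j + 5) \<in> Mk_basis k" using h_in_basis_3[OF True] by simp
    then show ?thesis using g(2,4) g' z
      by (simp add: eps_dmap_unit_vec l act_v8_elt e_total b q q_g(2,4)[OF le] q_h_3[OF True] add_self del: One_nat_def)
  next
    case False
    then have le': "4 * j + 8 \<le> k" using 6 by simp
    then have g': "gen (int k) 4 n" "\<not> gen (int k) 4 (n - 2)" using g False by simp_all
    have "g_lab (8 * j + 7) \<in> Mk_basis k" using in_basis(8)[of j] le' by simp
    then show ?thesis using g(2,4) g' z
      by (simp add: eps_dmap_unit_vec l act_v8_elt e_total b q q_g(2,4)[OF le] q_g(6)[OF le'] add_self del: One_nat_def)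
  qed
qed

lemma eps_dmap:
  assumes x: "\<forall>n. \<not> gen (int k) 5 n \<longrightarrow> x n = 0" shows "eps (dmap (int k) 4 x) = 0"
proof -
  let ?G = "{n. gen (int k) 5 n}" and ?g = "\<lambda>x. eps (dmap (int k) 4 x)"
  let ?f = "\<lambda>n. act (free_mod ?G (\<lambda>n. n)) (v8_elt (x n)) (unit_vec n)"
  have add: "?g (u + v) = ?g u + ?g v" for u v by (simp add: dmap_add eps_add)
  have zero: "?g 0 = 0" using add[of 0 0] by simp
  have "?g (sum ?f I) = 0" if "I \<subseteq> ?G" for I
    using that
  proof (induction I rule: infinite_finite_induct)
    case (insert n I)
    have "?f n = act F0 (v8_elt (x n)) (unit_vec n)" by (simp add: act_free)
    then have "dmap (int k) 4 (?f n) = act F0 (v8_elt (x n)) (dmap (int k) 4 (unit_vec n))"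
      by (auto simp: act_free dmap_st_act v8_elt_in_A1)
    then have "?g (?f n) = 0" using insert.prems by (simp add: eps_act v8_elt_in_A1 eps_dmap_unit act_zero_right)
    then show ?case unfolding sum.insert[OF insert.hyps] add using insert by simp
  qed (use zero in \<open>simp_all only: sum.infinite sum.empty not_False_eq_True\<close>)
  from this[OF order_refl] have "?g (sum ?f ?G) = 0" .
  moreover have "x = sum ?f ?G" using x by (intro free_expand finite_gen) auto
  ultimately show ?thesis by (rule ssubst[where P = "\<lambda>x. ?g x = 0", rotated])
qed

text \<open>The homotopy splits \<open>x\<close> into a boundary and \<open>y\<close>. Boundaries
  lie in the kernel of \<open>eps\<close>, hence so does \<open>y\<close>; but \<open>y\<close> is
  the lift of \<open>eps y\<close>, so it is zero.\<close>

lemma eps_exact: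
  assumes x: "\<forall>n. \<not> gen (int k) 4 n \<longrightarrow> x n = 0" and eps: "eps x = 0"
  shows "dmap (int k) 4 (hmap (int k) 5 x) = x"
proof -
  define y where "y = hmap (int k) 4 (dmap (int k) 3 x)"
  have eq: "dmap (int k) 4 (hmap (int k) 5 x) + y = x" using homotopy[OF _ x] k4 by (simp add: y_def)
  have "eps (dmap (int k) 4 (hmap (int k) 5 x)) = 0" using hmap_outside by (intro eps_dmap) simp
  then have "eps y = 0" using eps arg_cong[OF eq, of eps] by (simp add: eps_add)
  moreover have "lift (eps y) = y" unfolding y_def by (rule lift_eps_boundary) (simp add: dmap_outside)
  ultimately have "y = 0" by simp
  then show ?thesis using eq by simp
qed

section \<open>The minimal resolution of M_k and its chart\<close>

lemma total_gen: "total (free_mod {n. gen (int k) s n} dg) = {x. \<forall>n. \<not> gen (int k) s n \<longrightarrow> x n = 0}"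
  by (subst total_free) (simp_all add: finite_gen)

lemma piece_genD:
  assumes "x \<in> piece (free_mod {n. gen (int k) s n} dg) t" shows "x n \<in> v8_piece (t - dg n)"
  using free_pieceD[OF assms, of n] by (cases "gen (int k) s n") auto

text \<open>The number \<open>c\<close> is the resolution degree; a generator in stem
  \<open>n - 8\<close> of the chart has internal degree \<open>c + n - 8\<close>.\<close>

lemma gmap_dmap:
  "gmap (free_mod {n. gen (int k) (s + 1) n} (\<lambda>n. c + 1 + n - 8)) (free_mod {n. gen (int k) s n} (\<lambda>n. c + n - 8)) (dmap (int k) s)"
  unfolding gmap_def
proof (intro conjI ballI allI)
  fix t x assume "x \<in> piece (free_mod {n. gen (int k) (s + 1) n} (\<lambda>n. c + 1 + n - 8)) t"
  from piece_genD[OF this] have "dmap (int k) s x n \<in> v8_piece (t - c + 8 - n)" for n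
    by (intro dmap_piece) (simp add: algebra_simps)
  then show "dmap (int k) s x \<in> piece (free_mod {n. gen (int k) s n} (\<lambda>n. c + n - 8)) t"
    by (simp add: free_mod_def dmap_outside algebra_simps)
qed (rule dmap_add)

lemma gmap_hmap:
  "gmap (free_mod {n. gen (int k) s n} (\<lambda>n. c + n - 8)) (free_mod {n. gen (int k) (s + 1) n} (\<lambda>n. c + 1 + n - 8)) (hmap (int k) (s + 1))"
  unfolding gmap_def
proof (intro conjI ballI allI)
  fix t x assume "x \<in> piece (free_mod {n. gen (int k) s n} (\<lambda>n. c + n - 8)) t"
  from piece_genD[OF this] have "hmap (int k) (s + 1) x n \<in> v8_piece (t - c + 7 - n)" for n
    by (intro hmap_piece) (simp add: algebra_simps)
  then show "hmap (int k) (s + 1) x \<in> piece (free_mod {n. gen (int k) (s + 1) n} (\<lambda>n. c + 1 + n - 8)) t"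
    by (simp add: free_mod_def hmap_outside algebra_simps)
qed (rule hmap_add)

lemma resolution_Mk:
  "resolution N (\<lambda>q. {n. gen (int k) (int q + 4) n}) (\<lambda>q n. int q + n - 8) eps lift
     (\<lambda>q. dmap (int k) (int q + 4)) (\<lambda>q. hmap (int k) (int q + 5))"
proof (intro resolution.intro resolution_axioms.intro cover.intro)
  have ik: "4 \<le> int k" using k4 by simp
  have ix: "int (Suc q) = int q + 1" "int q + 5 = int q + 4 + 1" "int q + 1 + 4 = int q + 4 + 1"
    "int q + 1 + 1 + 4 = int q + 4 + 2" "int q + 1 + 5 = int q + 4 + 1 + 1" for q by simp_all
  show "gmodule N" by (rule gmodule_axioms)
  have fin: "finite {n. gen (int k) s n}" for s by (rule finite_gen) simp
  show "finite {n. gen (int k) (int 0 + 4) n}" by (rule fin)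
  show "finite {n. gen (int k) (int q + 4) n}" for q by (rule fin)
  show "gmap (free_mod {n. gen (int k) (int 0 + 4) n} (\<lambda>n. int 0 + n - 8)) N eps" using gmap_eps by simp
  show "gmap N (free_mod {n. gen (int k) (int 0 + 4) n} (\<lambda>n. int 0 + n - 8)) lift" using gmap_lift by simp
  show "eps (act (free_mod {n. gen (int k) (int 0 + 4) n} (\<lambda>n. int 0 + n - 8)) a x) = act N a (eps x)" if "a \<in> A1" for a x
    using eps_act[OF that] by simp
  show "eps (lift m) = m" if "m \<in> total N" for m using that by (rule eps_lift)
  have exact_0: "dmap (int k) (int 0 + 4) (hmap (int k) (int 0 + 5) x) = x"
    if "x \<in> total (free_mod {n. gen (int k) (int 0 + 4) n} (\<lambda>n. int 0 + n - 8))" "eps x = 0" for x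
    using that eps_exact[of x] by (simp add: total_gen)
  then show "dmap (int k) (int 0 + 4) (hmap (int k) (int 0 + 5) x) = x"
    if "x \<in> total (free_mod {n. gen (int k) (int 0 + 4) n} (\<lambda>n. int 0 + n - 8))" "eps x = 0" for x using that by blast
  show "c0 (x n) = 0"
    if "x \<in> total (free_mod {n. gen (int k) (int 0 + 4) n} (\<lambda>n. int 0 + n - 8))" "eps x = 0" for x n
    using exact_0[OF that] c0_dmap by metis
  show "gmap (free_mod {n. gen (int k) (int (Suc q) + 4) n} (\<lambda>n. int (Suc q) + n - 8))
     (free_mod {n. gen (int k) (int q + 4) n} (\<lambda>n. int q + n - 8)) (dmap (int k) (int q + 4))" for q
    unfolding ix by (rule gmap_dmap)
  show "gmap (free_mod {n. gen (int k) (int q + 4) n} (\<lambda>n. int q + n - 8))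
     (free_mod {n. gen (int k) (int (Suc q) + 4) n} (\<lambda>n. int (Suc q) + n - 8)) (hmap (int k) (int q + 5))" for q
    unfolding ix by (rule gmap_hmap)
  show "dmap (int k) (int q + 4) (\<lambda>n. st_act a (x n)) n = st_act a (dmap (int k) (int q + 4) x n)" if "a \<in> A1" for q a x n
    using that by (rule dmap_st_act)
  show "eps (dmap (int k) (int 0 + 4) x) = 0"
    if "x \<in> total (free_mod {n. gen (int k) (int 1 + 4) n} (\<lambda>n. int 1 + n - 8))" for x
    using that eps_dmap[of x] by (simp add: total_gen)
  show "dmap (int k) (int q + 4) (dmap (int k) (int (Suc q) + 4) x) = 0"
    if "x \<in> total (free_mod {n. gen (int k) (int (Suc (Suc q)) + 4) n} (\<lambda>n. int (Suc (Suc q)) + n - 8))" for q x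
    using that dmap_dmap[OF _ ik, of "int q + 4" x] unfolding total_gen ix by auto
  show "dmap (int k) (int (Suc q) + 4) (hmap (int k) (int (Suc q) + 5) x) = x"
    if "x \<in> total (free_mod {n. gen (int k) (int (Suc q) + 4) n} (\<lambda>n. int (Suc q) + n - 8))"
      "dmap (int k) (int q + 4) x = 0" for q x
  proof -
    have "hmap (int k) s 0 = 0" for s using hmap_add[of "int k" s 0 0] by simp
    then show ?thesis using that homotopy[OF ik, of "int q + 4 + 1" x] unfolding total_gen ix by (simp add: add.commute)
  qed
  show "c0 (dmap (int k) (int q + 4) x n) = 0" for q x n by (rule c0_dmap)
qed

text \<open>Internal degree \<open>s + n\<close> singles out stem \<open>n + 8\<close> of the
  complex.\<close>

lemma stem_zero_gen:
  assumes "\<And>s. 0 \<le> s \<Longrightarrow> \<not> gen (int k) (s + 4) (int n + 8)" shows "stem_zero N n"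
proof (rule stem_zeroI, rule resolution.ext_trivial_resolution[OF resolution_Mk], rule notI)
  fix s m assume "m \<in> {n. gen (int k) (int s + 4) n}" "int s + m - 8 = int s + int n"
  moreover from this(2) have "m = int n + 8" by simp
  ultimately show False using assms[of "int s"] by simp
qed

text \<open>An interval of generators gives the dots, and the Sq1 entries between them give the
  vertical segments; for \<open>d \<le> 1\<close> there are no segments.\<close>

lemma stem_cyclic_gen:
  assumes gen: "\<And>s::nat. gen (int k) (int s + 4) (int n + 8) \<longleftrightarrow> f \<le> s \<and> s < f + d"
    and h0: "d \<le> 1 \<or> (\<forall>s. gen (int k) s (int n + 8) \<longrightarrow> c1 (dmap (int k) s (unit_vec (int n + 8)) (int n + 8)) = 1)"
  shows "stem_cyclic N n d f"
proof (rule stem_cyclicI)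
  fix s
  have t: "int s + int n = int s + (int n + 8) - 8" by simp
  show "ext_trivial s (int s + int n) N" if "\<not> (f \<le> s \<and> s < f + d)"
  proof (rule resolution.ext_trivial_resolution[OF resolution_Mk], rule notI)
    fix m assume "m \<in> {n. gen (int k) (int s + 4) n}" "int s + m - 8 = int s + int n"
    moreover from this(2) have "m = int n + 8" by simp
    ultimately show False using that gen[of s] by simp
  qed
  show "ext_one_dim s (int s + int n) N" if "f \<le> s" "s < f + d"
    unfolding t using that gen[of s] by (intro resolution.ext_one_dim_resolution[OF resolution_Mk]) auto
  show "ext_h0_inj s (int s + int n) N" if "f \<le> s" "Suc s < f + d"
  proof -
    have g: "gen (int k) (int s + 4) (int n + 8)" "gen (int k) (int (Suc s) + 4) (int n + 8)"
      unfolding gen using that by simp_all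
    then have "c1 (dmap (int k) (int s + 4) (unit_vec (int n + 8)) (int n + 8)) = 1" using h0 that by auto
    then show ?thesis unfolding t
      using g by (intro resolution.ext_h0_inj_resolution[OF resolution_Mk, where m = "int n + 8"]) auto
  qed
qed

end

theorem mainTheorem2:
  fixes k :: nat and M N :: "'m::ab_group_add gmod"
  assumes "k \<ge> 4" and "is_Mk k M" and "N = suspension (- (2 ^ k)) M"
  shows "\<forall>i::nat.
    stem_zero N (8*i+6) \<and> stem_zero N (8*i+8) \<and>
    stem_cyclic N (8*i+1) 1 (4*i) \<and> stem_cyclic N (8*i+2) 1 (4*i+1) \<and>
    (if k \<le> 4*i+6 then stem_cyclic N (8*i+4) 1 (4*i+6-k) else stem_zero N (8*i+4)) \<and>
    (if k \<le> 4*i+7 then stem_cyclic N (8*i+5) 1 (4*i+7-k) else stem_zero N (8*i+5)) \<and>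
    (if k \<le> 4*i+8 then stem_cyclic N (8*i+7) (k-4) (4*i+8-k)
     else stem_cyclic N (8*i+7) (4*i+4) 0) \<and>
    (if k \<le> 4*i+5 then stem_cyclic N (8*i+3) (k-2) (4*i+5-k)
     else stem_cyclic N (8*i+3) (4*i+3) 0)"
proof
  fix i :: nat
  have "gmodule M" using assms(2) by (simp add: is_Mk_def gmodule_def)
  then have N: "gmodule N" unfolding assms(3) by (rule gmodule.gmodule_suspension)
  obtain e :: "label \<Rightarrow> 'm" where
    "\<forall>n. piece N n = {(\<Sum>x\<in>S. e x) | S. S \<subseteq> {x \<in> Mk_basis k. int (label_deg x) = n}}"
    "\<forall>S \<subseteq> Mk_basis k. (\<Sum>x\<in>S. e x) = 0 \<longrightarrow> S = {}"
    "\<forall>x \<in> Mk_basis k. act N (Sq 1) (e x) = (\<Sum>y \<in> Mk_Sq1 k `` {x}. e y)"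
    "\<forall>x \<in> Mk_basis k. act N (Sq 2) (e x) = (\<Sum>y \<in> Mk_Sq2 k `` {x}. e y)"
    using assms(2) unfolding is_Mk_def has_Mk_form_def assms(3) by blast
  then interpret Mk_module N k e
    using N assms(1) by (intro Mk_module.intro Mk_module_axioms.intro) blast+
  have n: "int (8 * i + 1) + 8 = 8 * int i + 9" "int (8 * i + 2) + 8 = 8 * int i + 10" "int (8 * i + 3) + 8 = 8 * int i + 11"
    "int (8 * i + 4) + 8 = 8 * int i + 12" "int (8 * i + 5) + 8 = 8 * int i + 13" "int (8 * i + 6) + 8 = 8 * (int i + 1) + 6"
    "int (8 * i + 7) + 8 = 8 * int i + 15" "int (8 * i + 8) + 8 = 8 * (int i + 2)" by simp_all
  \<comment> \<open>In stems 3 and 7 modulo 8 the diagonal entries of the differential are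
    Sq1.\<close>
  have h3: "\<forall>s. gen (int k) s (8 * int i + 11) \<longrightarrow> c1 (dmap (int k) s (unit_vec (8 * int i + 11)) (8 * int i + 11)) = 1"
    using dmap_unit_vec(3)[of "int k" _ "int i + 1"] by (simp add: algebra_simps)
  have h7: "\<forall>s. gen (int k) s (8 * int i + 15) \<longrightarrow> c1 (dmap (int k) s (unit_vec (8 * int i + 15)) (8 * int i + 15)) = 1"
    using dmap_unit_vec(9)[of "int k" _ "int i + 1"] by (simp add: algebra_simps)
  \<comment> \<open>The filtrations claimed involve truncated subtraction; in this additive form
    both branches of the conditionals are plain arithmetic.\<close>
  have e3: "gen (int k) (int s + 4) (8 * int i + 11) \<longleftrightarrow> 4 * i + 5 \<le> s + k \<and> s \<le> 4 * i + 2" for s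
    unfolding gen_simps by linarith
  have e7: "gen (int k) (int s + 4) (8 * int i + 15) \<longleftrightarrow> 4 * i + 8 \<le> s + k \<and> s \<le> 4 * i + 3" for s
    unfolding gen_simps by linarith
  have "stem_zero N (8*i+6)" "stem_zero N (8*i+8)"
    by (rule stem_zero_gen, unfold n, rule gen_simps)+
  moreover have "stem_cyclic N (8*i+1) 1 (4*i)" "stem_cyclic N (8*i+2) 1 (4*i+1)"
    by (rule stem_cyclic_gen; unfold n gen_simps; auto)+
  moreover have "stem_cyclic N (8*i+4) 1 (4*i+6-k)" if "k \<le> 4*i+6"
    using that by (intro stem_cyclic_gen; unfold n gen_simps; auto)
  moreover have "stem_cyclic N (8*i+5) 1 (4*i+7-k)" if "k \<le> 4*i+7"
    using that by (intro stem_cyclic_gen; unfold n gen_simps; auto)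
  moreover have "stem_zero N (8*i+4)" if "\<not> k \<le> 4*i+6"
    using that by (intro stem_zero_gen; unfold n gen_simps; simp)
  moreover have "stem_zero N (8*i+5)" if "\<not> k \<le> 4*i+7"
    using that by (intro stem_zero_gen; unfold n gen_simps; simp)
  moreover have "stem_cyclic N (8*i+7) (k-4) (4*i+8-k)" if "k \<le> 4*i+8"
    by (rule stem_cyclic_gen; (rule disjI2)?; unfold n; (rule h7)?) (use that k4 in \<open>simp only: e7; auto\<close>)
  moreover have "stem_cyclic N (8*i+7) (4*i+4) 0" if "\<not> k \<le> 4*i+8"
    by (rule stem_cyclic_gen; (rule disjI2)?; unfold n; (rule h7)?) (use that k4 in \<open>simp only: e7; auto\<close>)
  moreover have "stem_cyclic N (8*i+3) (k-2) (4*i+5-k)" if "k \<le> 4*i+5"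
    by (rule stem_cyclic_gen; (rule disjI2)?; unfold n; (rule h3)?) (use that k4 in \<open>simp only: e3; auto\<close>)
  moreover have "stem_cyclic N (8*i+3) (4*i+3) 0" if "\<not> k \<le> 4*i+5"
    by (rule stem_cyclic_gen; (rule disjI2)?; unfold n; (rule h3)?) (use that k4 in \<open>simp only: e3; auto\<close>)
  ultimately show "stem_zero N (8*i+6) \<and> stem_zero N (8*i+8) \<and>
    stem_cyclic N (8*i+1) 1 (4*i) \<and> stem_cyclic N (8*i+2) 1 (4*i+1) \<and>
    (if k \<le> 4*i+6 then stem_cyclic N (8*i+4) 1 (4*i+6-k) else stem_zero N (8*i+4)) \<and>
    (if k \<le> 4*i+7 then stem_cyclic N (8*i+5) 1 (4*i+7-k) else stem_zero N (8*i+5)) \<and>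
    (if k \<le> 4*i+8 then stem_cyclic N (8*i+7) (k-4) (4*i+8-k)
     else stem_cyclic N (8*i+7) (4*i+4) 0) \<and>
    (if k \<le> 4*i+5 then stem_cyclic N (8*i+3) (k-2) (4*i+5-k)
     else stem_cyclic N (8*i+3) (4*i+3) 0)"
    by (auto split: if_split)
qed

end
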